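(* Let $P$ be an instance of the one-to-one two-sided matching market with $m$ workers and $n$ firms (positions), let $N=\max\{m,n\}$, let $D(P)$ be its matching digraph, and let $V^{in},V^{out}\subseteq V(D(P))$ be disjoint sets of vertices such that each worker and each firm appears in at most one pair of $V^{in}$. Then Algorithm 1 (described in the context), run on $(D(P),V^{in},V^{out})$, correctly solves the problem Reduced Constrained Stable Matchings: it returns exactly the set of all stable matchings of $D(P)$ that include all vertices in $V^{in}$ and do not include any vertex in $V^{out}$ (the empty set if there are none). Moreover, it does so in time $O(N^3+N^3 s)$, where $s$ is the number of stable matchings outputted by the algorithm, and the time between two consecutive stable matchings outputted by the algorithm is $O(N^3)$.
   Context: **Market.** An instance $P$ of the one-to-one two-sided matching market consists of disjoint finite sets $W$ of $m$ workers and $F$ of $n$ firms (each firm has one position). Each worker has a strict preference ordering over a nonempty list of (acceptable) firms, and each firm has a strict preference ordering over a nonempty list of (acceptable) workers; $w$ is acceptable to $f$ if and only if $f$ is acceptable to $w$, and then $(w,f)$ is called an acceptable pair. **Matching digraph.** $D(P)=(V,A)$, where $V\subseteq W\times F$ is the set of acceptable pairs and $A=A_W\cup A_F$ with $A_W=\{(w,f_i)(w,f_j) : w \text{ prefers } f_j \text{ to } f_i\}$ and $A_F=\{(w_i,f)(w_j,f): f\text{ prefers } w_j\text{ to } w_i\}$ (arc $xy$ goes from $x$ to $y$). The row of $w$ is the set of vertices with first coordinate $w$; the column of $f$ is the set of vertices with second coordinate $f$. All digraphs below are induced subdigraphs of $D(P)$. For such a digraph $D$ and $x\in V(D)$, $d_W^+(x)$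 and $d_F^+(x)$ denote the numbers of arcs of $D$ leaving $x$ that lie in $A_W$ and $A_F$ respectively. $D-x$ is $D$ with vertex $x$ deleted. **Stable matchings.** A matching in $D$ is an independent set of vertices (no two in the same row or column). A stable matching in $D$ is a matching $M$ such that every vertex of $D$ is in $M$ or has an out-neighbour in $M$. For $D=D(P)$ this is equivalent to having no blocking pair. **IDUA (iterated deletion of unattractive alternatives).** For a digraph $D$, $\mathcal R(D)$ is obtained from $D$ by deleting the following vertices: (i) whenever $(w,f)\in V(D)$ has no arc of $A_F$ leaving it in $D$, delete all $(w,f_i)\in V(D)$ with $(w,f_i)(w,f)\in A_W$; (ii) whenever $(w,f)\in V(D)$ has no arc of $A_W$ leaving it in $D$, delete all $(w_i,f)\in V(D)$ with $(w_i,f)(w,f)\in A_F$. Running IDUA on $D$ means applying $\mathcal R$ repeatedly until nothing changes. The normal form $D^*(P)$ is the result of running IDUA on $D(P)$. **Algorithm 1.** Input: $D(P),V^{in},V^{out}$. 1.1. Determine $D^*(P)$ by running IDUA. 1.2. Let $AllSolutions=\emptyset$ and let $r$ be the number of non-empty rows (equivalently, columns) of $D^*(P)$. 1.3. Call Algorithm 2$(D^*(P),V^{in},V^{out})$. 1.4. Return $AllSolutions$. **Algorithm 2**$(D,V^{in},V^{out})$ (recursive). 2.1. If $V^{in}\setminus V(D)\neq\emptyset$, return. For every $(w,f)\in V^{in}$, place all vertices different from $(w,f)$ in the same row or column as $(w,f)$ in $V^{out}$. 2.2. While there is a vertex $(w,f)\in V^{out}$ of $D$ with $d_W^+((w,f))=0$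 or $d_F^+((w,f))=0$, replace $D$ by the digraph obtained by running IDUA on $D-(w,f)$. 2.3. Let $M_W=\{x\in V(D): d_W^+(x)=0\}$ and $M_F=\{x\in V(D): d_F^+(x)=0\}$. 2.4. If $|M_W|<r$ or if $V^{in}\not\subseteq V(D)$, return. (One has $|M_W|=|M_F|$.) 2.5. If $M_W=M_F$, add $M_W$ to $AllSolutions$ (output $M_W$) and return. 2.6. If $M_W\neq M_F$, choose any $(w,f)\in M_W\setminus M_F$; (a) call Algorithm 2$(D,V^{in}\cup\{(w,f)\},V^{out})$; (b) call Algorithm 2$(D,V^{in},V^{out}\cup\{(w,f)\})$; then return. A stable matching is "outputted" when it is added to $AllSolutions$. Running time counts elementary operations. *)

theory Defs
  imports Main "HOL-Library.While_Combinator" "HOL-Library.Monad_Syntax"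
begin

section \<open>Markets and their matching digraphs\<close>

text \<open>
  Preference lists are ordered from most to least preferred. Only the values of
  \<open>wpref\<close> on workers and of \<open>fpref\<close> on firms are meaningful.
\<close>

record ('w, 'f) market =
  workers :: "'w set"
  firms :: "'f set"
  wpref :: "'w \<Rightarrow> 'f list"
  fpref :: "'f \<Rightarrow> 'w list"

definition valid_market :: "('w, 'f) market \<Rightarrow> bool" where
  "valid_market P \<longleftrightarrow>
     finite (workers P) \<and> finite (firms P) \<and>
     (\<forall>w\<in>workers P. wpref P w \<noteq> [] \<and> distinct (wpref P w) \<and> set (wpref P w) \<subseteq> firms P) \<and>
     (\<forall>f\<in>firms P. fpref P f \<noteq> [] \<and> distinct (fpref P f) \<and> set (fpref P f) \<subseteq> workers P) \<and>
     (\<forall>w\<in>workers P. \<forall>f\<in>firms P. f \<in> set (wpref P w) \<longleftrightarrow> w \<in> set (fpref P f))"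

text \<open>\<open>prefers xs y x\<close>: the owner of the list \<open>xs\<close> prefers \<open>y\<close> to \<open>x\<close>.\<close>

definition prefers :: "'a list \<Rightarrow> 'a \<Rightarrow> 'a \<Rightarrow> bool" where
  "prefers xs y x \<longleftrightarrow> (\<exists>i j. i < j \<and> j < length xs \<and> xs ! i = y \<and> xs ! j = x)"

definition vertices :: "('w, 'f) market \<Rightarrow> ('w \<times> 'f) set" where
  "vertices P = {(w, f). w \<in> workers P \<and> f \<in> set (wpref P w)}"

definition arcs_W :: "('w, 'f) market \<Rightarrow> (('w \<times> 'f) \<times> ('w \<times> 'f)) set" where
  "arcs_W P = {((w, f), (w', f')). (w, f) \<in> vertices P \<and> (w', f') \<in> vertices P \<and>
                 w = w' \<and> prefers (wpref P w) f' f}"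

definition arcs_F :: "('w, 'f) market \<Rightarrow> (('w \<times> 'f) \<times> ('w \<times> 'f)) set" where
  "arcs_F P = {((w, f), (w', f')). (w, f) \<in> vertices P \<and> (w', f') \<in> vertices P \<and>
                 f = f' \<and> prefers (fpref P f) w' w}"

text \<open>
  From here on a set \<open>D \<subseteq> vertices P\<close> stands for the subdigraph of the matching digraph
  induced by \<open>D\<close>.
\<close>

definition outdeg_W :: "('w, 'f) market \<Rightarrow> ('w \<times> 'f) set \<Rightarrow> 'w \<times> 'f \<Rightarrow> nat" where
  "outdeg_W P D x = card {y \<in> D. (x, y) \<in> arcs_W P}"

definition outdeg_F :: "('w, 'f) market \<Rightarrow> ('w \<times> 'f) set \<Rightarrow> 'w \<times> 'f \<Rightarrow> nat" where
  "outdeg_F P D x = card {y \<in> D. (x, y) \<in> arcs_F P}"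

definition matching :: "('w, 'f) market \<Rightarrow> ('w \<times> 'f) set \<Rightarrow> ('w \<times> 'f) set \<Rightarrow> bool" where
  "matching P D M \<longleftrightarrow> M \<subseteq> D \<and> (\<forall>x\<in>M. \<forall>y\<in>M. (x, y) \<notin> arcs_W P \<union> arcs_F P)"

definition stable_matching :: "('w, 'f) market \<Rightarrow> ('w \<times> 'f) set \<Rightarrow> ('w \<times> 'f) set \<Rightarrow> bool" where
  "stable_matching P D M \<longleftrightarrow>
     matching P D M \<and> (\<forall>x\<in>D. x \<in> M \<or> (\<exists>y\<in>M. (x, y) \<in> arcs_W P \<union> arcs_F P))"


section \<open>Iterated deletion of unattractive alternatives\<close>

definition idua_step :: "('w, 'f) market \<Rightarrow> ('w \<times> 'f) set \<Rightarrow> ('w \<times> 'f) set" where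
  "idua_step P D = D
     - {y \<in> D. \<exists>x\<in>D. (\<forall>z\<in>D. (x, z) \<notin> arcs_F P) \<and> (y, x) \<in> arcs_W P}
     - {y \<in> D. \<exists>x\<in>D. (\<forall>z\<in>D. (x, z) \<notin> arcs_W P) \<and> (y, x) \<in> arcs_F P}"

text \<open>In this and the following section, \<open>None\<close> is the result of a computation that diverges.\<close>

definition idua :: "('w, 'f) market \<Rightarrow> ('w \<times> 'f) set \<Rightarrow> ('w \<times> 'f) set option" where
  "idua P D = while_option (\<lambda>D. idua_step P D \<noteq> D) (idua_step P) D"


section \<open>The enumeration algorithm\<close>

definition heads_W :: "('w, 'f) market \<Rightarrow> ('w \<times> 'f) set \<Rightarrow> ('w \<times> 'f) set" where
  "heads_W P D = {x \<in> D. outdeg_W P D x = 0}"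

definition heads_F :: "('w, 'f) market \<Rightarrow> ('w \<times> 'f) set \<Rightarrow> ('w \<times> 'f) set" where
  "heads_F P D = {x \<in> D. outdeg_F P D x = 0}"

text \<open>
  The nondeterministic choices are resolved by a choice rule \<open>pick p X\<close>, which selects an element
  of the set \<open>X\<close> of candidates in the recursive call reached by the path \<open>p\<close> (\<open>True\<close> for the
  first, \<open>False\<close> for the second subcall). Within one call no set of candidates
  occurs twice, since the chosen vertex is either deleted or chosen last. So quantifying over all
  choice rules covers every way of making the choices.
\<close>

definition choice_rule :: "(bool list \<Rightarrow> 'v set \<Rightarrow> 'v) \<Rightarrow> bool" where
  "choice_rule pick \<longleftrightarrow> (\<forall>p X. X \<noteq> {} \<longrightarrow> pick p X \<in> X)"

partial_function (option) prune ::
  "('w, 'f) market \<Rightarrow> (('w \<times> 'f) set \<Rightarrow> 'w \<times> 'f) \<Rightarrow> ('w \<times> 'f) set \<Rightarrow> ('w \<times> 'f) set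
     \<Rightarrow> ('w \<times> 'f) set option" where
  "prune P sel Vout D =
     (let X = {x \<in> D. x \<in> Vout \<and> (outdeg_W P D x = 0 \<or> outdeg_F P D x = 0)} in
      if X = {} then Some D
      else do { D' \<leftarrow> idua P (D - {sel X}); prune P sel Vout D' })"

definition same_lines :: "('w \<times> 'f) set \<Rightarrow> ('w \<times> 'f) set \<Rightarrow> ('w \<times> 'f) set" where
  "same_lines D Vin = {y \<in> D. \<exists>x\<in>Vin. y \<noteq> x \<and> (fst y = fst x \<or> snd y = snd x)}"

text \<open>
  The algorithm returns a log of its recursive calls, with their arguments, and its outputs, in
  chronological order. The set of all solutions it collects is extracted by \<open>solutions\<close>.
\<close>

datatype ('w, 'f) event =
    Call "('w \<times> 'f) set" "('w \<times> 'f) set" "('w \<times> 'f) set"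
  | Output "('w \<times> 'f) set"

definition solutions :: "('w, 'f) event list \<Rightarrow> ('w \<times> 'f) set set" where
  "solutions evs = {M. Output M \<in> set evs}"

partial_function (option) enumerate_rec ::
  "('w, 'f) market \<Rightarrow> nat \<Rightarrow> (bool list \<Rightarrow> ('w \<times> 'f) set \<Rightarrow> 'w \<times> 'f) \<Rightarrow> bool list
     \<Rightarrow> ('w \<times> 'f) set \<Rightarrow> ('w \<times> 'f) set \<Rightarrow> ('w \<times> 'f) set \<Rightarrow> ('w, 'f) event list option" where
  "enumerate_rec P r pick p D Vin Vout =
     (if Vin - D \<noteq> {} then Some [Call D Vin Vout]
      else
        let Vout' = Vout \<union> same_lines D Vin in
        do {
          D' \<leftarrow> prune P (pick p) Vout' D;
          let MW = heads_W P D';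
          let MF = heads_F P D';
          if card MW < r \<or> \<not> Vin \<subseteq> D' then Some [Call D Vin Vout]
          else if MW = MF then Some [Call D Vin Vout, Output MW]
          else
            let x = pick p (MW - MF) in
            do {
              evs1 \<leftarrow> enumerate_rec P r pick (p @ [True]) D' (insert x Vin) Vout';
              evs2 \<leftarrow> enumerate_rec P r pick (p @ [False]) D' Vin (insert x Vout');
              Some (Call D Vin Vout # evs1 @ evs2)
            }
        })"

definition enumerate_stable ::
  "('w, 'f) market \<Rightarrow> (bool list \<Rightarrow> ('w \<times> 'f) set \<Rightarrow> 'w \<times> 'f)
     \<Rightarrow> ('w \<times> 'f) set \<Rightarrow> ('w \<times> 'f) set \<Rightarrow> ('w, 'f) event list option" where
  "enumerate_stable P pick Vin Vout =
     do {
       D \<leftarrow> idua P (vertices P);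
       enumerate_rec P (card (fst ` D)) pick [] D Vin Vout
     }"

definition valid_constraints ::
  "('w, 'f) market \<Rightarrow> ('w \<times> 'f) set \<Rightarrow> ('w \<times> 'f) set \<Rightarrow> bool" where
  "valid_constraints P Vin Vout \<longleftrightarrow>
     Vin \<subseteq> vertices P \<and> Vout \<subseteq> vertices P \<and> Vin \<inter> Vout = {} \<and> inj_on fst Vin \<and> inj_on snd Vin"


section \<open>A random access machine\<close>

text \<open>
  Time is measured on a random access machine with structured programs. Its memory consists of
  arrays of natural numbers with any fixed number of indices (scalars have none). The elementary
  operations are addition, (truncated) subtraction, comparison, Boolean connectives, array reads
  and writes, choosing a number, writing a number to the output tape, and branching. Each
  costs one or two units in addition to the evaluation of its operands and indices.
  There is deliberately no multiplication, so that long numbers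
  cannot be built up cheaply.
\<close>

datatype aexp =
    Const nat
  | Read nat "aexp list"
  | Plus aexp aexp
  | Minus aexp aexp

datatype bexp =
    Less aexp aexp
  | Not bexp
  | And bexp bexp

datatype com =
    Skip
  | Assign nat "aexp list" aexp
  | Choose nat "aexp list" aexp
  | Emit aexp
  | Seq com com
  | If bexp com com
  | While bexp com

type_synonym memory = "nat \<Rightarrow> nat list \<Rightarrow> nat"

primrec aval :: "memory \<Rightarrow> aexp \<Rightarrow> nat" where
  "aval mem (Const k) = k"
| "aval mem (Read a es) = mem a (map (aval mem) es)"
| "aval mem (Plus e1 e2) = aval mem e1 + aval mem e2"
| "aval mem (Minus e1 e2) = aval mem e1 - aval mem e2"

primrec bval :: "memory \<Rightarrow> bexp \<Rightarrow> bool" where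
  "bval mem (Less e1 e2) \<longleftrightarrow> aval mem e1 < aval mem e2"
| "bval mem (Not b) \<longleftrightarrow> \<not> bval mem b"
| "bval mem (And b1 b2) \<longleftrightarrow> bval mem b1 \<and> bval mem b2"

primrec acost :: "aexp \<Rightarrow> nat" where
  "acost (Const k) = 1"
| "acost (Read a es) = 1 + sum_list (map acost es)"
| "acost (Plus e1 e2) = 1 + acost e1 + acost e2"
| "acost (Minus e1 e2) = 1 + acost e1 + acost e2"

primrec bcost :: "bexp \<Rightarrow> nat" where
  "bcost (Less e1 e2) = 1 + acost e1 + acost e2"
| "bcost (Not b) = 1 + bcost b"
| "bcost (And b1 b2) = 1 + bcost b1 + bcost b2"

definition store :: "memory \<Rightarrow> nat \<Rightarrow> nat list \<Rightarrow> nat \<Rightarrow> memory" where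
  "store mem a is v = mem(a := (mem a)(is := v))"

text \<open>
  A configuration consists of the memory, the clock, the sequence of choices still to be made, and
  the output tape, on which each number is stamped with the time at which it has been written.
  Execution is deterministic once the sequence of choices is fixed.
\<close>

record config =
  mem :: memory
  clock :: nat
  choices :: "nat \<Rightarrow> nat"
  tape :: "(nat \<times> nat) list"

definition tick :: "nat \<Rightarrow> config \<Rightarrow> config" where
  "tick k s = s\<lparr>clock := clock s + k\<rparr>"

inductive exec :: "com \<Rightarrow> config \<Rightarrow> config \<Rightarrow> bool" where
  Skip: "exec Skip s (tick 1 s)"
| Assign:
    "exec (Assign a es e) s
       (tick (2 + sum_list (map acost es) + acost e)
         (s\<lparr>mem := store (mem s) a (map (aval (mem s)) es) (aval (mem s) e)\<rparr>))"
| Choose: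
    "\<lbrakk>b = aval (mem s) e; v = (if b = 0 then 0 else choices s 0 mod b)\<rbrakk> \<Longrightarrow>
     exec (Choose a es e) s
       (tick (2 + sum_list (map acost es) + acost e)
         (s\<lparr>mem := store (mem s) a (map (aval (mem s)) es) v,
            choices := (\<lambda>i. choices s (Suc i))\<rparr>))"
| Emit:
    "s' = tick (1 + acost e) s \<Longrightarrow>
     exec (Emit e) s (s'\<lparr>tape := tape s @ [(clock s', aval (mem s) e)]\<rparr>)"
| Seq: "\<lbrakk>exec c1 s s'; exec c2 s' s''\<rbrakk> \<Longrightarrow> exec (Seq c1 c2) s s''"
| IfTrue: "\<lbrakk>bval (mem s) b; exec c1 (tick (1 + bcost b) s) s'\<rbrakk> \<Longrightarrow> exec (If b c1 c2) s s'"
| IfFalse: "\<lbrakk>\<not> bval (mem s) b; exec c2 (tick (1 + bcost b) s) s'\<rbrakk> \<Longrightarrow> exec (If b c1 c2) s s'"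
| WhileFalse: "\<not> bval (mem s) b \<Longrightarrow> exec (While b c) s (tick (1 + bcost b) s)"
| WhileTrue:
    "\<lbrakk>bval (mem s) b; exec c (tick (1 + bcost b) s) s'; exec (While b c) s' s''\<rbrakk> \<Longrightarrow>
     exec (While b c) s s''"


section \<open>Running the algorithm on the machine\<close>

text \<open>
  The machine requires the workers and the firms to be numbered from 0. The input is the matching
  digraph together with the two sets of vertices: scalars 0 and 1 hold the numbers of workers and
  firms; arrays 2, 3 and 4 are the characteristic functions of the vertices, \<open>Vin\<close> and
  \<open>Vout\<close>; arrays 5 and 6 are those of the two arc sets, with \<open>[w, f, f']\<close> standing for the arc from
  \<open>(w, f)\<close> to \<open>(w, f')\<close>, and \<open>[w, f, w']\<close> for the one from \<open>(w, f)\<close> to \<open>(w', f)\<close>.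
\<close>

definition numbered_market :: "(nat, nat) market \<Rightarrow> bool" where
  "numbered_market P \<longleftrightarrow>
     workers P = {..<card (workers P)} \<and> firms P = {..<card (firms P)}"

definition input_memory ::
  "(nat, nat) market \<Rightarrow> (nat \<times> nat) set \<Rightarrow> (nat \<times> nat) set \<Rightarrow> memory" where
  "input_memory P Vin Vout a is =
     (case is of
        [] \<Rightarrow> if a = 0 then card (workers P) else if a = 1 then card (firms P) else 0
      | [w, f] \<Rightarrow>
          of_bool (a = 2 \<and> (w, f) \<in> vertices P \<or> a = 3 \<and> (w, f) \<in> Vin \<or> a = 4 \<and> (w, f) \<in> Vout)
      | [w, f, x] \<Rightarrow>
          of_bool (a = 5 \<and> ((w, f), (w, x)) \<in> arcs_W P \<or> a = 6 \<and> ((w, f), (x, f)) \<in> arcs_F P)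
      | _ \<Rightarrow> 0)"

definition start ::
  "(nat, nat) market \<Rightarrow> (nat \<times> nat) set \<Rightarrow> (nat \<times> nat) set \<Rightarrow> (nat \<Rightarrow> nat) \<Rightarrow> config" where
  "start P Vin Vout ch = \<lparr>mem = input_memory P Vin Vout, clock = 0, choices = ch, tape = []\<rparr>"

text \<open>
  With \<open>m\<close> workers and \<open>n\<close> firms, a call is written as 0 followed by the \<open>m * n\<close> entries (row by
  row) of the characteristic functions of its three arguments. A matching is written as 1 followed,
  for each worker, by 0 if the worker is unmatched, and otherwise by the successor of the partner.
\<close>

fun encode_event :: "nat \<Rightarrow> nat \<Rightarrow> (nat, nat) event \<Rightarrow> nat list" where
  "encode_event m n (Call D Vin Vout) =
     0 # concat (map (\<lambda>(w, f). [of_bool ((w, f) \<in> D), of_bool ((w, f) \<in> Vin), of_bool ((w, f) \<in> Vout)])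
                  (List.product [0..<m] [0..<n]))"
| "encode_event m n (Output M) =
     1 # map (\<lambda>w. if \<exists>f. (w, f) \<in> M then Suc (THE f. (w, f) \<in> M) else 0) [0..<m]"

text \<open>The times at which the matchings in the log have been completely written.\<close>

fun output_times :: "nat \<Rightarrow> nat \<Rightarrow> (nat, nat) event list \<Rightarrow> (nat \<times> nat) list \<Rightarrow> nat list" where
  "output_times m n [] tp = []"
| "output_times m n (Call D Vin Vout # evs) tp =
     output_times m n evs (drop (length (encode_event m n (Call D Vin Vout))) tp)"
| "output_times m n (Output M # evs) tp =
     fst (tp ! (length (encode_event m n (Output M)) - 1))
       # output_times m n evs (drop (length (encode_event m n (Output M))) tp)"

text \<open>
  \<open>timely_run prog C P Vin Vout ch pick\<close>: with choices \<open>ch\<close>, the program \<open>prog\<close> halts after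
  performing exactly the calls and outputs of the algorithm under the choice rule \<open>pick\<close>, and it
  meets the time bounds with constant \<open>C\<close>. The bounds are not required of the empty market, where
  \<open>N = 0\<close>.
\<close>

definition timely_run ::
  "com \<Rightarrow> nat \<Rightarrow> (nat, nat) market \<Rightarrow> (nat \<times> nat) set \<Rightarrow> (nat \<times> nat) set \<Rightarrow> (nat \<Rightarrow> nat)
     \<Rightarrow> (bool list \<Rightarrow> (nat \<times> nat) set \<Rightarrow> nat \<times> nat) \<Rightarrow> bool" where
  "timely_run prog C P Vin Vout ch pick \<longleftrightarrow>
     (let m = card (workers P); n = card (firms P); N = max m n in
      \<exists>t evs.
        exec prog (start P Vin Vout ch) t \<and>
        enumerate_stable P pick Vin Vout = Some evs \<and>
        map snd (tape t) = concat (map (encode_event m n) evs) \<and>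
        (N > 0 \<longrightarrow>
           clock t \<le> C * (N ^ 3 + N ^ 3 * card (solutions evs)) \<and>
           (let ts = output_times m n evs (tape t) in
            \<forall>k. Suc k < length ts \<longrightarrow> ts ! Suc k \<le> ts ! k + C * N ^ 3)))"

end

theory Submission
  imports Defs
begin

text \<open>
  A vertex deleted in step 2.2 is worse, for one of its two endpoints, than everything that remains in
  the line of that endpoint, and it belongs to no stable matching avoiding \<open>V\<^sup>o\<^sup>u\<^sup>t\<close>. Let \<open>S\<close> be the
  set of these matchings. If \<open>S\<close> is nonempty, what remains after step 2.2 therefore consists of the
  vertices that are, both in their row and in their column, at least as good as some vertex occurring in
  \<open>S\<close>, in whichever order the deletions were made. So the program is free to delete in an order
  of its own. Moreover \<open>M\<^sub>W\<close> and \<open>M\<^sub>F\<close> belong to \<open>S\<close>. Hence both subcalls of step 2.6 have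
  solutions, and all calls but possibly the first one lead to an output.

  The program keeps a stack of the lines whose heads may have changed. To process a line takes time
  \<open>O(N)\<close>, and a deletion puts two lines on the stack, so that a call takes time \<open>O(N\<^sup>2)\<close> plus
  \<open>O(N)\<close> for every deleted vertex. On the way to the next output the recursion descends through first
  subcalls only. Each of them adds a vertex to the matching \<open>V\<^sup>i\<^sup>n\<close> and works on what its caller has left
  of the digraph, which amounts to \<open>O(N\<^sup>3)\<close>. The second subcall is a tail call that overwrites
  the frame of its caller, so that returning takes no time.
\<close>

section \<open>Normal forms and stable matchings\<close>

text \<open>The time bounds concern a program whose tape shows exactly the calls of the algorithm,
  including the digraph handed to each subcall. Equal sets of solutions would not be enough for
  this; the remaining digraph must be the same, hence the equation with \<open>hull\<close>, in
  which no deletion occurs. If there is no solution, different orders may leave different digraphs,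
  but the call then ends and only its arguments at entry are on record. That no row or column is
  lost is argued in two ways. A pruning starts from a normal digraph, where a stable matching meets
  every line, so counting rows decides. The full digraph of the market is not normal and may lose
  lines under IDUA; there it is used that deleted vertices remain dominated by heads of the current
  digraph. Choice rules and sequences of machine choices are compared through trees of chosen
  vertices, since a rule is indexed by paths and a sequence by time. The gap between outputs is
  bounded by \<open>2 * max_potential\<close>: one part for finishing the iteration that wrote an
  output, one for the descent to the next.\<close>

definition heads :: "('v \<times> 'v) set \<Rightarrow> 'v set \<Rightarrow> 'v set" where
  "heads R D = {x \<in> D. \<forall>y\<in>D. (x, y) \<notin> R}"

definition tails :: "('v \<times> 'v) set \<Rightarrow> 'v set \<Rightarrow> 'v set" where
  "tails R D = {x \<in> D. \<forall>y\<in>D. (y, x) \<notin> R}"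

text \<open>The fixed points of IDUA, by \<open>normal_iff\<close>. Arcs lead to preferred vertices,
  so the best vertex of a row has to be the worst of its column, and conversely.\<close>

definition normal :: "('v \<times> 'v) set \<Rightarrow> ('v \<times> 'v) set \<Rightarrow> 'v set \<Rightarrow> bool" where
  "normal R T D \<longleftrightarrow> heads R D \<subseteq> tails T D \<and> heads T D \<subseteq> tails R D"

definition stable :: "('v \<times> 'v) set \<Rightarrow> ('v \<times> 'v) set \<Rightarrow> 'v set \<Rightarrow> 'v set \<Rightarrow> bool" where
  "stable R T D M \<longleftrightarrow> M \<subseteq> D \<and> (\<forall>x\<in>M. \<forall>y\<in>M. (x, y) \<notin> R \<union> T) \<and>
     (\<forall>x\<in>D. x \<in> M \<or> (\<exists>y\<in>M. (x, y) \<in> R \<union> T))"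

definition hull :: "('v \<times> 'v) set \<Rightarrow> ('v \<times> 'v) set \<Rightarrow> 'v set \<Rightarrow> 'v set set \<Rightarrow> 'v set" where
  "hull R T D S =
     {y \<in> D. (\<exists>z\<in>\<Union>S. z = y \<or> (z, y) \<in> R) \<and> (\<exists>z\<in>\<Union>S. z = y \<or> (z, y) \<in> T)}"

text \<open>The disjuncts are the deletion rules (i) and (ii): one round of IDUA removes exactly the
  dominated vertices.\<close>

definition dominated :: "('v \<times> 'v) set \<Rightarrow> ('v \<times> 'v) set \<Rightarrow> 'v set \<Rightarrow> 'v \<Rightarrow> bool" where
  "dominated R T D y \<longleftrightarrow> (\<exists>x\<in>heads T D. (y, x) \<in> R) \<or> (\<exists>x\<in>heads R D. (y, x) \<in> T)"

lemma stable_commute: "stable R T D M \<longleftrightarrow> stable T R D M"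
  by (simp add: stable_def Un_commute)

lemma heads_subset: "heads R D \<subseteq> D" and tails_subset: "tails R D \<subseteq> D"
  by (auto simp: heads_def tails_def)

lemma heads_mono: "x \<in> heads R D \<Longrightarrow> x \<in> D' \<Longrightarrow> D' \<subseteq> D \<Longrightarrow> x \<in> heads R D'"
  by (auto simp: heads_def)

section \<open>One side of the market: strict total orders on its lines\<close>

locale line_order =
  fixes R :: "('v \<times> 'v) set" and line :: "'v \<Rightarrow> 'a" and V :: "'v set"
  assumes finite_V: "finite V"
    and R_line: "(x, y) \<in> R \<Longrightarrow> x \<in> V \<and> y \<in> V \<and> line x = line y"
    and R_irrefl: "(x, x) \<notin> R"
    and R_trans: "(x, y) \<in> R \<Longrightarrow> (y, z) \<in> R \<Longrightarrow> (x, z) \<in> R"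
    and R_total: "x \<in> V \<Longrightarrow> y \<in> V \<Longrightarrow> line x = line y \<Longrightarrow> x \<noteq> y \<Longrightarrow> (x, y) \<in> R \<or> (y, x) \<in> R"
begin

lemma finite_R: "finite R"
  by (rule finite_subset[of _ "V \<times> V"]) (use R_line finite_V in auto)

lemma wf_R: "wf (R\<inverse>)" "wf R"
proof -
  have "trans R" using R_trans by (auto intro: transI)
  then have "acyclic R" using R_irrefl by (simp add: acyclic_def)
  then show "wf (R\<inverse>)" "wf R"
    using finite_R by (auto intro: finite_acyclic_wf finite_acyclic_wf_converse)
qed

lemma head_ex:
  assumes "x \<in> D"
  obtains h where "h \<in> heads R D" "line h = line x" "h = x \<or> (x, h) \<in> R"
proof -
  let ?Q = "{h \<in> D. h = x \<or> (x, h) \<in> R}"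
  have "x \<in> ?Q" using assms by simp
  then obtain h where h: "h \<in> ?Q" and max: "\<And>y. (y, h) \<in> R\<inverse> \<Longrightarrow> y \<notin> ?Q"
    using wf_R(1) by (metis (no_types, lifting) wfE_min)
  then have "h \<in> heads R D"
    by (auto simp: heads_def dest: R_trans)
  then show thesis using that h R_line by auto
qed

lemma tail_ex:
  assumes "x \<in> D"
  obtains t where "t \<in> tails R D" "line t = line x" "t = x \<or> (t, x) \<in> R"
proof -
  let ?Q = "{h \<in> D. h = x \<or> (h, x) \<in> R}"
  have "x \<in> ?Q" using assms by simp
  then obtain h where h: "h \<in> ?Q" and max: "\<And>y. (y, h) \<in> R \<Longrightarrow> y \<notin> ?Q"
    using wf_R(2) by (metis (no_types, lifting) wfE_min)
  then have "h \<in> tails R D"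
    by (auto simp: tails_def dest: R_trans)
  then show thesis using that h R_line by auto
qed

lemma inj_on_heads: "D \<subseteq> V \<Longrightarrow> inj_on line (heads R D)"
  by (rule inj_onI, simp add: heads_def) (meson R_total subset_eq)

lemma inj_on_tails: "D \<subseteq> V \<Longrightarrow> inj_on line (tails R D)"
  by (rule inj_onI, simp add: tails_def) (meson R_total subset_eq)

lemma line_heads: "line ` heads R D = line ` D"
proof
  show "line ` heads R D \<subseteq> line ` D" using heads_subset by (rule image_mono)
  show "line ` D \<subseteq> line ` heads R D" by (metis head_ex image_eqI image_subsetI)
qed

lemma line_tails: "line ` tails R D = line ` D"
proof
  show "line ` tails R D \<subseteq> line ` D" using tails_subset by (rule image_mono)
  show "line ` D \<subseteq> line ` tails R D" by (metis tail_ex image_eqI image_subsetI)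
qed

lemma card_heads: "D \<subseteq> V \<Longrightarrow> card (heads R D) = card (line ` D)"
  using inj_on_heads line_heads by (metis card_image)

lemma card_tails: "D \<subseteq> V \<Longrightarrow> card (tails R D) = card (line ` D)"
  using inj_on_tails line_tails by (metis card_image)

text \<open>Once everything worse than \<open>x\<close> has left a line, whatever remains there is
  \<open>x\<close> or better than \<open>x\<close>, so a vertex \<open>y\<close> worse than
  \<open>x\<close> is worse than all of it.\<close>

lemma below: "(y, x) \<in> R \<Longrightarrow> z \<in> V \<Longrightarrow> line z = line y \<Longrightarrow> (z, x) \<notin> R \<Longrightarrow> (y, z) \<in> R"
  using R_total[of x z] R_line R_trans by metis

text \<open>Since \<open>x\<close> has no out-neighbour in \<open>D\<close> along \<open>T\<close>,
  a matching inside \<open>D\<close> can answer \<open>x\<close> only along \<open>R\<close>. The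
  answering vertex is better than \<open>y\<close> too, and so excludes \<open>y\<close>. Stability
  refers to the original \<open>D0\<close>, whereas \<open>D\<close> is what deletions have
  left.\<close>

lemma dominated_not_stable:
  assumes "stable R T D0 M" "M \<subseteq> D" "D \<subseteq> D0" "x \<in> heads T D" "(y, x) \<in> R"
  shows "y \<notin> M"
proof
  assume y: "y \<in> M"
  then have "x \<in> D0" "x \<notin> M" using assms by (auto simp: heads_def stable_def)
  then obtain z where z: "z \<in> M" "(x, z) \<in> R \<union> T" using assms(1) by (auto simp: stable_def)
  then have "(x, z) \<in> R" using assms(2,4) by (auto simp: heads_def)
  then have "(y, z) \<in> R" using assms(5) R_trans by blast
  then show False using assms(1) y z by (auto simp: stable_def)
qed

text \<open>The vertex \<open>h\<close> is dominated neither along \<open>T\<close>, where it is a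
  head, nor along \<open>R\<close>, where it is best among such heads of its line. This is what lets
  it survive a round of deletions.\<close>

lemma best_head:
  assumes "x \<in> heads T D" "(y, x) \<in> R"
  obtains h where "h \<in> heads T D" "h \<in> heads R (heads T D)" "(y, h) \<in> R"
proof -
  obtain h where h: "h \<in> heads R (heads T D)" "h = x \<or> (x, h) \<in> R"
    using head_ex[OF assms(1)] by metis
  then have "(y, h) \<in> R" using assms(2) R_trans by blast
  then show thesis using that h heads_subset by fast
qed

text \<open>No arc of \<open>T\<close> enters a tail of \<open>T\<close>, so heads that are such
  tails are independent; any other vertex has an arc to the head of its own line.\<close>

lemma stable_heads:
  assumes "heads R D \<subseteq> tails T D"
  shows "stable R T D (heads R D)"
proof -
  have "(x, y) \<notin> R \<union> T" if "x \<in> heads R D" "y \<in> heads R D" for x y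
    using that assms by (auto simp: heads_def tails_def)
  then show ?thesis
    unfolding stable_def using heads_subset head_ex by (metis UnI1)
qed

text \<open>The worst vertex of a line of \<open>R\<close> has no arc of \<open>T\<close> leaving
  it. Hence it is matched itself, or answered by a matched vertex of the same line.\<close>

lemma stable_line:
  assumes "heads T D = tails R D" "stable R T D M"
  shows "line ` M = line ` D"
proof -
  have sub: "M \<subseteq> D" using assms(2) by (simp add: stable_def)
  have "line t \<in> line ` M" if "t \<in> tails R D" for t
  proof -
    have "t \<in> heads T D" using that assms(1) by blast
    then have "t \<in> M \<or> (\<exists>y\<in>M. (t, y) \<in> R)" using assms(2) sub unfolding stable_def heads_def by blast
    then show ?thesis using R_line by (metis image_eqI)
  qed
  then show ?thesis using line_tails sub by (metis image_mono image_subsetI subset_antisym)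
qed

text \<open>The vertex of \<open>M\<close> in the line of \<open>h\<close> is not worse than the
  tail \<open>h\<close>, and therefore beats everything that \<open>h\<close> beats.\<close>

lemma below_tail:
  assumes "line ` M = line ` D" "M \<subseteq> D" "D \<subseteq> V" "h \<in> tails R D" "(x, h) \<in> R"
  shows "\<exists>a\<in>M. (x, a) \<in> R"
proof -
  have "line h \<in> line ` M" using assms(1,4) tails_subset[of R D] by auto
  then obtain a where a: "a \<in> M" "line a = line h" by force
  then have "a \<in> V" "(a, h) \<notin> R" using assms(2-4) by (auto simp: tails_def)
  then show ?thesis using below[OF assms(5)] a R_line[OF assms(5)] by metis
qed

end

section \<open>Both sides together: deletions and stable matchings\<close>

locale matching_digraph =
  rows: line_order R row V + cols: line_order T col V
  for R T :: "('v \<times> 'v) set" and row :: "'v \<Rightarrow> 'a" and col :: "'v \<Rightarrow> 'b" and V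
begin

text \<open>The last clause compares a deleted vertex with what remains, and not with the vertex
  that caused its deletion, which may itself be gone by now. In this form it persists when
  \<open>D\<close> shrinks further.\<close>

definition reduced :: "'v set \<Rightarrow> 'v set \<Rightarrow> 'v set \<Rightarrow> bool" where
  "reduced D0 out D \<longleftrightarrow> D \<subseteq> D0 \<and> (\<forall>M. stable R T D0 M \<longrightarrow> M \<inter> out = {} \<longrightarrow> M \<subseteq> D) \<and>
     (\<forall>y\<in>D0 - D. (\<forall>z\<in>D. row z = row y \<longrightarrow> (y, z) \<in> R) \<or> (\<forall>z\<in>D. col z = col y \<longrightarrow> (y, z) \<in> T))"

lemma reduced_refl: "reduced D0 out D0"
  by (auto simp: reduced_def stable_def)

lemma stable_inj:
  assumes "stable R T D M" "D \<subseteq> V"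
  shows "inj_on row M" "inj_on col M"
proof -
  have M: "x \<in> V" "(x, y) \<notin> R" "(x, y) \<notin> T" if "x \<in> M" "y \<in> M" for x y
    using assms that by (auto simp: stable_def)
  show "inj_on row M" "inj_on col M"
    by (rule inj_onI, metis M rows.R_total cols.R_total)+
qed

text \<open>Several vertices may go at once: that no wanted matching contains them is judged in
  \<open>D\<close>, that each is at the bottom of a line is judged in \<open>D'\<close>.\<close>

lemma reduced_delete:
  assumes "reduced D0 out D" "D0 \<subseteq> V" "D' \<subseteq> D"
    and "\<And>y. y \<in> D - D' \<Longrightarrow> y \<in> out \<or> dominated R T D y"
    and "\<And>y. y \<in> D - D' \<Longrightarrow>
      (\<forall>z\<in>D'. row z = row y \<longrightarrow> (y, z) \<in> R) \<or> (\<forall>z\<in>D'. col z = col y \<longrightarrow> (y, z) \<in> T)"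
  shows "reduced D0 out D'"
  unfolding reduced_def
proof (intro conjI allI impI ballI)
  show "D' \<subseteq> D0" using assms by (auto simp: reduced_def)
next
  fix M assume M: "stable R T D0 M" "M \<inter> out = {}"
  then have "M \<subseteq> D" "D \<subseteq> D0" using assms(1) by (auto simp: reduced_def)
  then have "y \<notin> M" if "dominated R T D y" for y
    using rows.dominated_not_stable[OF M(1)] cols.dominated_not_stable[OF M(1)[unfolded stable_commute[of R]]] that
    unfolding dominated_def by blast
  then show "M \<subseteq> D'" using \<open>M \<subseteq> D\<close> M(2) assms(4) by blast
next
  fix y assume y: "y \<in> D0 - D'"
  show "(\<forall>z\<in>D'. row z = row y \<longrightarrow> (y, z) \<in> R) \<or> (\<forall>z\<in>D'. col z = col y \<longrightarrow> (y, z) \<in> T)"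
  proof (cases "y \<in> D")
    case True
    then show ?thesis using y assms(5) by blast
  next
    case False
    then have "(\<forall>z\<in>D. row z = row y \<longrightarrow> (y, z) \<in> R) \<or> (\<forall>z\<in>D. col z = col y \<longrightarrow> (y, z) \<in> T)"
      using y assms(1) by (auto simp: reduced_def)
    then show ?thesis using assms(3) by blast
  qed
qed

text \<open>The best head dominating \<open>y\<close> is not itself dominated, and hence survives.\<close>

lemma dominated_delete:
  assumes "dominated R T D y" "D' \<subseteq> D" "\<And>z. z \<in> D - D' \<Longrightarrow> dominated R T D z"
  shows "dominated R T D' y"
proof -
  have survives: "h \<in> D'" if "h \<in> D" "\<not> dominated R T D h" for h
    using assms(3) that by blast
  from assms(1) consider x where "x \<in> heads T D" "(y, x) \<in> R" | x where "x \<in> heads R D" "(y, x) \<in> T"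
    by (auto simp: dominated_def)
  then show ?thesis
  proof cases
    case 1
    obtain h where h: "h \<in> heads T D" "h \<in> heads R (heads T D)" "(y, h) \<in> R" using rows.best_head[OF 1] .
    then have "h \<in> D'" by (intro survives) (auto simp: dominated_def heads_def)
    then show ?thesis using heads_mono[OF h(1) _ assms(2)] h(3) by (auto simp: dominated_def)
  next
    case 2
    obtain h where h: "h \<in> heads R D" "h \<in> heads T (heads R D)" "(y, h) \<in> T" using cols.best_head[OF 2] .
    then have "h \<in> D'" by (intro survives) (auto simp: dominated_def heads_def)
    then show ?thesis using heads_mono[OF h(1) _ assms(2)] h(3) by (auto simp: dominated_def)
  qed
qed

lemma normal_iff: "D \<subseteq> V \<Longrightarrow> normal R T D \<longleftrightarrow> (\<forall>y\<in>D. \<not> dominated R T D y)"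
  unfolding normal_def dominated_def heads_def tails_def by blast

text \<open>Every nonempty line has one head and one tail. Row heads are column tails, so there are
  at most as many rows as columns, and the other inclusion gives the converse.\<close>

lemma normal_card:
  assumes "normal R T D" "D \<subseteq> V"
  shows "card (row ` D) = card (col ` D)"
proof -
  have fin: "finite (tails T D)" "finite (tails R D)"
    using assms(2) rows.finite_V tails_subset by (meson finite_subset)+
  have "card (heads R D) \<le> card (tails T D)" "card (heads T D) \<le> card (tails R D)"
    using assms(1) fin by (auto simp: normal_def intro: card_mono)
  then show ?thesis
    using rows.card_heads rows.card_tails cols.card_heads cols.card_tails assms(2) by simp
qed

text \<open>By \<open>normal_card\<close> the inclusions in \<open>normal\<close> are between finite
  sets of equal size.\<close>

lemma normal_heads:
  assumes "normal R T D" "D \<subseteq> V"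
  shows "heads R D = tails T D" "heads T D = tails R D"
proof -
  have fin: "finite (tails T D)" "finite (tails R D)"
    using assms(2) rows.finite_V tails_subset by (meson finite_subset)+
  show "heads R D = tails T D" "heads T D = tails R D"
    using assms fin normal_card[OF assms] rows.card_heads rows.card_tails cols.card_heads cols.card_tails
    by (simp_all add: normal_def card_subset_eq)
qed

lemma stable_heads:
  assumes "normal R T D" "D \<subseteq> V"
  shows "stable R T D (heads R D)" "stable R T D (heads T D)"
  using assms rows.stable_heads[of D T] cols.stable_heads[of D R]
  by (simp_all add: normal_def stable_commute[of T])

lemma stable_lines:
  assumes "normal R T D" "D \<subseteq> V" "stable R T D M"
  shows "row ` M = row ` D" "col ` M = col ` D"
  using normal_heads[OF assms(1,2)] rows.stable_line[OF _ assms(3)]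
    cols.stable_line[OF _ assms(3)[unfolded stable_commute[of R]]] by simp_all

text \<open>In a normal digraph the worst vertex of a row is a column head and the worst vertex of a
  column is a row head; both belong to members of \<open>S\<close>, so all of \<open>D\<close> lies
  in the hull. Conversely, a deleted vertex is worse in one of its lines than all of
  \<open>D\<close>, which contains every member of \<open>S\<close>.\<close>

lemma reduced_hull:
  assumes "reduced D0 out D" "D0 \<subseteq> V" "normal R T D"
    and "stable R T D0 (heads R D)" "heads R D \<inter> out = {}"
    and "stable R T D0 (heads T D)" "heads T D \<inter> out = {}"
  shows "D = hull R T D0 {M. stable R T D0 M \<and> M \<inter> out = {}}" (is "D = hull R T D0 ?S")
proof (intro subset_antisym subsetI)
  have DV: "D \<subseteq> V" using assms by (auto simp: reduced_def)
  fix y assume y: "y \<in> D"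
  obtain t where t: "t \<in> tails R D" "t = y \<or> (t, y) \<in> R" using rows.tail_ex[OF y] by metis
  obtain u where u: "u \<in> tails T D" "u = y \<or> (u, y) \<in> T" using cols.tail_ex[OF y] by metis
  have "heads T D \<in> ?S" "heads R D \<in> ?S" using assms by auto
  moreover have "t \<in> heads T D" "u \<in> heads R D" using t u normal_heads[OF assms(3) DV] by auto
  ultimately have "t \<in> \<Union>?S" "u \<in> \<Union>?S" by blast+
  then have "\<exists>z\<in>\<Union>?S. z = y \<or> (z, y) \<in> R" "\<exists>z\<in>\<Union>?S. z = y \<or> (z, y) \<in> T"
    using t(2) u(2) by (metis (lifting))+
  moreover have "y \<in> D0" using y assms(1) by (auto simp: reduced_def)
  ultimately show "y \<in> hull R T D0 ?S" by (simp add: hull_def)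
next
  fix y assume y: "y \<in> hull R T D0 ?S"
  have "\<Union>?S \<subseteq> D" using assms(1) by (auto simp: reduced_def)
  with y obtain t u where tu: "t \<in> D" "t = y \<or> (t, y) \<in> R" "u \<in> D" "u = y \<or> (u, y) \<in> T" "y \<in> D0"
    unfolding hull_def by blast
  show "y \<in> D"
  proof (rule ccontr)
    assume "y \<notin> D"
    then consider "\<forall>z\<in>D. row z = row y \<longrightarrow> (y, z) \<in> R" | "\<forall>z\<in>D. col z = col y \<longrightarrow> (y, z) \<in> T"
      using tu assms(1) by (auto simp: reduced_def)
    then show False
    proof cases
      case 1
      then show ?thesis using tu rows.R_line rows.R_irrefl rows.R_trans by metis
    next
      case 2
      then show ?thesis using tu cols.R_line cols.R_irrefl cols.R_trans by metis
    qed
  qed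
qed

text \<open>A stable matching of the normal \<open>D\<close> meets every line of \<open>D\<close>.
  If no line has been lost, it thus has a vertex in both lines of a deleted vertex, and in one of
  them the deleted vertex is worse.\<close>

lemma reduced_stable_iff:
  assumes "reduced D0 out D" "D0 \<subseteq> V" "normal R T D" "row ` D = row ` D0" "col ` D = col ` D0" "M \<inter> out = {}"
  shows "stable R T D M \<longleftrightarrow> stable R T D0 M"
proof
  have DV: "D \<subseteq> V" using assms by (auto simp: reduced_def)
  assume M: "stable R T D M"
  note lines = stable_lines[OF assms(3) DV M]
  have arc: "\<exists>y\<in>M. (x, y) \<in> R \<union> T" if x: "x \<in> D0 - D" for x
  proof -
    obtain a b where ab: "a \<in> M" "row a = row x" "b \<in> M" "col b = col x"
    proof -
      have "row x \<in> row ` M" "col x \<in> col ` M" using lines assms(4,5) x by auto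
      then show thesis using that by (metis imageE)
    qed
    have "M \<subseteq> D" using M by (simp add: stable_def)
    then have "a \<in> D" "b \<in> D" using ab by auto
    then have "(x, a) \<in> R \<or> (x, b) \<in> T" using assms(1) x ab unfolding reduced_def by metis
    then show ?thesis using ab by blast
  qed
  have "D \<subseteq> D0" using assms(1) by (simp add: reduced_def)
  then show "stable R T D0 M" using M arc unfolding stable_def by (meson DiffI subset_trans)
next
  assume M: "stable R T D0 M"
  then have "M \<subseteq> D" "D \<subseteq> D0" using assms(1,6) by (auto simp: reduced_def)
  then show "stable R T D M" using M by (auto simp: stable_def)
qed

text \<open>
  Hence the outcome of the deletions does not depend on their order, unless no stable matching
  avoids \<open>out\<close>.
\<close>

theorem reduced_final:
  assumes "reduced D0 out D" "D0 \<subseteq> V" "normal R T D0" "normal R T D" "(heads R D \<union> heads T D) \<inter> out = {}"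
  defines "S \<equiv> {M. stable R T D0 M \<and> M \<inter> out = {}}"
  shows "S \<noteq> {} \<longleftrightarrow> card (row ` D) = card (row ` D0)"
    and "S \<noteq> {} \<Longrightarrow> D = hull R T D0 S"
    and "S \<noteq> {} \<Longrightarrow> row ` D = row ` D0"
    and "S \<noteq> {} \<Longrightarrow> heads R D \<in> S \<and> heads T D \<in> S"
    and "S \<noteq> {} \<Longrightarrow> S = {M. stable R T D M \<and> M \<inter> out = {}}"
proof -
  have DV: "D \<subseteq> V" and sub: "D \<subseteq> D0" using assms(1,2) by (auto simp: reduced_def)
  have fin: "finite D0" using assms(2) rows.finite_V finite_subset by blast
  note c = normal_card[OF assms(3,2)] normal_card[OF assms(4) DV]
  \<comment> \<open>Counting rows suffices, since both digraphs are normal and so have as many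
    columns as rows.\<close>
  have lines: "row ` D = row ` D0 \<and> col ` D = col ` D0" if "card (row ` D) = card (row ` D0)"
  proof -
    have "row ` D \<subseteq> row ` D0" "col ` D \<subseteq> col ` D0" using sub by auto
    then show ?thesis using that c fin by (simp add: card_subset_eq)
  qed
  \<comment> \<open>Being stable in the normal \<open>D0\<close>, the matching meets every row of
    \<open>D0\<close>; as it lies in \<open>D\<close>, no row has disappeared.\<close>
  have ne: "card (row ` D) = card (row ` D0)" if M: "M \<in> S" for M
  proof -
    have "M \<subseteq> D" using M assms(1) by (auto simp: S_def reduced_def)
    then have "row ` D0 \<subseteq> row ` D" using stable_lines(1)[OF assms(3,2)] M unfolding S_def by blast
    then show ?thesis using sub by (metis image_mono subset_antisym)
  qed
  have iff: "stable R T D M \<longleftrightarrow> stable R T D0 M"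
    if "card (row ` D) = card (row ` D0)" "M \<inter> out = {}" for M
    using reduced_stable_iff[OF assms(1,2,4)] lines that by blast
  have hS: "heads R D \<in> S \<and> heads T D \<in> S" if "card (row ` D) = card (row ` D0)"
    using iff[OF that] stable_heads[OF assms(4) DV] assms(5) by (auto simp: S_def)
  show eq: "S \<noteq> {} \<longleftrightarrow> card (row ` D) = card (row ` D0)" using hS ne by blast
  assume "S \<noteq> {}"
  then have c: "card (row ` D) = card (row ` D0)" using eq by blast
  show "row ` D = row ` D0" "heads R D \<in> S \<and> heads T D \<in> S" "S = {M. stable R T D M \<and> M \<inter> out = {}}"
    using lines hS c iff by (auto simp: S_def)
  show "D = hull R T D0 S" unfolding S_def
    using reduced_hull[OF assms(1,2,4)] hS[OF c] by (auto simp: S_def)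
qed

text \<open>Here \<open>D0\<close> need not be normal and lines may vanish, so a deleted vertex need
  not have a matched vertex in both of its lines. It is instead dominated by a head of
  \<open>D\<close>, which is a tail in the line concerned, and a stable matching of \<open>D\<close>
  has a vertex there that is at least as good.\<close>

theorem dominated_final:
  assumes "reduced D0 {} D" "D0 \<subseteq> V" "normal R T D" "\<And>y. y \<in> D0 - D \<Longrightarrow> dominated R T D y"
  shows "stable R T D M \<longleftrightarrow> stable R T D0 M"
    and "D = hull R T D0 {M. stable R T D0 M}"
proof -
  have DV: "D \<subseteq> V" and sub: "D \<subseteq> D0" using assms(1,2) by (auto simp: reduced_def)
  have iff: "stable R T D M \<longleftrightarrow> stable R T D0 M" for M
  proof
    assume M: "stable R T D M"
    note lines = stable_lines[OF assms(3) DV M]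
    have MD: "M \<subseteq> D" using M by (simp add: stable_def)
    have "\<exists>y\<in>M. (x, y) \<in> R \<union> T" if x: "x \<in> D0 - D" for x
    proof -
      from assms(3,4) x have "(\<exists>h\<in>tails R D. (x, h) \<in> R) \<or> (\<exists>h\<in>tails T D. (x, h) \<in> T)"
        unfolding dominated_def normal_def by blast
      then show ?thesis
        using rows.below_tail[OF lines(1) MD DV] cols.below_tail[OF lines(2) MD DV] by blast
    qed
    then show "stable R T D0 M" using M sub unfolding stable_def by (meson DiffI subset_trans)
  next
    assume M: "stable R T D0 M"
    then have "M \<subseteq> D" using assms(1) by (auto simp: reduced_def)
    then show "stable R T D M" using M sub by (auto simp: stable_def)
  qed
  show "stable R T D M \<longleftrightarrow> stable R T D0 M" by (fact iff)
  show "D = hull R T D0 {M. stable R T D0 M}"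
    using reduced_hull[OF assms(1,2,3)] stable_heads[OF assms(3) DV] iff by auto
qed

text \<open>This is the elementary move of the program, and unlike step 2.2 it needs no normal
  digraph: once everything below \<open>x\<close> in its column is deleted, \<open>x\<close> is at
  the bottom and may be deleted as well if it has to be avoided.\<close>

lemma reduced_process:
  assumes "reduced D0 out D" "D0 \<subseteq> V" "x \<in> heads R D" "D' = D - {y. (y, x) \<in> T} - ({x} \<inter> out)"
  shows "reduced D0 out D'"
proof (rule reduced_delete[OF assms(1,2)])
  have DV: "D \<subseteq> V" using assms(1,2) by (auto simp: reduced_def)
  have xD: "x \<in> D" using assms(3) heads_subset by fast
  show "D' \<subseteq> D" using assms(4) by blast
  fix y assume y: "y \<in> D - D'"
  show "y \<in> out \<or> dominated R T D y" using y assms(3,4) by (auto simp: dominated_def)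
  consider "(y, x) \<in> T" | "y = x" "x \<notin> D'" using y assms(4) by auto
  then have "\<forall>z\<in>D'. col z = col y \<longrightarrow> (y, z) \<in> T"
  proof cases
    case 1
    have "z \<in> V" "(z, x) \<notin> T" if "z \<in> D'" for z using that assms(4) DV by auto
    then show ?thesis using cols.below[OF 1] by metis
  next
    \<comment> \<open>Nothing below \<open>x\<close> is left in the column, so the deleted
      \<open>x\<close> is worse than all that remains there.\<close>
    case 2
    have "z \<in> V" "(z, x) \<notin> T" "x \<in> V" if "z \<in> D'" for z using that assms(4) DV xD by auto
    then show ?thesis using cols.R_total[of x] 2 by metis
  qed
  then show "(\<forall>z\<in>D'. row z = row y \<longrightarrow> (y, z) \<in> R) \<or> (\<forall>z\<in>D'. col z = col y \<longrightarrow> (y, z) \<in> T)"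
    by blast
qed

end

section \<open>Correctness of the enumeration\<close>

lemma
  assumes "distinct xs"
  shows prefers_irrefl: "\<not> prefers xs x x"
    and prefers_trans: "prefers xs x y \<Longrightarrow> prefers xs y z \<Longrightarrow> prefers xs x z"
    and prefers_total: "x \<in> set xs \<Longrightarrow> y \<in> set xs \<Longrightarrow> x \<noteq> y \<Longrightarrow> prefers xs x y \<or> prefers xs y x"
proof -
  have idx: "i = j" if "i < length xs" "j < length xs" "xs ! i = xs ! j" for i j
    using that assms nth_eq_iff_index_eq by blast
  show "\<not> prefers xs x x"
    unfolding prefers_def by (metis idx less_trans nat_neq_iff)
  show "prefers xs x z" if xy: "prefers xs x y" and yz: "prefers xs y z"
  proof -
    obtain i j where i: "i < j" "j < length xs" "xs ! i = x" "xs ! j = y"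
      using xy by (auto simp: prefers_def)
    obtain k l where k: "k < l" "l < length xs" "xs ! k = y" "xs ! l = z"
      using yz by (auto simp: prefers_def)
    have "j = k" using i k by (intro idx) auto
    then show ?thesis unfolding prefers_def using i k by (metis less_trans)
  qed
  show "prefers xs x y \<or> prefers xs y x" if x: "x \<in> set xs" and y: "y \<in> set xs" and "x \<noteq> y"
  proof -
    obtain i j where "i < length xs" "xs ! i = x" "j < length xs" "xs ! j = y"
      using x y by (auto simp: in_set_conv_nth)
    then show ?thesis using \<open>x \<noteq> y\<close> unfolding prefers_def by (metis nat_neq_iff)
  qed
qed

section \<open>The matching digraph of a market\<close>

locale market =
  fixes P :: "('w, 'f) market"
  assumes valid: "valid_market P"
begin

abbreviation "V \<equiv> vertices P"
abbreviation "W \<equiv> arcs_W P"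
abbreviation "F \<equiv> arcs_F P"

lemma vertices_F: "(w, f) \<in> V \<longleftrightarrow> f \<in> firms P \<and> w \<in> set (fpref P f)"
  using valid unfolding valid_market_def vertices_def by fastforce

lemma vertices_W: "(w, f) \<in> V \<longleftrightarrow> w \<in> workers P \<and> f \<in> set (wpref P w)"
  by (simp add: vertices_def)

lemma vertices_subset: "V \<subseteq> workers P \<times> firms P"
  using vertices_F vertices_W by auto

lemma finite_vertices: "finite V"
  using vertices_subset valid finite_subset unfolding valid_market_def by blast

lemma distinct_pref:
  "(w, f) \<in> V \<Longrightarrow> distinct (wpref P w)" "(w, f) \<in> V \<Longrightarrow> distinct (fpref P f)"
  using valid vertices_F[of w f] vertices_W[of w f] unfolding valid_market_def by blast+

lemma arcs_W_iff: "((w, f), (w', f')) \<in> W \<longleftrightarrow>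
    (w, f) \<in> V \<and> (w', f') \<in> V \<and> w = w' \<and> prefers (wpref P w) f' f"
  by (simp add: arcs_W_def)

lemma arcs_F_iff: "((w, f), (w', f')) \<in> F \<longleftrightarrow>
    (w, f) \<in> V \<and> (w', f') \<in> V \<and> f = f' \<and> prefers (fpref P f) w' w"
  by (simp add: arcs_F_def)

sublocale matching_digraph W F fst snd V
proof
  fix x y z :: "'w \<times> 'f"
  obtain w f w' f' w'' f'' where [simp]: "x = (w, f)" "y = (w', f')" "z = (w'', f'')"
    by (metis surj_pair)
  show "(x, y) \<in> W \<Longrightarrow> x \<in> V \<and> y \<in> V \<and> fst x = fst y"
    by (auto simp: arcs_W_iff)
  show "(x, y) \<in> F \<Longrightarrow> x \<in> V \<and> y \<in> V \<and> snd x = snd y"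
    by (auto simp: arcs_F_iff)
  show "(x, x) \<notin> W"
  proof
    assume "(x, x) \<in> W"
    then have "(w, f) \<in> V" "prefers (wpref P w) f f" by (simp_all add: arcs_W_iff)
    then show False using prefers_irrefl distinct_pref(1) by metis
  qed
  show "(x, x) \<notin> F"
  proof
    assume "(x, x) \<in> F"
    then have "(w, f) \<in> V" "prefers (fpref P f) w w" by (simp_all add: arcs_F_iff)
    then show False using prefers_irrefl distinct_pref(2) by metis
  qed
  show "(x, y) \<in> W \<Longrightarrow> (y, z) \<in> W \<Longrightarrow> (x, z) \<in> W"
    using prefers_trans[of "wpref P w" f'' f' f] distinct_pref(1)[of w f] by (auto simp: arcs_W_iff)
  show "(x, y) \<in> F \<Longrightarrow> (y, z) \<in> F \<Longrightarrow> (x, z) \<in> F"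
    using prefers_trans[of "fpref P f" w'' w' w] distinct_pref(2)[of w f] by (auto simp: arcs_F_iff)
  show "x \<in> V \<Longrightarrow> y \<in> V \<Longrightarrow> fst x = fst y \<Longrightarrow> x \<noteq> y \<Longrightarrow> (x, y) \<in> W \<or> (y, x) \<in> W"
    using prefers_total[of "wpref P w" f f'] distinct_pref(1)[of w f] by (auto simp: arcs_W_iff vertices_W)
  show "x \<in> V \<Longrightarrow> y \<in> V \<Longrightarrow> snd x = snd y \<Longrightarrow> x \<noteq> y \<Longrightarrow> (x, y) \<in> F \<or> (y, x) \<in> F"
    using prefers_total[of "fpref P f" w w'] distinct_pref(2)[of w f] by (auto simp: arcs_F_iff vertices_F)
qed (fact finite_vertices)+

lemma stable_matching_eq: "stable_matching P D M \<longleftrightarrow> stable W F D M"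
  by (simp add: stable_matching_def matching_def stable_def)

lemma finite_digraph: "D \<subseteq> V \<Longrightarrow> finite D"
  using finite_vertices by (rule finite_subset[rotated])

lemma outdeg_0:
  assumes "D \<subseteq> V"
  shows "outdeg_W P D x = 0 \<longleftrightarrow> (\<forall>y\<in>D. (x, y) \<notin> W)"
    and "outdeg_F P D x = 0 \<longleftrightarrow> (\<forall>y\<in>D. (x, y) \<notin> F)"
  using finite_digraph[OF assms] by (auto simp: outdeg_W_def outdeg_F_def)

lemma heads_eq: "D \<subseteq> V \<Longrightarrow> heads_W P D = heads W D" "D \<subseteq> V \<Longrightarrow> heads_F P D = heads F D"
  by (auto simp: heads_W_def heads_F_def heads_def outdeg_0)

lemma idua_step_eq: "idua_step P D = {y \<in> D. \<not> dominated W F D y}"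
  unfolding idua_step_def dominated_def heads_def by blast

lemma reduced_idua_step:
  assumes "reduced D0 out D" "D0 \<subseteq> V"
  shows "reduced D0 out (idua_step P D)"
proof (rule reduced_delete[OF assms])
  have DV: "D \<subseteq> V" using assms by (auto simp: reduced_def)
  show "idua_step P D \<subseteq> D" by (auto simp: idua_step_eq)
  fix y assume y: "y \<in> D - idua_step P D"
  then show "y \<in> out \<or> dominated W F D y" by (auto simp: idua_step_eq)
  from y consider x where "x \<in> heads F D" "(y, x) \<in> W" | x where "x \<in> heads W D" "(y, x) \<in> F"
    by (auto simp: dominated_def idua_step_eq)
  then show "(\<forall>z\<in>idua_step P D. fst z = fst y \<longrightarrow> (y, z) \<in> W) \<or>
      (\<forall>z\<in>idua_step P D. snd z = snd y \<longrightarrow> (y, z) \<in> F)"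
  proof cases
    case 1
    then have "z \<in> V" "(z, x) \<notin> W" if "z \<in> idua_step P D" for z
      using that DV by (auto simp: idua_step_eq dominated_def)
    then show ?thesis using rows.below[OF 1(2)] by blast
  next
    case 2
    then have "z \<in> V" "(z, x) \<notin> F" if "z \<in> idua_step P D" for z
      using that DV by (auto simp: idua_step_eq dominated_def)
    then show ?thesis using cols.below[OF 2(2)] by blast
  qed
qed

text \<open>A vertex is deleted for being dominated in an earlier digraph, but dominance is needed
  in the final one; \<open>dominated_delete\<close> carries it through each round. The statement
  about \<open>reduced\<close> is for every \<open>D0\<close> because the run may occur in the
  middle of a pruning.\<close>

lemma idua_Some:
  assumes "D \<subseteq> V"
  obtains D' where "idua P D = Some D'" "D' \<subseteq> D" "normal W F D'"
    "\<And>D0 out. reduced D0 out D \<Longrightarrow> D0 \<subseteq> V \<Longrightarrow> reduced D0 out D'"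
    "\<And>y. y \<in> D - D' \<Longrightarrow> dominated W F D' y"
proof -
  let ?I = "\<lambda>D'. D' \<subseteq> D \<and> (\<forall>D0 out. reduced D0 out D \<longrightarrow> D0 \<subseteq> V \<longrightarrow> reduced D0 out D') \<and>
    (\<forall>y\<in>D - D'. dominated W F D' y)"
  have step: "?I (idua_step P D')" if "?I D'" for D'
  proof -
    have sub: "idua_step P D' \<subseteq> D'" by (auto simp: idua_step_eq)
    have dom: "dominated W F D' y" if "y \<in> D' - idua_step P D'" for y
      using that by (auto simp: idua_step_eq)
    have "dominated W F (idua_step P D') y" if "y \<in> D - idua_step P D'" for y
      using dominated_delete[OF _ sub dom] that dom \<open>?I D'\<close> by blast
    then show ?thesis using that sub reduced_idua_step by blast
  qed
  have "card (idua_step P D') < card D'" if "?I D'" "idua_step P D' \<noteq> D'" for D'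
    using that finite_digraph assms by (intro psubset_card_mono) (auto simp: idua_step_eq finite_digraph)
  then have "\<exists>D'. idua P D = Some D'"
    unfolding idua_def using step
    by (intro measure_while_option_Some[where P = ?I and f = card]) auto
  then obtain D' where D': "idua P D = Some D'" by blast
  have "?I D" by blast
  from while_option_rule[where P = ?I, OF step D'[unfolded idua_def] this] have "?I D'" .
  moreover have "idua_step P D' = D'"
    using while_option_stop[OF D'[unfolded idua_def]] by simp
  then have "normal W F D'" using normal_iff[of D'] \<open>?I D'\<close> assms by (auto simp: idua_step_eq)
  ultimately show thesis using that D' by blast
qed

text \<open>All that is retained of a pruning. The loop of step 2.2 and the stack of the program
  both end in such a digraph.\<close>

definition final :: "('w \<times> 'f) set \<Rightarrow> ('w \<times> 'f) set \<Rightarrow> ('w \<times> 'f) set \<Rightarrow> bool" where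
  "final D0 out D \<longleftrightarrow> reduced D0 out D \<and> normal W F D \<and> (heads W D \<union> heads F D) \<inter> out = {}"

lemma final_subset: "final D0 out D \<Longrightarrow> D \<subseteq> D0"
  by (simp add: final_def reduced_def)

text \<open>In a normal digraph a head of one side is a tail of the other, so it is at the bottom of
  a line.\<close>

lemma reduced_delete_head:
  assumes "reduced D0 out D" "D0 \<subseteq> V" "normal W F D" "x \<in> out" "x \<in> heads W D \<or> x \<in> heads F D"
  shows "reduced D0 out (D - {x})"
proof (rule reduced_delete[OF assms(1,2)])
  have DV: "D \<subseteq> V" using assms by (auto simp: reduced_def)
  fix y assume "y \<in> D - (D - {x})"
  then have [simp]: "y = x" and xD: "x \<in> D" by auto
  show "y \<in> out \<or> dominated W F D y" using assms by simp
  consider "x \<in> tails F D" | "x \<in> tails W D" using assms(3,5) by (auto simp: normal_def)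
  then show "(\<forall>z\<in>D - {x}. fst z = fst y \<longrightarrow> (y, z) \<in> W) \<or> (\<forall>z\<in>D - {x}. snd z = snd y \<longrightarrow> (y, z) \<in> F)"
  proof cases
    case 1
    then have "\<forall>z\<in>D - {x}. snd z = snd y \<longrightarrow> (y, z) \<in> F"
      using cols.R_total[of x] xD DV by (fastforce simp: tails_def)
    then show ?thesis ..
  next
    case 2
    then have "\<forall>z\<in>D - {x}. fst z = fst y \<longrightarrow> (y, z) \<in> W"
      using rows.R_total[of x] xD DV by (fastforce simp: tails_def)
    then show ?thesis ..
  qed
qed auto

lemma prune_Some:
  assumes "reduced D0 out D" "D0 \<subseteq> V" "normal W F D" "\<And>X. X \<noteq> {} \<Longrightarrow> sel X \<in> X"
  shows "\<exists>D'. prune P sel out D = Some D' \<and> final D0 out D'"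
  using assms(1,3)
proof (induction "card D" arbitrary: D rule: less_induct)
  case less
  have DV: "D \<subseteq> V" using less.prems assms(2) by (auto simp: reduced_def)
  let ?X = "{x \<in> D. x \<in> out \<and> (outdeg_W P D x = 0 \<or> outdeg_F P D x = 0)}"
  have X: "?X = out \<inter> (heads W D \<union> heads F D)"
    by (auto simp: outdeg_0[OF DV] heads_def)
  show ?case
  proof (cases "?X = {}")
    case True
    then have "prune P sel out D = Some D" by (subst prune.simps) (simp only: Let_def simp_thms if_True)
    then show ?thesis using less.prems True X by (auto simp: final_def)
  next
    case False
    let ?x = "sel ?X"
    have x: "?x \<in> ?X" by (rule assms(4)[OF False])
    then have red: "reduced D0 out (D - {?x})"
      using reduced_delete_head[OF less.prems(1) assms(2) less.prems(2)] X by blast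
    obtain D' where D': "idua P (D - {?x}) = Some D'" "D' \<subseteq> D - {?x}" "normal W F D'" "reduced D0 out D'"
    proof -
      have "D - {?x} \<subseteq> V" using DV by blast
      then show thesis
      proof (rule idua_Some)
        fix D'
        assume "idua P (D - {?x}) = Some D'" "D' \<subseteq> D - {?x}" "normal W F D'"
          and "\<And>D0 out. reduced D0 out (D - {?x}) \<Longrightarrow> D0 \<subseteq> V \<Longrightarrow> reduced D0 out D'"
        then show thesis using that red assms(2) by presburger
      qed
    qed
    have "card D' < card D"
      using D'(2) x finite_digraph[OF DV] by (intro psubset_card_mono) auto
    then obtain D'' where "prune P sel out D' = Some D''" "final D0 out D''"
      using less.hyps D' by blast
    moreover have "prune P sel out D = prune P sel out D'"
      by (subst prune.simps) (simp only: Let_def False if_False D' bind.bind_lunit)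
    ultimately show ?thesis by simp
  qed
qed

section \<open>Solutions of a call and how a branching divides them\<close>

definition sols :: "('w \<times> 'f) set \<Rightarrow> ('w \<times> 'f) set \<Rightarrow> ('w \<times> 'f) set \<Rightarrow> ('w \<times> 'f) set set" where
  "sols D inn out = {M. stable W F D M \<and> inn \<subseteq> M \<and> M \<inter> out = {}}"

text \<open>What remains of \<open>D\<close> after step 2.2, if there is a solution.\<close>

definition pruned :: "('w \<times> 'f) set \<Rightarrow> ('w \<times> 'f) set \<Rightarrow> ('w \<times> 'f) set \<Rightarrow> ('w \<times> 'f) set" where
  "pruned D inn out = hull W F D (sols D inn out)"

text \<open>A stable matching of a normal digraph has exactly one vertex in every nonempty row, so
  avoiding all competitors of a vertex forces it in. Thus step 2.1 turns the constraint
  \<open>inn\<close> into one of avoidance, the only kind that pruning deals with.\<close>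

lemma sols_same_lines:
  assumes "D \<subseteq> V" "normal W F D" "inn \<subseteq> D"
  shows "sols D inn out = {M. stable W F D M \<and> M \<inter> (out \<union> same_lines D inn) = {}}"
proof -
  have "M \<inter> same_lines D inn = {} \<longleftrightarrow> inn \<subseteq> M" if M: "stable W F D M" for M
  proof
    have MV: "M \<subseteq> V" using M assms(1) by (auto simp: stable_def)
    note inj = stable_inj[OF M assms(1)]
    show "inn \<subseteq> M \<Longrightarrow> M \<inter> same_lines D inn = {}"
      using inj_onD[OF inj(1)] inj_onD[OF inj(2)] unfolding same_lines_def by blast
    assume empty: "M \<inter> same_lines D inn = {}"
    show "inn \<subseteq> M"
    proof
      fix x assume x: "x \<in> inn"
      then have "fst x \<in> fst ` M" using stable_lines(1)[OF assms(2,1) M] assms(3) by auto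
      then obtain z where z: "z \<in> M" "fst z = fst x" by force
      have "z \<in> D" using z M by (auto simp: stable_def)
      then have "z = x" using empty z x unfolding same_lines_def by blast
      then show "x \<in> M" using z by simp
    qed
  qed
  then show ?thesis unfolding sols_def by blast
qed

text \<open>
  Everything that the algorithm looks at after step 2.2 is independent of how the pruning is done:
  either all prunings lead to failure, or all yield the same digraph.
\<close>

theorem final_sols:
  assumes "D \<subseteq> V" "normal W F D" "final D (out \<union> same_lines D inn) D'"
  shows "sols D inn out \<noteq> {} \<longleftrightarrow> card (fst ` D') = card (fst ` D) \<and> inn \<subseteq> D'"
    and "sols D inn out \<noteq> {} \<Longrightarrow> D' = pruned D inn out"
proof -
  let ?out = "out \<union> same_lines D inn"
  let ?S = "{M. stable W F D M \<and> M \<inter> ?out = {}}"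
  have red: "reduced D ?out D'" and nrm: "normal W F D'" and hd: "(heads W D' \<union> heads F D') \<inter> ?out = {}"
    using assms(3) by (auto simp: final_def)
  note fin = reduced_final[OF red assms(1,2) nrm hd]
  have inn: "inn \<subseteq> D" if "sols D inn out \<noteq> {}"
    using that by (auto simp: sols_def stable_def)
  have sols: "sols D inn out = ?S" if "inn \<subseteq> D"
    using sols_same_lines[OF assms(1,2) that] .
  show "D' = pruned D inn out" if "sols D inn out \<noteq> {}"
    using fin(2) sols inn that by (simp add: pruned_def)
  have "D' \<subseteq> D" using final_subset assms(3) .
  moreover have "inn \<subseteq> D'" if ne: "sols D inn out \<noteq> {}"
  proof -
    obtain M where "M \<in> sols D inn out" using ne by blast
    then have "M \<in> ?S" "inn \<subseteq> M" using sols[OF inn[OF ne]] by (blast, simp add: sols_def)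
    moreover from this have "M \<subseteq> D'" using red unfolding reduced_def by blast
    ultimately show ?thesis by blast
  qed
  ultimately show "sols D inn out \<noteq> {} \<longleftrightarrow> card (fst ` D') = card (fst ` D) \<and> inn \<subseteq> D'"
    using fin(1) sols inn by (cases "inn \<subseteq> D") auto
qed

lemma final_ex:
  assumes "D \<subseteq> V" "normal W F D"
  obtains D' where "final D out D'"
proof -
  have "\<And>X. X \<noteq> {} \<Longrightarrow> (SOME x. x \<in> X) \<in> X" by (simp add: some_in_eq)
  then show thesis
    using prune_Some[OF reduced_refl assms(1,2), of "\<lambda>X. SOME x. x \<in> X"] that by blast
qed

lemma pruned:
  assumes "D \<subseteq> V" "normal W F D" "sols D inn out \<noteq> {}"
  defines "D' \<equiv> pruned D inn out" and "out' \<equiv> out \<union> same_lines D inn"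
  shows "D' \<subseteq> D" "normal W F D'" "fst ` D' = fst ` D"
    and "heads W D' \<in> sols D inn out" "heads F D' \<in> sols D inn out"
    and "sols D' inn out' = sols D inn out"
proof -
  obtain E where E: "final D out' E" using final_ex[OF assms(1,2)] .
  have ED: "E = D'" using final_sols(2)[OF assms(1,2), of out inn E] E assms(3) by (simp add: D'_def out'_def)
  have inn: "inn \<subseteq> D" using assms(3) by (auto simp: sols_def stable_def)
  note S = sols_same_lines[OF assms(1,2) inn, of out, folded out'_def]
  have red: "reduced D out' D'" and nrm: "normal W F D'" and hd: "(heads W D' \<union> heads F D') \<inter> out' = {}"
    using E ED by (auto simp: final_def)
  note fin = reduced_final(2-)[OF red assms(1,2) nrm hd, folded S, OF assms(3)]
  show "D' \<subseteq> D" using E ED final_subset by blast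
  show "normal W F D'" by (fact nrm)
  show "fst ` D' = fst ` D" "heads W D' \<in> sols D inn out" "heads F D' \<in> sols D inn out" using fin by auto
  have "inn \<subseteq> M" if "M \<in> sols D inn out" for M using that by (simp add: sols_def)
  then show "sols D' inn out' = sols D inn out" using fin(4) unfolding sols_def[of D' inn out'] by blast
qed

text \<open>The witnesses are \<open>heads W D'\<close>, which contains \<open>x\<close>, and
  \<open>heads F D'\<close>, which does not. The latter contains \<open>inn\<close>, so
  \<open>x\<close> is new: every first subcall enlarges \<open>inn\<close>.\<close>

lemma sols_split:
  assumes "D \<subseteq> V" "normal W F D" "sols D inn out \<noteq> {}"
  defines "D' \<equiv> pruned D inn out" and "out' \<equiv> out \<union> same_lines D inn"
  assumes "x \<in> heads W D' - heads F D'"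
  shows "sols D' (insert x inn) out' = {M \<in> sols D inn out. x \<in> M}"
    and "sols D' inn (insert x out') = {M \<in> sols D inn out. x \<notin> M}"
    and "sols D' (insert x inn) out' \<noteq> {}" "sols D' inn (insert x out') \<noteq> {}"
    and "x \<notin> inn"
proof -
  note p = pruned[OF assms(1-3), folded D'_def out'_def]
  show 1: "sols D' (insert x inn) out' = {M \<in> sols D inn out. x \<in> M}"
    and 2: "sols D' inn (insert x out') = {M \<in> sols D inn out. x \<notin> M}"
    using p(6) unfolding sols_def by auto
  show "sols D' (insert x inn) out' \<noteq> {}" "sols D' inn (insert x out') \<noteq> {}"
    using 1 2 p(4,5) assms(6) by auto
  show "x \<notin> inn" using p(5) assms(6) by (auto simp: sols_def)
qed

text \<open>If the heads of both sides coincide, the best vertex of each row is also its worst. Rows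
  are then singletons, the whole of \<open>D'\<close> is independent, and it is its only stable
  matching.\<close>

lemma sols_single:
  assumes "D \<subseteq> V" "normal W F D" "sols D inn out \<noteq> {}"
  defines "D' \<equiv> pruned D inn out"
  assumes "heads W D' = heads F D'"
  shows "sols D inn out = {heads W D'}"
proof -
  note p = pruned[OF assms(1-3), folded D'_def]
  have "M = heads W D'" if "M \<in> sols D' inn (out \<union> same_lines D inn)" for M
  proof -
    have D'V: "D' \<subseteq> V" using p(1) assms(1) by blast
    have hd: "heads W D' = tails W D'" using normal_heads[OF p(2) D'V] assms(5) by simp
    have "x \<in> heads W D'" if x: "x \<in> D'" for x
    proof -
      obtain h where h: "h \<in> heads W D'" "h = x \<or> (x, h) \<in> W" using rows.head_ex[OF x] by metis
      then show ?thesis using hd x by (auto simp: tails_def)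
    qed
    then have D': "D' = heads W D'" by (intro subset_antisym heads_subset subsetI)
    have M: "stable W F D' M" using that by (simp add: sols_def)
    then have "x \<in> M" if "x \<in> D'" for x
    proof -
      have "(x, y) \<notin> W \<union> F" if "y \<in> D'" for y
        using \<open>x \<in> D'\<close> that D' assms(5) by (auto simp: heads_def)
      then show ?thesis using M \<open>x \<in> D'\<close> unfolding stable_def by blast
    qed
    then show ?thesis using M D' by (auto simp: stable_def)
  qed
  then show ?thesis using p(4) p(6) by blast
qed

end

section \<open>Recursion trees and their logs\<close>

datatype 'v tree = Leaf | Node 'v "'v tree" "'v tree"

primrec label :: "'v tree \<Rightarrow> bool list \<Rightarrow> 'v option" where
  "label Leaf p = None"
| "label (Node x t1 t2) p = (case p of [] \<Rightarrow> Some x | True # q \<Rightarrow> label t1 q | False # q \<Rightarrow> label t2 q)"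

context market
begin

text \<open>Only the chosen vertices are stored, the arguments of the calls being recomputed through
  \<open>pruned\<close>. Requiring a solution at each node excludes failing calls. Both a choice
  rule and a sequence of machine choices determine such a tree.\<close>

primrec rec_tree :: "('w \<times> 'f) tree \<Rightarrow> ('w \<times> 'f) set \<Rightarrow> ('w \<times> 'f) set \<Rightarrow> ('w \<times> 'f) set \<Rightarrow> bool" where
  "rec_tree Leaf D inn out \<longleftrightarrow> sols D inn out \<noteq> {} \<and>
     heads W (pruned D inn out) = heads F (pruned D inn out)"
| "rec_tree (Node x t1 t2) D inn out \<longleftrightarrow> sols D inn out \<noteq> {} \<and>
     x \<in> heads W (pruned D inn out) - heads F (pruned D inn out) \<and>
     rec_tree t1 (pruned D inn out) (insert x inn) (out \<union> same_lines D inn) \<and>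
     rec_tree t2 (pruned D inn out) inn (insert x (out \<union> same_lines D inn))"

primrec log_tree ::
  "('w \<times> 'f) tree \<Rightarrow> ('w \<times> 'f) set \<Rightarrow> ('w \<times> 'f) set \<Rightarrow> ('w \<times> 'f) set \<Rightarrow> ('w, 'f) event list" where
  "log_tree Leaf D inn out = [Call D inn out, Output (heads W (pruned D inn out))]"
| "log_tree (Node x t1 t2) D inn out = Call D inn out #
     log_tree t1 (pruned D inn out) (insert x inn) (out \<union> same_lines D inn) @
     log_tree t2 (pruned D inn out) inn (insert x (out \<union> same_lines D inn))"

lemma finite_sols: "D \<subseteq> V \<Longrightarrow> finite (sols D inn out)"
  by (rule finite_subset[of _ "Pow D"]) (auto simp: sols_def stable_def finite_digraph)

text \<open>Each subcall misses a solution of the other, so the number of solutions serves as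
  induction measure for the recursion.\<close>

lemma card_sols_split:
  assumes "D \<subseteq> V" "normal W F D" "sols D inn out \<noteq> {}"
  defines "D' \<equiv> pruned D inn out" and "out' \<equiv> out \<union> same_lines D inn"
  assumes "x \<in> heads W D' - heads F D'"
  shows "card (sols D' (insert x inn) out') < card (sols D inn out)"
    and "card (sols D' inn (insert x out')) < card (sols D inn out)"
proof -
  note s = sols_split[OF assms(1-3), folded D'_def out'_def, OF assms(6)]
  show "card (sols D' (insert x inn) out') < card (sols D inn out)"
    and "card (sols D' inn (insert x out')) < card (sols D inn out)"
    using s finite_sols[OF assms(1)] by (auto intro!: psubset_card_mono)
qed

lemma solutions_simps [simp]:
  "solutions [] = {}" "solutions (Call D inn out # evs) = solutions evs"
  "solutions (Output M # evs) = insert M (solutions evs)"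
  "solutions (evs1 @ evs2) = solutions evs1 \<union> solutions evs2"
  by (auto simp: solutions_def)

lemma solutions_log_tree:
  "rec_tree t D inn out \<Longrightarrow> D \<subseteq> V \<Longrightarrow> normal W F D \<Longrightarrow> solutions (log_tree t D inn out) = sols D inn out"
proof (induction t arbitrary: D inn out)
  case Leaf
  then show ?case using sols_single by simp
next
  case (Node x t1 t2)
  let ?D = "pruned D inn out"
  from Node.prems have ne: "sols D inn out \<noteq> {}" and x: "x \<in> heads W ?D - heads F ?D" by auto
  note p = pruned[OF Node.prems(2,3) ne] sols_split[OF Node.prems(2,3) ne x]
  have "?D \<subseteq> V" using p(1) Node.prems(2) by blast
  then show ?case using Node.IH Node.prems p by auto
qed

definition outputs :: "('w, 'f) event list \<Rightarrow> nat" where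
  "outputs evs = length (filter (\<lambda>e. case e of Output M \<Rightarrow> True | _ \<Rightarrow> False) evs)"

lemma outputs_simps [simp]:
  "outputs [] = 0" "outputs (Call D inn out # evs) = outputs evs"
  "outputs (Output M # evs) = Suc (outputs evs)"
  "outputs (evs1 @ evs2) = outputs evs1 + outputs evs2"
  by (auto simp: outputs_def)

text \<open>The time bound counts distinct matchings, the clock counts output events. They agree
  because one subcall finds matchings containing \<open>x\<close> and the other matchings without
  it.\<close>

lemma outputs_log_tree:
  "rec_tree t D inn out \<Longrightarrow> D \<subseteq> V \<Longrightarrow> normal W F D \<Longrightarrow>
     outputs (log_tree t D inn out) = card (solutions (log_tree t D inn out))"
proof (induction t arbitrary: D inn out)
  case Leaf
  then show ?case by simp
next
  case (Node x t1 t2)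
  let ?D = "pruned D inn out" and ?out = "out \<union> same_lines D inn"
  from Node.prems have ne: "sols D inn out \<noteq> {}" and x: "x \<in> heads W ?D - heads F ?D" by auto
  note p = pruned[OF Node.prems(2,3) ne] sols_split[OF Node.prems(2,3) ne x]
  have DV: "?D \<subseteq> V" using p(1) Node.prems(2) by blast
  have t: "rec_tree t1 ?D (insert x inn) ?out" "rec_tree t2 ?D inn (insert x ?out)" using Node.prems by auto
  have "card (sols ?D (insert x inn) ?out \<union> sols ?D inn (insert x ?out)) =
      card (sols ?D (insert x inn) ?out) + card (sols ?D inn (insert x ?out))"
    by (intro card_Un_disjoint finite_sols[OF DV]) (auto simp: sols_def)
  then show ?case
    using Node.IH(1)[OF t(1) DV p(2)] Node.IH(2)[OF t(2) DV p(2)]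
      solutions_log_tree[OF t(1) DV p(2)] solutions_log_tree[OF t(2) DV p(2)] by simp
qed

text \<open>The rule \<open>pick\<close> resolves both the deletions and the branching of a call; by
  \<open>final_sols\<close> the former leave no trace in the log. The row count of the current
  digraph stands for \<open>r\<close>, as pruning with a solution preserves the rows.\<close>

lemma enumerate_rec_unfold:
  fixes inn out :: "('w \<times> 'f) set"
  assumes "D \<subseteq> V" "normal W F D" "choice_rule pick"
  defines "out' \<equiv> out \<union> same_lines D inn"
  shows "sols D inn out = {} \<Longrightarrow> enumerate_rec P (card (fst ` D)) pick p D inn out = Some [Call D inn out]"
    and "sols D inn out \<noteq> {} \<Longrightarrow> enumerate_rec P (card (fst ` D)) pick p D inn out =
      (let D' = pruned D inn out; MW = heads W D'; MF = heads F D' in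
       if MW = MF then Some [Call D inn out, Output MW]
       else
         let x = pick p (MW - MF) in
         do {
           evs1 \<leftarrow> enumerate_rec P (card (fst ` D')) pick (p @ [True]) D' (insert x inn) out';
           evs2 \<leftarrow> enumerate_rec P (card (fst ` D')) pick (p @ [False]) D' inn (insert x out');
           Some (Call D inn out # evs1 @ evs2)
         })" (is "_ \<Longrightarrow> ?unfolded")
proof -
  obtain D' where D': "prune P (pick p) out' D = Some D'" "final D out' D'"
    using prune_Some[OF reduced_refl assms(1,2), of "pick p"] assms(3) unfolding choice_rule_def by blast
  note fs = final_sols[OF assms(1,2) D'(2)[unfolded out'_def]]
  have D'V: "D' \<subseteq> V" using final_subset[OF D'(2)] assms(1) by blast
  have le: "card (fst ` D') \<le> card (fst ` D)"
    using final_subset[OF D'(2)] finite_digraph[OF assms(1)] by (intro card_mono) auto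
  note hd = heads_eq[OF D'V] rows.card_heads[OF D'V]
  show "enumerate_rec P (card (fst ` D)) pick p D inn out = Some [Call D inn out]" if "sols D inn out = {}"
  proof (cases "inn \<subseteq> D")
    case True
    have "card (fst ` D') < card (fst ` D) \<or> \<not> inn \<subseteq> D'" using fs(1) that le by auto
    then show ?thesis
      by (subst enumerate_rec.simps) (use D'(1) hd True in \<open>simp add: Let_def out'_def\<close>)
  next
    case False
    then show ?thesis by (subst enumerate_rec.simps) auto
  qed
  assume ne: "sols D inn out \<noteq> {}"
  note fs = fs(1)[THEN iffD1, OF ne] fs(2)[OF ne]
  have "inn \<subseteq> D" using fs(1) final_subset[OF D'(2)] by blast
  then show ?unfolded
    by (subst enumerate_rec.simps) (use D'(1) hd fs in \<open>simp add: Let_def out'_def\<close>)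
qed

text \<open>The two sets of heads have the same size by \<open>normal_card\<close>, so neither is
  properly contained in the other. This makes the choice of step 2.6 possible.\<close>

lemma heads_W_diff_nonempty:
  assumes "D \<subseteq> V" "normal W F D" "heads W D \<noteq> heads F D"
  shows "heads W D - heads F D \<noteq> {}"
proof
  assume "heads W D - heads F D = {}"
  then have "heads W D \<subseteq> heads F D" by blast
  moreover have "card (heads W D) = card (heads F D)"
    using rows.card_heads cols.card_heads normal_card assms by simp
  moreover have "finite (heads F D)" using finite_digraph[OF assms(1)] heads_subset finite_subset by metis
  ultimately show False using assms(3) card_subset_eq by blast
qed

text \<open>The condition \<open>x \<in> X\<close> keeps the hypothesis consistent with
  \<open>pick\<close> being a choice rule, since at the same path the rule is also applied to sets
  of vertices to be deleted.\<close>

lemma enumerate_rec_log_tree: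
  assumes "rec_tree t D inn out" "D \<subseteq> V" "normal W F D" "choice_rule pick"
    and "\<And>q x X. label t q = Some x \<Longrightarrow> x \<in> X \<Longrightarrow> pick (p @ q) X = x"
  shows "enumerate_rec P (card (fst ` D)) pick p D inn out = Some (log_tree t D inn out)"
  using assms(1-3,5)
proof (induction t arbitrary: p D inn out)
  case Leaf
  then show ?case using enumerate_rec_unfold(2)[OF Leaf(2,3) assms(4)] by simp
next
  case (Node x t1 t2)
  let ?D = "pruned D inn out" and ?out = "out \<union> same_lines D inn"
  from Node.prems have ne: "sols D inn out \<noteq> {}" and x: "x \<in> heads W ?D - heads F ?D" by auto
  note p = pruned[OF Node.prems(2,3) ne]
  have DV: "?D \<subseteq> V" using p(1) Node.prems(2) by blast
  have t: "rec_tree t1 ?D (insert x inn) ?out" "rec_tree t2 ?D inn (insert x ?out)" using Node.prems by auto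
  have pick: "pick p (heads W ?D - heads F ?D) = x" using Node.prems(4)[of "[]" x] x by simp
  have "pick ((p @ [True]) @ q) X = y" if "label t1 q = Some y" "y \<in> X" for q y X
    using Node.prems(4)[of "True # q" y X] that by simp
  note 1 = Node.IH(1)[OF t(1) DV p(2) this]
  have "pick ((p @ [False]) @ q) X = y" if "label t2 q = Some y" "y \<in> X" for q y X
    using Node.prems(4)[of "False # q" y X] that by simp
  note 2 = Node.IH(2)[OF t(2) DV p(2) this]
  show ?case
    using enumerate_rec_unfold(2)[OF Node.prems(2,3) assms(4) ne] pick 1 2 x by (auto simp: Let_def)
qed

text \<open>Induction on the number of solutions, which drops in both subcalls while staying
  positive. Termination of the recursion is obtained along the way.\<close>

lemma rec_tree_of_pick:
  assumes "D \<subseteq> V" "normal W F D" "sols D inn out \<noteq> {}" "choice_rule pick"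
  shows "\<exists>t. rec_tree t D inn out \<and> enumerate_rec P (card (fst ` D)) pick p D inn out = Some (log_tree t D inn out)"
  using assms(1-3)
proof (induction "card (sols D inn out)" arbitrary: p D inn out rule: less_induct)
  case less
  let ?D = "pruned D inn out" and ?out = "out \<union> same_lines D inn"
  note p = pruned[OF less.prems]
  have DV: "?D \<subseteq> V" using p(1) less.prems(1) by blast
  show ?case
  proof (cases "heads W ?D = heads F ?D")
    case True
    then have "rec_tree Leaf D inn out" using less.prems by simp
    moreover have "enumerate_rec P (card (fst ` D)) pick p D inn out = Some (log_tree Leaf D inn out)"
      using enumerate_rec_unfold(2)[OF less.prems(1,2) assms(4) less.prems(3)] True by simp
    ultimately show ?thesis by blast
  next
    case False
    define x where "x = pick p (heads W ?D - heads F ?D)"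
    have x: "x \<in> heads W ?D - heads F ?D"
      using assms(4)[unfolded choice_rule_def, rule_format, OF heads_W_diff_nonempty[OF DV p(2) False]]
      unfolding x_def .
    note c = card_sols_split[OF less.prems x] and s = sols_split[OF less.prems x]
    obtain t1 where t1: "rec_tree t1 ?D (insert x inn) ?out"
      "enumerate_rec P (card (fst ` ?D)) pick (p @ [True]) ?D (insert x inn) ?out = Some (log_tree t1 ?D (insert x inn) ?out)"
      using less.hyps[OF c(1) DV p(2) s(3)] by blast
    obtain t2 where t2: "rec_tree t2 ?D inn (insert x ?out)"
      "enumerate_rec P (card (fst ` ?D)) pick (p @ [False]) ?D inn (insert x ?out) = Some (log_tree t2 ?D inn (insert x ?out))"
      using less.hyps[OF c(2) DV p(2) s(4)] by blast
    have "rec_tree (Node x t1 t2) D inn out" using less.prems x t1 t2 by simp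
    moreover have "enumerate_rec P (card (fst ` D)) pick p D inn out = Some (log_tree (Node x t1 t2) D inn out)"
      using enumerate_rec_unfold(2)[OF less.prems(1,2) assms(4) less.prems(3)] False t1 t2
      by (simp add: Let_def x_def[symmetric])
    ultimately show ?thesis by blast
  qed
qed

text \<open>This is \<open>D\<^sup>*(P)\<close>.\<close>

definition nf :: "('w \<times> 'f) set" where
  "nf = hull W F V {M. stable W F V M}"

lemma final_V:
  assumes "reduced V {} D" "normal W F D" "\<And>y. y \<in> V - D \<Longrightarrow> dominated W F D y"
  shows "D = nf"
  using dominated_final(2)[OF assms(1) _ assms(2,3)] by (simp add: nf_def)

lemma idua_vertices: "idua P V = Some nf" and nf: "nf \<subseteq> V" "normal W F nf" "sols nf inn out = sols V inn out"
proof -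
  obtain D where D: "idua P V = Some D" "D \<subseteq> V" "normal W F D" "reduced V {} D"
    "\<And>y. y \<in> V - D \<Longrightarrow> dominated W F D y"
    using subset_refl
  proof (rule idua_Some)
    fix D
    assume "idua P V = Some D" "D \<subseteq> V" "normal W F D" "\<And>y. y \<in> V - D \<Longrightarrow> dominated W F D y"
      and "\<And>D0 out. reduced D0 out V \<Longrightarrow> D0 \<subseteq> V \<Longrightarrow> reduced D0 out D"
    then show thesis using that reduced_refl[of V "{}"] by blast
  qed
  have "D = nf" using final_V[OF D(4,3,5)] .
  then show "idua P V = Some nf" "nf \<subseteq> V" "normal W F nf" "sols nf inn out = sols V inn out"
    using D dominated_final(1)[OF D(4) subset_refl D(3,5)] by (simp_all add: sols_def)
qed

lemma enumerate_stable_eq: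
  "enumerate_stable P pick inn out = enumerate_rec P (card (fst ` nf)) pick [] nf inn out"
  by (simp add: enumerate_stable_def idua_vertices)

theorem enumerate_stable_correct:
  assumes "choice_rule pick"
  shows "\<exists>evs. enumerate_stable P pick inn out = Some evs \<and>
    solutions evs = {M. stable_matching P V M \<and> inn \<subseteq> M \<and> M \<inter> out = {}}"
proof (cases "sols nf inn out = {}")
  case True
  then show ?thesis
    using enumerate_rec_unfold(1)[OF nf(1,2) assms True] nf(3)[of inn out, unfolded True]
    by (simp add: enumerate_stable_eq stable_matching_eq sols_def[symmetric])
next
  case False
  then obtain t where t: "rec_tree t nf inn out" "enumerate_stable P pick inn out = Some (log_tree t nf inn out)"
    using rec_tree_of_pick[OF nf(1,2) False assms] by (auto simp: enumerate_stable_eq)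
  then show ?thesis
    using solutions_log_tree[OF t(1) nf(1,2)] nf(3)[of inn out] by (simp add: stable_matching_eq sols_def)
qed

end

section \<open>Running times of programs\<close>

abbreviation rd :: "nat \<Rightarrow> aexp" where "rd a \<equiv> Read a []"

text \<open>Counter and bound are memory cells read again in each iteration, so the rules for loops
  demand that the body assign neither.\<close>

definition For :: "nat \<Rightarrow> nat \<Rightarrow> com \<Rightarrow> com" where
  "For i a c = Seq (Assign i [] (Const 0))
     (While (Less (rd i) (rd a)) (Seq c (Assign i [] (Plus (rd i) (Const 1)))))"

primrec assigned :: "com \<Rightarrow> nat set" where
  "assigned Skip = {}"
| "assigned (Assign a es e) = {a}"
| "assigned (Choose a es e) = {a}"
| "assigned (Emit e) = {}"
| "assigned (Seq c1 c2) = assigned c1 \<union> assigned c2"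
| "assigned (If b c1 c2) = assigned c1 \<union> assigned c2"
| "assigned (While b c) = assigned c"

lemma assigned_For [simp]: "assigned (For i a c) = insert i (assigned c)"
  by (auto simp: For_def)

text \<open>The running time, provided that no loop is iterated more than \<open>N\<close> times.\<close>

primrec loop_cost :: "nat \<Rightarrow> com \<Rightarrow> nat" where
  "loop_cost N Skip = 1"
| "loop_cost N (Assign a es e) = 2 + sum_list (map acost es) + acost e"
| "loop_cost N (Choose a es e) = 2 + sum_list (map acost es) + acost e"
| "loop_cost N (Emit e) = 1 + acost e"
| "loop_cost N (Seq c1 c2) = loop_cost N c1 + loop_cost N c2"
| "loop_cost N (If b c1 c2) = 1 + bcost b + loop_cost N c1 + loop_cost N c2"
| "loop_cost N (While b c) = (N + 1) * (1 + bcost b) + N * loop_cost N c"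

primrec nesting :: "com \<Rightarrow> nat" where
  "nesting Skip = 0"
| "nesting (Assign a es e) = 0"
| "nesting (Choose a es e) = 0"
| "nesting (Emit e) = 0"
| "nesting (Seq c1 c2) = max (nesting c1) (nesting c2)"
| "nesting (If b c1 c2) = max (nesting c1) (nesting c2)"
| "nesting (While b c) = Suc (nesting c)"

lemma nesting_For [simp]: "nesting (For i a c) = Suc (nesting c)"
  by (simp add: For_def)

text \<open>The cost is a polynomial in \<open>N\<close> of degree at most \<open>nesting c\<close>
  with nonnegative coefficients, and its value at 1 is their sum. In the loop case,
  \<open>N + 1\<close> tests become the factor 2, the value of \<open>N + 1\<close> at 1.\<close>

lemma loop_cost_le:
  assumes "N \<ge> 1" "nesting c \<le> k"
  shows "loop_cost N c \<le> loop_cost 1 c * N ^ k"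
proof -
  have base: "a \<le> a * N ^ k" for a k
    using assms(1) by (metis mult.right_neutral mult_le_mono2 one_le_power)
  show ?thesis using assms(2)
  proof (induction c arbitrary: k)
    case (Seq c1 c2)
    then show ?case by (simp add: add_mult_distrib add_mono)
  next
    case (If b c1 c2)
    have "1 + bcost b \<le> (1 + bcost b) * N ^ k" by (rule base)
    moreover have "loop_cost N c1 \<le> loop_cost 1 c1 * N ^ k" "loop_cost N c2 \<le> loop_cost 1 c2 * N ^ k"
      using If by auto
    ultimately have "1 + bcost b + loop_cost N c1 + loop_cost N c2 \<le>
        (1 + bcost b) * N ^ k + loop_cost 1 c1 * N ^ k + loop_cost 1 c2 * N ^ k" by linarith
    also have "\<dots> = (1 + bcost b + loop_cost 1 c1 + loop_cost 1 c2) * N ^ k"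
      by (simp only: add_mult_distrib)
    finally show ?case by simp
  next
    case (While b c)
    then obtain l where k: "k = Suc l" "nesting c \<le> l" by (cases k) auto
    have pow: "N ^ l \<ge> 1" using assms(1) by simp
    then have "N \<le> N * N ^ l" by simp
    then have "N + 1 \<le> 2 * (N * N ^ l)" using assms(1) pow by linarith
    then have "(N + 1) * (1 + bcost b) \<le> 2 * (N * N ^ l) * (1 + bcost b)" by (rule mult_right_mono) simp
    moreover have "N * loop_cost N c \<le> N * (loop_cost 1 c * N ^ l)" using While.IH k by simp
    ultimately have "loop_cost N (While b c) \<le>
        2 * (N * N ^ l) * (1 + bcost b) + N * (loop_cost 1 c * N ^ l)"
      unfolding loop_cost.simps by (rule add_mono)
    also have "\<dots> = loop_cost 1 (While b c) * N ^ k" by (simp add: k algebra_simps)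
    finally show ?case .
  qed (simp_all only: loop_cost.simps base)
qed

lemma store_apply [simp]: "store M a is v b js = (if b = a \<and> js = is then v else M b js)"
  by (simp add: store_def)

lemma exec_frame: "exec c s t \<Longrightarrow> a \<notin> assigned c \<Longrightarrow> mem t a = mem s a"
  by (induction rule: exec.induct) (auto simp: tick_def store_def)

text \<open>Whatever a program writes is stamped between its start and its end. This is the only
  information about stamps that the timing of outputs uses.\<close>

lemma exec_tape:
  "exec c s t \<Longrightarrow> clock s \<le> clock t \<and>
     (\<exists>tp. tape t = tape s @ tp \<and> (\<forall>e\<in>set tp. clock s \<le> fst e \<and> fst e \<le> clock t))"
proof (induction rule: exec.induct)
  case (Seq c1 s s' c2 s'')
  then obtain tp tp' where "tape s' = tape s @ tp" "tape s'' = tape s' @ tp'"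
    "\<forall>e\<in>set tp. clock s \<le> fst e \<and> fst e \<le> clock s'" "\<forall>e\<in>set tp'. clock s' \<le> fst e \<and> fst e \<le> clock s''"
    "clock s \<le> clock s'" "clock s' \<le> clock s''" by blast
  then show ?case by (intro conjI exI[of _ "tp @ tp'"]) fastforce+
next
  case (WhileTrue s b c s' s'')
  then obtain tp tp' where "tape s' = tape s @ tp" "tape s'' = tape s' @ tp'"
    "\<forall>e\<in>set tp. clock s \<le> fst e \<and> fst e \<le> clock s'" "\<forall>e\<in>set tp'. clock s' \<le> fst e \<and> fst e \<le> clock s''"
    "clock s \<le> clock s'" "clock s' \<le> clock s''" unfolding tick_def by fastforce
  then show ?case by (intro conjI exI[of _ "tp @ tp'"]) fastforce+
next
  case (IfTrue s b c1 s' c2)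
  then obtain tp where "tape s' = tape s @ tp" "\<forall>e\<in>set tp. clock s + 1 \<le> fst e \<and> fst e \<le> clock s'"
    "clock s \<le> clock s'" unfolding tick_def by fastforce
  then show ?case by (intro conjI exI[of _ tp]) fastforce+
next
  case (IfFalse s b c2 s' c1)
  then obtain tp where "tape s' = tape s @ tp" "\<forall>e\<in>set tp. clock s + 1 \<le> fst e \<and> fst e \<le> clock s'"
    "clock s \<le> clock s'" unfolding tick_def by fastforce
  then show ?case by (intro conjI exI[of _ tp]) fastforce+
qed (auto simp: tick_def)

text \<open>Total correctness with time bounded by the syntactic \<open>loop_cost\<close>. Stamps
  are hidden, so assertions do not depend on the clock. The choices must be unchanged, which leaves
  \<open>Choose\<close> to be treated separately.\<close>

definition emits :: "nat \<Rightarrow> com \<Rightarrow> memory \<Rightarrow> nat list \<Rightarrow> (memory \<Rightarrow> nat list \<Rightarrow> bool) \<Rightarrow> bool" where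
  "emits N c M out Q \<longleftrightarrow> (\<forall>s :: config. mem s = M \<longrightarrow> map snd (tape s) = out \<longrightarrow>
     (\<exists>t. exec c s t \<and> clock t \<le> clock s + loop_cost N c \<and> choices t = choices s \<and>
        Q (mem t) (map snd (tape t))))"

definition silent :: "nat \<Rightarrow> com \<Rightarrow> memory \<Rightarrow> (memory \<Rightarrow> bool) \<Rightarrow> bool" where
  "silent N c M Q \<longleftrightarrow> (\<forall>out. emits N c M out (\<lambda>M' out'. out' = out \<and> Q M'))"

lemma emitsE:
  assumes "emits N c (mem s) (map snd (tape s)) Q"
  obtains t where "exec c s t" "clock t \<le> clock s + loop_cost N c" "choices t = choices s"
    "Q (mem t) (map snd (tape t))"
  using assms unfolding emits_def by blast

lemma silentE:
  assumes "silent N c (mem s) Q"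
  obtains t where "exec c s t" "clock t \<le> clock s + loop_cost N c" "choices t = choices s"
    "tape t = tape s" "Q (mem t)"
proof -
  obtain t where t: "exec c s t" "clock t \<le> clock s + loop_cost N c" "choices t = choices s"
    "map snd (tape t) = map snd (tape s)" "Q (mem t)"
    using assms emitsE[of N c s] unfolding silent_def emits_def by blast
  \<comment> \<open>The judgement determines only the values on the tape; since the tape can only
    grow, equal length shows that the stamps agree as well.\<close>
  then have "length (tape t) = length (tape s)" by (metis length_map)
  then have "tape t = tape s" using exec_tape[OF t(1)] by auto
  then show thesis using that t by blast
qed

lemma emits_mono: "emits N c M out Q \<Longrightarrow> (\<And>M' out'. Q M' out' \<Longrightarrow> Q' M' out') \<Longrightarrow> emits N c M out Q'"
  unfolding emits_def by blast

lemma silent_mono: "silent N c M Q \<Longrightarrow> (\<And>M'. Q M' \<Longrightarrow> Q' M') \<Longrightarrow> silent N c M Q'"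
  unfolding silent_def emits_def by blast

lemma emits_frame:
  assumes "emits N c M out Q"
  shows "emits N c M out (\<lambda>M' out'. Q M' out' \<and> (\<forall>a. a \<notin> assigned c \<longrightarrow> M' a = M a))"
  using assms exec_frame unfolding emits_def by fast

lemma silent_frame:
  assumes "silent N c M Q"
  shows "silent N c M (\<lambda>M'. Q M' \<and> (\<forall>a. a \<notin> assigned c \<longrightarrow> M' a = M a))"
  using assms exec_frame unfolding silent_def emits_def by fast

lemma emits_Skip: "Q M out \<Longrightarrow> emits N Skip M out Q"
  unfolding emits_def using exec.Skip by (fastforce simp: tick_def)

lemma emits_Assign:
  "Q (store M a (map (aval M) es) (aval M e)) out \<Longrightarrow> emits N (Assign a es e) M out Q"
  unfolding emits_def
  by (intro allI impI exI, rule conjI, rule exec.Assign) (auto simp: tick_def)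

lemma emits_Emit: "Q M (out @ [aval M e]) \<Longrightarrow> emits N (Emit e) M out Q"
  unfolding emits_def
  by (intro allI impI exI, rule conjI, rule exec.Emit, rule refl) (auto simp: tick_def)

lemma emits_Seq:
  assumes "emits N c1 M out (\<lambda>M' out'. emits N c2 M' out' Q)"
  shows "emits N (Seq c1 c2) M out Q"
  unfolding emits_def
proof (intro allI impI)
  fix s :: config assume "mem s = M" "map snd (tape s) = out"
  then obtain t where t: "exec c1 s t" "clock t \<le> clock s + loop_cost N c1" "choices t = choices s"
    "emits N c2 (mem t) (map snd (tape t)) Q"
    using assms unfolding emits_def by blast
  from t(4) obtain u where u: "exec c2 t u" "clock u \<le> clock t + loop_cost N c2" "choices u = choices t"
    "Q (mem u) (map snd (tape u))" by (rule emitsE)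
  then show "\<exists>u. exec (Seq c1 c2) s u \<and> clock u \<le> clock s + loop_cost N (Seq c1 c2) \<and>
      choices u = choices s \<and> Q (mem u) (map snd (tape u))"
    using t by (intro exI[of _ u]) (auto intro: exec.Seq)
qed

lemma emits_If:
  assumes "bval M b \<Longrightarrow> emits N c1 M out Q" "\<not> bval M b \<Longrightarrow> emits N c2 M out Q"
  shows "emits N (If b c1 c2) M out Q"
  unfolding emits_def
proof (intro allI impI)
  fix s :: config assume s: "mem s = M" "map snd (tape s) = out"
  let ?s = "tick (1 + bcost b) s"
  have tick: "mem ?s = M" "map snd (tape ?s) = out" "choices ?s = choices s" "clock ?s = clock s + (1 + bcost b)"
    using s by (auto simp: tick_def)
  show "\<exists>u. exec (If b c1 c2) s u \<and> clock u \<le> clock s + loop_cost N (If b c1 c2) \<and>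
      choices u = choices s \<and> Q (mem u) (map snd (tape u))"
  proof (cases "bval M b")
    case True
    then obtain u where "exec c1 ?s u" "clock u \<le> clock ?s + loop_cost N c1" "choices u = choices ?s"
      "Q (mem u) (map snd (tape u))"
      using assms(1) tick unfolding emits_def by blast
    then show ?thesis using tick exec.IfTrue[of s b c1 u c2] True s by (intro exI[of _ u]) auto
  next
    case False
    then obtain u where "exec c2 ?s u" "clock u \<le> clock ?s + loop_cost N c2" "choices u = choices ?s"
      "Q (mem u) (map snd (tape u))"
      using assms(2) tick unfolding emits_def by blast
    then show ?thesis using tick exec.IfFalse[of s b c2 u c1] False s by (intro exI[of _ u]) auto
  qed
qed

text \<open>The invariant is stated after the counter has been set, hence the \<open>store\<close>
  in the step. Arrays that the loop does not assign are supplied unchanged and need not enter the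
  invariant.\<close>

lemma emits_For:
  assumes "i \<notin> assigned c" "a \<notin> assigned c" "i \<noteq> a" "M a [] = n" "n \<le> N"
    and init: "I 0 (store M i [] 0) out"
    and step: "\<And>k M' out'. k < n \<Longrightarrow> M' i [] = k \<Longrightarrow>
      (\<And>b. b \<notin> assigned c \<Longrightarrow> b \<noteq> i \<Longrightarrow> M' b = M b) \<Longrightarrow> I k M' out' \<Longrightarrow>
      emits N c M' out' (\<lambda>M'' out''. I (Suc k) (store M'' i [] (Suc k)) out'')"
    and final: "\<And>M' out'. I n M' out' \<Longrightarrow> (\<And>b. b \<notin> assigned c \<Longrightarrow> b \<noteq> i \<Longrightarrow> M' b = M b) \<Longrightarrow> Q M' out'"
  shows "emits N (For i a c) M out Q"
  unfolding emits_def
proof (intro allI impI)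
  let ?b = "Less (rd i) (rd a)" and ?c = "Seq c (Assign i [] (Plus (rd i) (Const 1)))"
  have loop: "\<exists>t. exec (While ?b ?c) s t \<and>
      clock t \<le> clock s + (n - k) * (1 + bcost ?b + loop_cost N ?c) + (1 + bcost ?b) \<and>
      choices t = choices s \<and> Q (mem t) (map snd (tape t))"
    if "k \<le> n" "mem s i [] = k" "\<And>b. b \<notin> assigned c \<Longrightarrow> b \<noteq> i \<Longrightarrow> mem s b = M b"
      "I k (mem s) (map snd (tape s))" for k s
    using that
  proof (induction "n - k" arbitrary: k s)
    case 0
    then have k: "k = n" by simp
    have "mem s a [] = n" using assms 0 by metis
    then have "exec (While ?b ?c) s (tick (1 + bcost ?b) s)"
      using 0 k by (intro exec.WhileFalse) simp
    moreover have "Q (mem s) (map snd (tape s))" using final 0 k by blast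
    ultimately show ?case by (intro exI[of _ "tick (1 + bcost ?b) s"]) (auto simp: tick_def)
  next
    case (Suc l)
    let ?s = "tick (1 + bcost ?b) s"
    have s: "mem ?s = mem s" "choices ?s = choices s" "tape ?s = tape s" "clock ?s = clock s + (1 + bcost ?b)"
      by (auto simp: tick_def)
    have kn: "k < n" using Suc by simp
    have a: "mem s a [] = n" using assms Suc by metis
    have "emits N c (mem ?s) (map snd (tape ?s)) (\<lambda>M'' out''. I (Suc k) (store M'' i [] (Suc k)) out'')"
      unfolding s by (rule step[OF kn]) (use Suc.prems in auto)
    then obtain t where t: "exec c ?s t" "clock t \<le> clock ?s + loop_cost N c" "choices t = choices ?s"
      "I (Suc k) (store (mem t) i [] (Suc k)) (map snd (tape t))" by (rule emitsE)
    have ti: "mem t i [] = k" using exec_frame[OF t(1) assms(1)] s Suc.prems by simp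
    define u where "u = tick (2 + acost (Plus (rd i) (Const 1))) (t\<lparr>mem := store (mem t) i [] (Suc k)\<rparr>)"
    have u: "exec (Assign i [] (Plus (rd i) (Const 1))) t u"
      using exec.Assign[of i "[]" "Plus (rd i) (Const 1)" t] ti by (simp add: u_def)
    have "exec ?c ?s u" using exec.Seq[OF t(1) u] .
    moreover have "\<exists>v. exec (While ?b ?c) u v \<and>
        clock v \<le> clock u + (n - Suc k) * (1 + bcost ?b + loop_cost N ?c) + (1 + bcost ?b) \<and>
        choices v = choices u \<and> Q (mem v) (map snd (tape v))"
    proof (rule Suc.hyps(1))
      show "l = n - Suc k" "Suc k \<le> n" using Suc by auto
      show "mem u i [] = Suc k" by (simp add: u_def tick_def)
      show "I (Suc k) (mem u) (map snd (tape u))" using t by (simp add: u_def tick_def)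
      show "mem u b = M b" if "b \<notin> assigned c" "b \<noteq> i" for b
        using that exec_frame[OF t(1), of b] s Suc.prems by (simp add: u_def tick_def store_def)
    qed
    then obtain v where v: "exec (While ?b ?c) u v"
      "clock v \<le> clock u + (n - Suc k) * (1 + bcost ?b + loop_cost N ?c) + (1 + bcost ?b)"
      "choices v = choices u" "Q (mem v) (map snd (tape v))" by blast
    moreover have "bval (mem s) ?b" using a Suc.prems kn by simp
    ultimately have "exec (While ?b ?c) s v" by (intro exec.WhileTrue[of s ?b ?c u v])
    moreover have "clock u \<le> clock s + (1 + bcost ?b + loop_cost N ?c)"
      using t(2) s by (simp add: u_def tick_def)
    then have "clock v \<le> clock s + (n - k) * (1 + bcost ?b + loop_cost N ?c) + (1 + bcost ?b)"
    proof -
      have "n - k = Suc (n - Suc k)" using kn by simp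
      then have "(n - k) * (1 + bcost ?b + loop_cost N ?c) =
          (1 + bcost ?b + loop_cost N ?c) + (n - Suc k) * (1 + bcost ?b + loop_cost N ?c)"
        by (simp only: mult_Suc)
      then show ?thesis using v(2) \<open>clock u \<le> _\<close> by linarith
    qed
    moreover have "choices v = choices s" using v t s by (simp add: u_def tick_def)
    ultimately show ?case using v(4) by blast
  qed
  fix s :: config assume s: "mem s = M" "map snd (tape s) = out"
  define t where "t = tick 3 (s\<lparr>mem := store M i [] 0\<rparr>)"
  have t: "exec (Assign i [] (Const 0)) s t"
    using exec.Assign[of i "[]" "Const 0" s] s by (simp add: t_def)
  have "\<exists>v. exec (While ?b ?c) t v \<and>
      clock v \<le> clock t + (n - 0) * (1 + bcost ?b + loop_cost N ?c) + (1 + bcost ?b) \<and>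
      choices v = choices t \<and> Q (mem v) (map snd (tape v))"
    using s init by (intro loop) (auto simp: t_def tick_def store_def)
  then obtain v where v: "exec (While ?b ?c) t v"
    "clock v \<le> clock t + n * (1 + bcost ?b + loop_cost N ?c) + (1 + bcost ?b)"
    "choices v = choices t" "Q (mem v) (map snd (tape v))" by auto
  have "exec (For i a c) s v" unfolding For_def using exec.Seq[OF t v(1)] .
  moreover have "n * (1 + bcost ?b + loop_cost N ?c) \<le> N * (1 + bcost ?b + loop_cost N ?c)"
    using assms(5) by (rule mult_right_mono) simp
  then have "clock v \<le> clock s + loop_cost N (For i a c)"
    using v(2) by (simp add: For_def t_def tick_def add_mult_distrib2)
  moreover have "choices v = choices s" using v by (simp add: t_def tick_def)
  ultimately show "\<exists>t. exec (For i a c) s t \<and> clock t \<le> clock s + loop_cost N (For i a c) \<and>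
      choices t = choices s \<and> Q (mem t) (map snd (tape t))"
    using v(4) by blast
qed

lemma silent_Skip: "Q M \<Longrightarrow> silent N Skip M Q"
  by (simp add: silent_def emits_Skip)

lemma silent_Assign: "Q (store M a (map (aval M) es) (aval M e)) \<Longrightarrow> silent N (Assign a es e) M Q"
  by (simp add: silent_def emits_Assign)

lemma silent_Seq: "silent N c1 M (\<lambda>M'. silent N c2 M' Q) \<Longrightarrow> silent N (Seq c1 c2) M Q"
  unfolding silent_def by (intro allI emits_Seq) (auto elim!: allE emits_mono)

lemma silent_If:
  "(bval M b \<Longrightarrow> silent N c1 M Q) \<Longrightarrow> (\<not> bval M b \<Longrightarrow> silent N c2 M Q) \<Longrightarrow> silent N (If b c1 c2) M Q"
  unfolding silent_def by (intro allI emits_If) auto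

lemma silent_For:
  assumes "i \<notin> assigned c" "a \<notin> assigned c" "i \<noteq> a" "M a [] = n" "n \<le> N"
    and init: "I 0 (store M i [] 0)"
    and step: "\<And>k M'. k < n \<Longrightarrow> M' i [] = k \<Longrightarrow>
      (\<And>b. b \<notin> assigned c \<Longrightarrow> b \<noteq> i \<Longrightarrow> M' b = M b) \<Longrightarrow> I k M' \<Longrightarrow>
      silent N c M' (\<lambda>M''. I (Suc k) (store M'' i [] (Suc k)))"
    and final: "\<And>M'. I n M' \<Longrightarrow> (\<And>b. b \<notin> assigned c \<Longrightarrow> b \<noteq> i \<Longrightarrow> M' b = M b) \<Longrightarrow> Q M'"
  shows "silent N (For i a c) M Q"
  unfolding silent_def
proof
  fix out
  show "emits N (For i a c) M out (\<lambda>M' out'. out' = out \<and> Q M')"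
    by (rule emits_For[where I = "\<lambda>k M' out'. out' = out \<and> I k M'" and n = n])
      (use assms(1-5) init step final in \<open>auto simp: silent_def\<close>)
qed

text \<open>For double loops with independent iterations: iteration \<open>(x, y)\<close>
  establishes \<open>R x y\<close> and spoils no other instance, so no invariant has to describe the
  part already traversed. \<open>J\<close> holds throughout, and neither may depend on the
  counters.\<close>

lemma silent_For2:
  assumes "i \<notin> assigned c" "j \<notin> assigned c" "a \<notin> assigned c" "i \<noteq> a" "j \<noteq> a" "i \<noteq> j" "M a [] = n" "n \<le> N"
    and init: "J M"
    and indep: "\<And>M' v. J M' \<Longrightarrow> J (store M' i [] v)" "\<And>M' v. J M' \<Longrightarrow> J (store M' j [] v)"
      "\<And>x y M' v. R x y M' \<Longrightarrow> R x y (store M' i [] v)" "\<And>x y M' v. R x y M' \<Longrightarrow> R x y (store M' j [] v)"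
    and step: "\<And>x y M'. x < n \<Longrightarrow> y < n \<Longrightarrow> M' i [] = x \<Longrightarrow> M' j [] = y \<Longrightarrow>
      (\<And>b. b \<notin> assigned c \<Longrightarrow> b \<noteq> i \<Longrightarrow> b \<noteq> j \<Longrightarrow> M' b = M b) \<Longrightarrow> J M' \<Longrightarrow>
      silent N c M' (\<lambda>M''. J M'' \<and> R x y M'' \<and>
        (\<forall>x' y'. x' < n \<longrightarrow> y' < n \<longrightarrow> (x', y') \<noteq> (x, y) \<longrightarrow> R x' y' M' \<longrightarrow> R x' y' M''))"
    and final: "\<And>M'. J M' \<Longrightarrow> (\<And>x y. x < n \<Longrightarrow> y < n \<Longrightarrow> R x y M') \<Longrightarrow>
      (\<And>b. b \<notin> assigned c \<Longrightarrow> b \<noteq> i \<Longrightarrow> b \<noteq> j \<Longrightarrow> M' b = M b) \<Longrightarrow> Q M'"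
  shows "silent N (For i a (For j a c)) M Q"
proof (rule silent_For[where I = "\<lambda>k M'. J M' \<and> (\<forall>x<k. \<forall>y<n. R x y M')"])
  show "i \<notin> assigned (For j a c)" "a \<notin> assigned (For j a c)" "i \<noteq> a" "M a [] = n" "n \<le> N"
    using assms(1-8) by auto
  show "J (store M i [] 0) \<and> (\<forall>x<0. \<forall>y<n. R x y (store M i [] 0))"
    using init indep by simp
next
  fix x M1
  assume x: "x < n" "M1 i [] = x" and fr1: "\<And>b. b \<notin> assigned (For j a c) \<Longrightarrow> b \<noteq> i \<Longrightarrow> M1 b = M b"
    and I1: "J M1 \<and> (\<forall>x'<x. \<forall>y<n. R x' y M1)"
  have fr1': "b \<notin> assigned c \<Longrightarrow> b \<noteq> i \<Longrightarrow> b \<noteq> j \<Longrightarrow> M1 b = M b" for b using fr1 by simp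
  show "silent N (For j a c) M1 (\<lambda>M'. J (store M' i [] (Suc x)) \<and>
      (\<forall>x'<Suc x. \<forall>y<n. R x' y (store M' i [] (Suc x))))"
  proof (rule silent_For[where I = "\<lambda>k M'. J M' \<and> (\<forall>x'<x. \<forall>y<n. R x' y M') \<and> (\<forall>y<k. R x y M')"])
    show "j \<notin> assigned c" "a \<notin> assigned c" "j \<noteq> a" "n \<le> N" using assms by auto
    show "M1 a [] = n" using fr1'[of a] assms(3-7) by simp
    show "J (store M1 j [] 0) \<and> (\<forall>x'<x. \<forall>y<n. R x' y (store M1 j [] 0)) \<and> (\<forall>y<0. R x y (store M1 j [] 0))"
      using I1 indep by simp
  next
    fix y M2
    assume y: "y < n" "M2 j [] = y" and fr2: "\<And>b. b \<notin> assigned c \<Longrightarrow> b \<noteq> j \<Longrightarrow> M2 b = M1 b"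
      and I2: "J M2 \<and> (\<forall>x'<x. \<forall>y<n. R x' y M2) \<and> (\<forall>y'<y. R x y' M2)"
    have "M2 i [] = x" using fr2[of i] x assms(1,6) by simp
    moreover have "M2 b = M b" if "b \<notin> assigned c" "b \<noteq> i" "b \<noteq> j" for b
      using fr1' fr2 that by metis
    ultimately have "silent N c M2 (\<lambda>M''. J M'' \<and> R x y M'' \<and>
        (\<forall>x' y'. x' < n \<longrightarrow> y' < n \<longrightarrow> (x', y') \<noteq> (x, y) \<longrightarrow> R x' y' M2 \<longrightarrow> R x' y' M''))"
      using step[OF x(1) y(1)] y I2 by blast
    then show "silent N c M2 (\<lambda>M''. J (store M'' j [] (Suc y)) \<and>
        (\<forall>x'<x. \<forall>y'<n. R x' y' (store M'' j [] (Suc y))) \<and> (\<forall>y'<Suc y. R x y' (store M'' j [] (Suc y))))"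
    proof (rule silent_mono)
      fix M''
      assume *: "J M'' \<and> R x y M'' \<and>
        (\<forall>x' y'. x' < n \<longrightarrow> y' < n \<longrightarrow> (x', y') \<noteq> (x, y) \<longrightarrow> R x' y' M2 \<longrightarrow> R x' y' M'')"
      then have "R x' y' M''" if "x' < x" "y' < n" for x' y'
        using that I2 x by auto
      moreover have "R x y' M''" if "y' < Suc y" for y'
        using * that I2 x y by (cases "y' = y") auto
      ultimately show "J (store M'' j [] (Suc y)) \<and>
        (\<forall>x'<x. \<forall>y'<n. R x' y' (store M'' j [] (Suc y))) \<and> (\<forall>y'<Suc y. R x y' (store M'' j [] (Suc y)))"
        using * by (simp add: indep)
    qed
  next
    fix M2
    assume I2: "J M2 \<and> (\<forall>x'<x. \<forall>y<n. R x' y M2) \<and> (\<forall>y<n. R x y M2)"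
    then have "R x' y M2" if "x' < Suc x" "y < n" for x' y
      using that by (cases "x' = x") auto
    then show "J (store M2 i [] (Suc x)) \<and> (\<forall>x'<Suc x. \<forall>y<n. R x' y (store M2 i [] (Suc x)))"
      using I2 by (simp add: indep)
  qed
next
  fix M'
  assume "J M' \<and> (\<forall>x<n. \<forall>y<n. R x y M')" "\<And>b. b \<notin> assigned (For j a c) \<Longrightarrow> b \<noteq> i \<Longrightarrow> M' b = M b"
  then show "Q M'" using final[of M'] by simp
qed

text \<open>Every iteration lowers a natural number, so the loop ends and its cost is charged to the
  decrease. The final value stays in the bound: for pruning it leaves only the vertices actually
  deleted to be paid for. The argument \<open>x\<close> is a ghost state, later the current
  digraph.\<close>

lemma While_potential:
  assumes step: "\<And>x M. J x M \<Longrightarrow> bval M b \<Longrightarrow> silent N c M (\<lambda>M'. \<exists>x'. J x' M' \<and> f x' M' < (f x M :: nat))"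
    and "J x (mem s)"
  shows "\<exists>t x'. exec (While b c) s t \<and> choices t = choices s \<and> tape t = tape s \<and> J x' (mem t) \<and>
    \<not> bval (mem t) b \<and> f x' (mem t) \<le> f x (mem s) \<and>
    clock t \<le> clock s + (1 + bcost b + loop_cost N c) * (f x (mem s) - f x' (mem t)) + (1 + bcost b)"
  using assms(2)
proof (induction "f x (mem s)" arbitrary: x s rule: less_induct)
  case less
  let ?s = "tick (1 + bcost b) s" and ?K = "1 + bcost b + loop_cost N c"
  have s: "mem ?s = mem s" "choices ?s = choices s" "tape ?s = tape s" "clock ?s = clock s + (1 + bcost b)"
    by (auto simp: tick_def)
  show ?case
  proof (cases "bval (mem s) b")
    case False
    then have "exec (While b c) s ?s" by (rule exec.WhileFalse)
    then show ?thesis using False less.prems s by (intro exI[of _ ?s] exI[of _ x]) simp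
  next
    case True
    have "silent N c (mem ?s) (\<lambda>M'. \<exists>x'. J x' M' \<and> f x' M' < f x (mem s))"
      using step[OF less.prems True] s by simp
    then obtain t x' where t: "exec c ?s t" "clock t \<le> clock ?s + loop_cost N c" "choices t = choices ?s"
      "tape t = tape ?s" "J x' (mem t)" "f x' (mem t) < f x (mem s)"
      by (auto elim: silentE)
    obtain u y where u: "exec (While b c) t u" "choices u = choices t" "tape u = tape t" "J y (mem u)"
      "\<not> bval (mem u) b" "f y (mem u) \<le> f x' (mem t)"
      "clock u \<le> clock t + ?K * (f x' (mem t) - f y (mem u)) + (1 + bcost b)"
      using less.hyps[OF t(6,5)] by blast
    \<comment> \<open>One unit of the decrease pays for the present iteration.\<close>
    have "?K * (f x' (mem t) - f y (mem u)) + ?K * 1 = ?K * (f x' (mem t) - f y (mem u) + 1)"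
      by (simp only: add_mult_distrib2)
    also have "\<dots> \<le> ?K * (f x (mem s) - f y (mem u))"
      using t(6) u(6) by (intro mult_left_mono) auto
    finally have "clock u \<le> clock s + ?K * (f x (mem s) - f y (mem u)) + (1 + bcost b)"
      using u(7) t(2) s by simp
    moreover have "exec (While b c) s u" using exec.WhileTrue[OF True t(1) u(1)] .
    ultimately show ?thesis using u t s by (intro exI[of _ u] exI[of _ y]) auto
  qed
qed

section \<open>Pruning on the machine\<close>

text \<open>
  Sides are numbered 0 (workers) and 1 (firms), and the digraph is stored once for each side, so that
  a single program processes rows and columns. All arrays are padded to the size
  \<open>N = max m n\<close>. A line is a pair of a side and an index.

  The arrays \<open>aG\<close>, \<open>aX\<close> and \<open>aP\<close> hold the current digraph, the vertices to be avoided and the arcs, with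
  the side as first index. The arrays \<open>aFD\<close>, \<open>aFI\<close> and \<open>aFO\<close> hold the arguments of the pending calls,
  with the recursion depth as first index, and \<open>aSS\<close> and \<open>aSL\<close> form a stack of lines, of height \<open>aSP\<close>.
  After step 2.2, \<open>aH\<close> holds the successors of the heads of the rows (0 for empty rows), and
  \<open>aCand\<close> the rows whose heads are in \<open>M\<^sub>W - M\<^sub>F\<close>.
\<close>

abbreviation (input) "aN \<equiv> 10 :: nat"
abbreviation (input) "aG \<equiv> 11 :: nat"
abbreviation (input) "aX \<equiv> 12 :: nat"
abbreviation (input) "aP \<equiv> 13 :: nat"
abbreviation (input) "aFD \<equiv> 14 :: nat"
abbreviation (input) "aFI \<equiv> 15 :: nat"
abbreviation (input) "aFO \<equiv> 16 :: nat"
abbreviation (input) "aSS \<equiv> 17 :: nat"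
abbreviation (input) "aSL \<equiv> 18 :: nat"
abbreviation (input) "aSP \<equiv> 19 :: nat"
abbreviation (input) "aDepth \<equiv> 20 :: nat"
abbreviation (input) "vi \<equiv> 21 :: nat"
abbreviation (input) "vj \<equiv> 22 :: nat"
abbreviation (input) "vk \<equiv> 23 :: nat"
abbreviation (input) "aH \<equiv> 24 :: nat"
abbreviation (input) "aCand \<equiv> 25 :: nat"
abbreviation (input) "vcnt \<equiv> 26 :: nat"
abbreviation (input) "aRows \<equiv> 27 :: nat"
abbreviation (input) "vrows \<equiv> 28 :: nat"
abbreviation (input) "vbad \<equiv> 29 :: nat"
abbreviation (input) "aMark \<equiv> 30 :: nat"
abbreviation (input) "vs \<equiv> 31 :: nat"
abbreviation (input) "vl \<equiv> 32 :: nat"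
abbreviation (input) "vh \<equiv> 33 :: nat"
abbreviation (input) "vb \<equiv> 34 :: nat"
abbreviation (input) "vx \<equiv> 35 :: nat"
abbreviation (input) "vy \<equiv> 36 :: nat"
abbreviation (input) "vt \<equiv> 37 :: nat"

abbreviation (input) "pos e \<equiv> Less (Const 0) e"
abbreviation (input) "Or b1 b2 \<equiv> Not (And (Not b1) (Not b2))"

definition push :: "aexp \<Rightarrow> aexp \<Rightarrow> com" where
  "push e1 e2 = Seq (Assign aSS [rd aSP] e1) (Seq (Assign aSL [rd aSP] e2)
     (Assign aSP [] (Plus (rd aSP) (Const 1))))"

text \<open>Sets \<open>vh\<close> to the successor of the index of the head of line \<open>(vs, vl)\<close>, or to 0.\<close>

definition scan :: com where
  "scan = Seq (Assign vh [] (Const 0)) (For vk aN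
     (If (And (pos (Read aG [rd vs, rd vl, rd vk]))
              (Or (Not (pos (rd vh))) (pos (Read aP [rd vs, rd vl, Minus (rd vh) (Const 1), rd vk]))))
       (Assign vh [] (Plus (rd vk) (Const 1))) Skip))"

text \<open>Runs along the line of side \<open>vt\<close> that crosses line \<open>(vs, vl)\<close>
  at its head. It deletes what the owner of the crossing line likes less than the head, and the head
  itself if it is to be avoided; the two negated comparisons express \<open>vk = vl\<close>.\<close>

definition sweep :: com where
  "sweep = For vk aN
     (If (And (pos (Read aG [rd vt, rd vb, rd vk]))
              (Or (pos (Read aP [rd vt, rd vb, rd vk, rd vl]))
                  (And (And (Not (Less (rd vk) (rd vl))) (Not (Less (rd vl) (rd vk))))
                       (pos (Read aX [rd vs, rd vl, rd vb])))))
       (Seq (Assign aG [rd vt, rd vb, rd vk] (Const 0))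
       (Seq (Assign aG [rd vs, rd vk, rd vb] (Const 0))
       (Seq (push (rd vs) (rd vk)) (push (rd vt) (rd vb)))))
       Skip)"

definition process_line :: com where
  "process_line =
     Seq (Assign aSP [] (Minus (rd aSP) (Const 1)))
     (Seq (Assign vs [] (Read aSS [rd aSP]))
     (Seq (Assign vl [] (Read aSL [rd aSP]))
     (Seq (Assign vt [] (Minus (Const 1) (rd vs)))
     (Seq scan
     (If (pos (rd vh)) (Seq (Assign vb [] (Minus (rd vh) (Const 1))) sweep) Skip)))))"

definition push_all :: com where
  "push_all = Seq (Assign aSP [] (Const 0))
     (For vi aN (Seq (push (Const 0) (rd vi)) (push (Const 1) (rd vi))))"

definition prune_com :: com where
  "prune_com = Seq push_all (While (pos (rd aSP)) process_line)"

section \<open>Coordinates relative to a side, and the stack of lines\<close>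

definition vtx :: "nat \<Rightarrow> nat \<Rightarrow> nat \<Rightarrow> nat \<times> nat" where
  "vtx s a b = (if s = 0 then (a, b) else (b, a))"

definition line_of :: "nat \<Rightarrow> nat \<times> nat \<Rightarrow> nat" where
  "line_of s x = (if s = 0 then fst x else snd x)"

text \<open>A set, although a line may be stacked repeatedly: correctness needs only membership, and
  the running time is measured by the height \<open>aSP\<close>.\<close>

definition stack :: "memory \<Rightarrow> (nat \<times> nat) set" where
  "stack M = (\<lambda>i. (M aSS [i], M aSL [i])) ` {..<M aSP []}"

definition pushed :: "memory \<Rightarrow> nat \<Rightarrow> nat \<Rightarrow> memory" where
  "pushed M v w = store (store (store M aSS [M aSP []] v) aSL [M aSP []] w) aSP [] (Suc (M aSP []))"

lemma pushed_apply [simp]: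
  "a \<noteq> aSS \<Longrightarrow> a \<noteq> aSL \<Longrightarrow> a \<noteq> aSP \<Longrightarrow> pushed M v w a = M a"
  "pushed M v w aSP [] = Suc (M aSP [])"
  by (auto simp: pushed_def store_def)

lemma stack_pushed [simp]: "stack (pushed M v w) = insert (v, w) (stack M)"
proof -
  have "(\<lambda>i. (pushed M v w aSS [i], pushed M v w aSL [i])) ` {..<M aSP []} = stack M"
    by (auto simp: stack_def pushed_def image_iff)
  then show ?thesis by (simp add: stack_def lessThan_Suc) (simp add: pushed_def)
qed

lemma stack_cong: "M' aSS = M aSS \<Longrightarrow> M' aSL = M aSL \<Longrightarrow> M' aSP [] = M aSP [] \<Longrightarrow> stack M' = stack M"
  by (simp add: stack_def)

lemma stack_store [simp]: "a \<noteq> aSS \<Longrightarrow> a \<noteq> aSL \<Longrightarrow> a \<noteq> aSP \<Longrightarrow> stack (store M a is v) = stack M"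
  by (simp add: stack_def)

text \<open>The second expression is evaluated after the first write, so its value must not be
  affected by a change of \<open>aSS\<close>.\<close>

lemma silent_push:
  assumes "aval M e1 = v" "\<And>x y. aval (store M aSS x y) e2 = w" "Q (pushed M v w)"
  shows "silent N (push e1 e2) M Q"
  unfolding push_def using assms by (intro silent_Seq silent_Assign) (simp add: pushed_def)

lemma less_2: "s < (2::nat) \<longleftrightarrow> s = 0 \<or> s = 1" by auto

lemma vtx_swap: "s < 2 \<Longrightarrow> vtx (1 - s) b a = vtx s a b" "vtx 0 a b = (a, b)" "vtx 1 b a = (a, b)" "vtx (Suc 0) b a = (a, b)"
  by (auto simp: vtx_def)

lemma line_of_vtx [simp]: "line_of s (vtx s a b) = a"
  by (simp add: line_of_def vtx_def)

lemma vtx_inject [simp]: "vtx s a b = vtx s a' b' \<longleftrightarrow> a = a' \<and> b = b'"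
  by (auto simp: vtx_def)

lemma vtx_eq_iff: "s < 2 \<Longrightarrow> s' < 2 \<Longrightarrow>
    vtx s' a c = vtx s k b \<longleftrightarrow> s' = s \<and> a = k \<and> c = b \<or> s' = 1 - s \<and> a = b \<and> c = k"
  by (auto simp: vtx_def less_2)

lemma vtx_cases: "s < 2 \<Longrightarrow> x = vtx s (line_of s x) (line_of (1 - s) x)"
  by (cases x) (auto simp: vtx_def line_of_def less_2)

locale numbered = market P for P :: "(nat, nat) market" +
  assumes numbered: "numbered_market P"
begin

definition m where "m = card (workers P)"
definition n where "n = card (firms P)"
definition N where "N = max m n"

lemma vertices_less: "(w, f) \<in> V \<Longrightarrow> w < m \<and> f < n"
  using vertices_subset numbered unfolding numbered_market_def m_def n_def by auto

lemma vertices_N: "(w, f) \<in> V \<Longrightarrow> w < N \<and> f < N"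
  using vertices_less unfolding N_def by fastforce

definition arc where "arc s = (if s = 0 then W else F)"

lemma vtx_N: "vtx s a b \<in> V \<Longrightarrow> a < N \<and> b < N"
  using vertices_N by (auto simp: vtx_def split: if_splits)

lemma arc_V: "(x, y) \<in> arc s \<Longrightarrow> x \<in> V \<and> y \<in> V \<and> line_of s x = line_of s y"
  using rows.R_line cols.R_line by (auto simp: arc_def line_of_def split: if_splits)

lemma arc_irrefl: "(x, x) \<notin> arc s"
  using rows.R_irrefl cols.R_irrefl by (auto simp: arc_def)

lemma arc_trans: "(x, y) \<in> arc s \<Longrightarrow> (y, z) \<in> arc s \<Longrightarrow> (x, z) \<in> arc s"
  unfolding arc_def using rows.R_trans[of x y z] cols.R_trans[of x y z] by presburger

definition repG :: "memory \<Rightarrow> (nat \<times> nat) set \<Rightarrow> bool" where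
  "repG M D \<longleftrightarrow> (\<forall>s<2. \<forall>a<N. \<forall>b<N. M aG [s, a, b] = of_bool (vtx s a b \<in> D))"

definition repX :: "memory \<Rightarrow> (nat \<times> nat) set \<Rightarrow> bool" where
  "repX M D \<longleftrightarrow> (\<forall>s<2. \<forall>a<N. \<forall>b<N. M aX [s, a, b] = of_bool (vtx s a b \<in> D))"

definition repP :: "memory \<Rightarrow> bool" where
  "repP M \<longleftrightarrow> M aN [] = N \<and>
     (\<forall>s<2. \<forall>a<N. \<forall>b<N. \<forall>c<N. M aP [s, a, b, c] = of_bool ((vtx s a b, vtx s a c) \<in> arc s))"

lemma rep_cong:
  "M' aG = M aG \<Longrightarrow> repG M' D \<longleftrightarrow> repG M D"
  "M' aX = M aX \<Longrightarrow> repX M' D \<longleftrightarrow> repX M D"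
  "M' aN = M aN \<Longrightarrow> M' aP = M aP \<Longrightarrow> repP M' \<longleftrightarrow> repP M"
  by (simp_all add: repG_def repX_def repP_def)

lemma rep_store [simp]:
  "a \<noteq> aG \<Longrightarrow> repG (store M a is v) D \<longleftrightarrow> repG M D"
  "a \<noteq> aX \<Longrightarrow> repX (store M a is v) D \<longleftrightarrow> repX M D"
  "a \<noteq> aN \<Longrightarrow> a \<noteq> aP \<Longrightarrow> repP (store M a is v) \<longleftrightarrow> repP M"
  by (simp_all add: repG_def repX_def repP_def)

lemma rep_pushed [simp]:
  "repG (pushed M v w) D \<longleftrightarrow> repG M D"
  "repX (pushed M v w) D \<longleftrightarrow> repX M D"
  "repP (pushed M v w) \<longleftrightarrow> repP M"
  by (simp_all add: repG_def repX_def repP_def)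

definition scanned :: "(nat \<times> nat) set \<Rightarrow> nat \<Rightarrow> nat \<Rightarrow> nat \<Rightarrow> nat \<Rightarrow> bool" where
  "scanned D s l k h \<longleftrightarrow> (if h = 0 then \<forall>c<k. vtx s l c \<notin> D
     else h \<le> k \<and> vtx s l (h - 1) \<in> D \<and>
       (\<forall>c<k. vtx s l c \<in> D \<longrightarrow> (vtx s l (h - 1), vtx s l c) \<notin> arc s))"

text \<open>All coordinates of \<open>D\<close> are below \<open>N\<close>, so the best of the first
  \<open>N\<close> positions is the head of the whole line.\<close>

lemma scanned_N:
  assumes "scanned D s l N h" "D \<subseteq> V" "s < 2"
  shows "h = 0 \<Longrightarrow> vtx s l b \<notin> D"
    and "h > 0 \<Longrightarrow> h - 1 < N \<and> vtx s l (h - 1) \<in> heads (arc s) D"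
proof -
  show "vtx s l b \<notin> D" if "h = 0"
    using assms(1,2) vtx_N that by (auto simp: scanned_def)
  assume h: "h > 0"
  have "(vtx s l (h - 1), y) \<notin> arc s" if "y \<in> D" for y
  proof
    assume arc: "(vtx s l (h - 1), y) \<in> arc s"
    then have y: "y = vtx s l (line_of (1 - s) y)"
      using vtx_cases[OF assms(3), of y] arc_V[OF arc] by simp
    then have "line_of (1 - s) y < N" using that assms(2) vtx_N by (metis subsetD)
    then show False using assms(1) h y arc that unfolding scanned_def by (metis neq0_conv)
  qed
  then show "h - 1 < N \<and> vtx s l (h - 1) \<in> heads (arc s) D"
    using assms(1) h by (auto simp: scanned_def heads_def)
qed

lemma scan:
  assumes "repG M D" "repP M" "M vs [] = s" "M vl [] = l" "s < 2" "l < N" "D \<subseteq> V"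
  shows "silent N scan M (\<lambda>M'. scanned D s l N (M' vh []) \<and> (\<forall>a. a \<notin> {vk, vh} \<longrightarrow> M' a = M a))"
  unfolding scan_def
proof (rule silent_Seq, rule silent_Assign, rule silent_For[where n = N and
    I = "\<lambda>k M'. scanned D s l k (M' vh [])"], goal_cases)
  case (7 k M')
  from 7(3) have fr: "M' a = M a" if "a \<notin> {vk, vh}" for a using that by (simp add: store_def)
  have G: "M' aG [s, l, k] = of_bool (vtx s l k \<in> D)"
    using assms 7(1) fr by (simp add: repG_def)
  have Pr: "M' aP [s, l, h, k] = of_bool ((vtx s l h, vtx s l k) \<in> arc s)" if "h < N" for h
    using assms 7(1) fr that by (simp add: repP_def)
  let ?h = "M' vh []"
  have hN: "?h - Suc 0 < N" if "?h > 0" using 7(1,4) that by (auto simp: scanned_def)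
  have "scanned D s l (Suc k) (Suc k)"
    if "vtx s l k \<in> D" "?h = 0 \<or> (vtx s l (?h - Suc 0), vtx s l k) \<in> arc s"
    using that 7(4) arc_trans[of "vtx s l (?h - Suc 0)" "vtx s l k" s "vtx s l c" for c] arc_irrefl[of "vtx s l k" s]
    by (auto simp: scanned_def less_Suc_eq split: if_splits)
  moreover have "scanned D s l (Suc k) ?h"
    if "\<not> (vtx s l k \<in> D \<and> (?h = 0 \<or> (vtx s l (?h - Suc 0), vtx s l k) \<in> arc s))"
    using that 7(4) by (auto simp: scanned_def less_Suc_eq split: if_splits)
  ultimately show ?case
    using 7(2) fr assms G Pr[OF hN]
    by (intro silent_If silent_Assign silent_Skip; cases "?h = 0") (auto split: if_splits)
next
  case (8 M')
  then show ?case by (auto simp: store_def)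
qed (use assms in \<open>auto simp: scanned_def repP_def\<close>)

definition lines :: "nat \<times> nat \<Rightarrow> (nat \<times> nat) set" where
  "lines x = {(0, fst x), (1, snd x)}"

lemma lines_vtx: "s < 2 \<Longrightarrow> lines (vtx s a b) = {(s, a), (1 - s, b)}"
  by (auto simp: lines_def vtx_def less_2)

text \<open>What processing a line with head \<open>x\<close> removes. For a head of the line,
  emptiness means that \<open>x\<close> is a tail of the other side and need not be avoided, as
  \<open>final\<close> demands.\<close>

definition killed :: "(nat \<times> nat) set \<Rightarrow> (nat \<times> nat) set \<Rightarrow> nat \<Rightarrow> nat \<times> nat \<Rightarrow> (nat \<times> nat) set" where
  "killed D out s x = D \<inter> ({y. (y, x) \<in> arc (1 - s)} \<union> ({x} \<inter> out))"

text \<open>Each iteration tests and deletes only the vertex at its own position, so deletions made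
  earlier in the loop do not influence later tests. Every deleted vertex puts its two lines on the
  stack, whence \<open>2 * card K\<close>.\<close>

lemma sweep:
  assumes "repG M D" "repX M out" "repP M" "M vs [] = s" "M vl [] = l" "M vt [] = 1 - s" "M vb [] = b"
    and "s < 2" "l < N" "b < N" "D \<subseteq> V"
  defines "K \<equiv> killed D out s (vtx s l b)"
  shows "silent N sweep M (\<lambda>M'. repG M' (D - K) \<and> M' aSP [] = M aSP [] + 2 * card K \<and>
    stack M' = stack M \<union> \<Union>(lines ` K) \<and> (\<forall>a. a \<notin> {vk, aG, aSS, aSL, aSP} \<longrightarrow> M' a = M a))"
proof -
  define J where "J k = K \<inter> (\<lambda>c. vtx s c b) ` {..<k}" for k
  have finK: "finite K" using finite_digraph[OF assms(11)] by (simp add: K_def killed_def)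
  have J0: "J 0 = {}" by (simp add: J_def)
  have K_vtx: "y \<in> (\<lambda>c. vtx s c b) ` {..<N}" if "y \<in> K" for y
  proof -
    have "y \<in> D" "line_of (1 - s) y = b"
      using that arc_V[of y "vtx s l b" "1 - s"] assms(8)
      by (auto simp: K_def killed_def line_of_def vtx_def less_2)
    then have "y = vtx s (line_of s y) b" using vtx_cases[OF assms(8), of y] by simp
    moreover have "line_of s y < N" using \<open>y \<in> D\<close> assms(11) vtx_N calculation by (metis subsetD)
    ultimately show ?thesis by blast
  qed
  then have JN: "J N = K" by (auto simp: J_def)
  have J_Suc: "J (Suc k) = (if vtx s k b \<in> K then insert (vtx s k b) (J k) else J k)" for k
    by (auto simp: J_def lessThan_Suc)
  have J_new: "vtx s k b \<notin> J k" for k by (auto simp: J_def)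
  have finJ: "finite (J k)" for k using finK by (simp add: J_def)
  show ?thesis unfolding sweep_def
  proof (rule silent_For[where n = N and I = "\<lambda>k M'. repG M' (D - J k) \<and>
        M' aSP [] = M aSP [] + 2 * card (J k) \<and> stack M' = stack M \<union> \<Union>(lines ` J k)"], goal_cases)
    case (7 k M')
    from 7(3) have fr: "M' a = M a" if "a \<notin> {vk, aG, aSS, aSL, aSP}" for a using that by (simp add: push_def)
    have t: "1 - s < 2" "vtx (1 - s) b k = vtx s k b" "vtx (1 - s) b l = vtx s l b"
      using vtx_swap(1)[OF assms(8)] by auto
    have G: "M' aG [1 - s, b, k] = of_bool (vtx s k b \<in> D)"
      using 7 assms(10) t J_new[of k] by (auto simp: repG_def)
    have Pr: "M' aP [1 - s, b, k, l] = of_bool ((vtx s k b, vtx s l b) \<in> arc (1 - s))"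
      using assms(3,9,10) 7(1) fr t by (simp add: repP_def)
    have X: "M' aX [s, l, b] = of_bool (vtx s l b \<in> out)"
      using assms(2,8,9,10) fr by (simp add: repX_def)
    have vars: "M' vs [] = s" "M' vl [] = l" "M' vt [] = 1 - s" "M' vb [] = b" "M' vk [] = k"
      using fr assms 7(2) by auto
    have inK: "vtx s k b \<in> K \<longleftrightarrow>
        vtx s k b \<in> D \<and> ((vtx s k b, vtx s l b) \<in> arc (1 - s) \<or> k = l \<and> vtx s l b \<in> out)"
      by (auto simp: K_def killed_def)
    let ?M = "store (store M' aG [1 - s, b, k] 0) aG [s, k, b] 0"
    have G': "repG ?M (D - insert (vtx s k b) (J k))"
      unfolding repG_def
    proof (intro allI impI)
      fix s' a c :: nat assume s': "s' < 2" and "a < N" "c < N"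
      then have "M' aG [s', a, c] = of_bool (vtx s' a c \<in> D - J k)" using 7(4) by (simp add: repG_def)
      then show "?M aG [s', a, c] = of_bool (vtx s' a c \<in> D - insert (vtx s k b) (J k))"
        using vtx_eq_iff[OF assms(8) s', of a c k b] by simp
    qed
    have "silent N (Seq (Assign aG [rd vt, rd vb, rd vk] (Const 0))
       (Seq (Assign aG [rd vs, rd vk, rd vb] (Const 0))
       (Seq (push (rd vs) (rd vk)) (push (rd vt) (rd vb))))) M'
       (\<lambda>M''. repG (store M'' vk [] (Suc k)) (D - J (Suc k)) \<and>
        store M'' vk [] (Suc k) aSP [] = M aSP [] + 2 * card (J (Suc k)) \<and>
        stack (store M'' vk [] (Suc k)) = stack M \<union> \<Union>(lines ` J (Suc k)))" if "vtx s k b \<in> K"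
    proof (intro silent_Seq silent_Assign, rule silent_push[where v = s and w = k],
        goal_cases)
      case 3
      show ?case
        apply (rule silent_push[where v = "1 - s" and w = b])
        using vars that J_Suc[of k] J_new[of k] finJ[of k] G' 7(4) lines_vtx[OF assms(8), of k b]
        by (auto simp: card_insert_if)
    qed (use vars in auto)
    moreover have "silent N Skip M'
       (\<lambda>M''. repG (store M'' vk [] (Suc k)) (D - J (Suc k)) \<and>
        store M'' vk [] (Suc k) aSP [] = M aSP [] + 2 * card (J (Suc k)) \<and>
        stack (store M'' vk [] (Suc k)) = stack M \<union> \<Union>(lines ` J (Suc k)))" if "vtx s k b \<notin> K"
      using that J_Suc[of k] 7(4) by (intro silent_Skip) auto
    ultimately show ?case
      using vars G Pr X inK by (intro silent_If) auto
  next
    case (8 M')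
    then show ?case using JN by (auto simp: push_def)
  qed (use assms J0 in \<open>auto simp: push_def repP_def\<close>)
qed

definition clean :: "(nat \<times> nat) set \<Rightarrow> (nat \<times> nat) set \<Rightarrow> nat \<Rightarrow> nat \<Rightarrow> bool" where
  "clean D out s a \<longleftrightarrow> (\<forall>x\<in>heads (arc s) D. line_of s x = a \<longrightarrow> killed D out s x = {})"

text \<open>Lines off the stack have nothing left to delete. The clause for empty \<open>out\<close>
  serves the initial IDUA run, which needs dominance for \<open>dominated_final\<close>.\<close>

definition prune_inv :: "(nat \<times> nat) set \<Rightarrow> (nat \<times> nat) set \<Rightarrow> (nat \<times> nat) set \<Rightarrow> memory \<Rightarrow> bool" where
  "prune_inv D0 out D M \<longleftrightarrow> repG M D \<and> repX M out \<and> repP M \<and>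
     reduced D0 out D \<and> (out = {} \<longrightarrow> (\<forall>y\<in>D0 - D. dominated W F D y)) \<and>
     stack M \<subseteq> {..<2} \<times> {..<N} \<and> (\<forall>s<2. \<forall>a<N. (s, a) \<in> stack M \<or> clean D out s a)"

lemma head_unique:
  assumes "s < 2" "D \<subseteq> V" "x \<in> heads (arc s) D" "y \<in> heads (arc s) D" "line_of s x = line_of s y"
  shows "x = y"
  using assms rows.inj_on_heads[OF assms(2)] cols.inj_on_heads[OF assms(2)]
  by (auto simp: less_2 arc_def line_of_def inj_on_def)

text \<open>Row heads are covered by \<open>reduced_process\<close>, and column heads by its dual
  with the two sides exchanged.\<close>

lemma reduced_killed:
  assumes "reduced D0 out D" "D0 \<subseteq> V" "s < 2" "x \<in> heads (arc s) D"
  shows "reduced D0 out (D - killed D out s x)"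
proof -
  interpret dual: matching_digraph F W snd fst V by unfold_locales
  have dual: "dual.reduced D0 out D' \<longleftrightarrow> reduced D0 out D'" for D'
    unfolding reduced_def dual.reduced_def using stable_commute[of F W] by auto
  have *: "D - killed D out s x = D - {y. (y, x) \<in> arc (1 - s)} - {x} \<inter> out"
    by (auto simp: killed_def)
  from assms(3) consider "s = 0" | "s = 1" by (auto simp: less_2)
  then show ?thesis
  proof cases
    case 1
    then show ?thesis using reduced_process[OF assms(1,2)] assms(4) * by (simp add: arc_def)
  next
    case 2
    have "dual.reduced D0 out D" using assms(1) dual by simp
    then have "dual.reduced D0 out (D - killed D out s x)"
      by (rule dual.reduced_process[OF _ assms(2)]) (use assms(4) * 2 in \<open>simp_all add: arc_def\<close>)
    then show ?thesis using dual by simp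
  qed
qed

text \<open>A line that loses no vertex keeps its head, and deletions elsewhere can only shrink what
  that head kills.\<close>

lemma clean_delete:
  assumes "clean D out s a" "s < 2" "D' \<subseteq> D" "D \<subseteq> V" "\<And>y. y \<in> D - D' \<Longrightarrow> line_of s y \<noteq> a"
  shows "clean D' out s a"
  unfolding clean_def
proof (intro ballI impI)
  fix x assume x: "x \<in> heads (arc s) D'" "line_of s x = a"
  have "(x, y) \<notin> arc s" if "y \<in> D" for y
  proof
    assume arc: "(x, y) \<in> arc s"
    then have "line_of s y = a" using arc_V x by metis
    then have "y \<in> D'" using assms(5) that by blast
    then show False using arc x(1) by (auto simp: heads_def)
  qed
  then have "x \<in> heads (arc s) D" using x assms(3) by (auto simp: heads_def)
  then have "killed D out s x = {}" using assms(1) x by (simp add: clean_def)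
  then show "killed D' out s x = {}" using assms(3) by (auto simp: killed_def)
qed

text \<open>A vertex weighs 2, which pays for the two lines pushed when it is deleted; the popped
  entry makes the sum strictly smaller.\<close>

lemma process_line:
  assumes inv: "prune_inv D0 out D M" and D0: "D0 \<subseteq> V" and sp: "M aSP [] > 0"
  shows "silent N process_line M (\<lambda>M'. \<exists>D'. prune_inv D0 out D' M' \<and>
    M' aSP [] + 2 * card D' < M aSP [] + 2 * card D)"
proof -
  have DV: "D \<subseteq> V" using inv D0 by (auto simp: prune_inv_def reduced_def)
  let ?i = "M aSP [] - 1"
  define s where "s = M aSS [?i]"
  define l where "l = M aSL [?i]"
  have "(s, l) \<in> stack M" using sp by (auto simp: stack_def s_def l_def)
  then have s: "s < 2" and l: "l < N" using inv by (auto simp: prune_inv_def)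
  define M1 where "M1 = store (store (store (store M aSP [] ?i) vs [] s) vl [] l) vt [] (1 - s)"
  have stack: "stack M = insert (s, l) (stack M1)"
  proof -
    have "{..<M aSP []} = insert ?i {..<?i}" using sp by auto
    then show ?thesis by (simp add: stack_def M1_def s_def l_def)
  qed
  have rep1: "repG M1 D" "repX M1 out" "repP M1" using inv by (auto simp: M1_def prune_inv_def)
  have other: "(s', a) \<in> stack M1 \<or> clean D out s' a" if "s' < 2" "a < N" "(s', a) \<noteq> (s, l)" for s' a
    using inv that stack by (auto simp: prune_inv_def)
  have scan1: "silent N scan M1 (\<lambda>M2. scanned D s l N (M2 vh []) \<and> (\<forall>a. a \<notin> {vk, vh} \<longrightarrow> M2 a = M1 a))"
    using s l DV rep1 by (intro scan) (auto simp: M1_def)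
  have rest: "silent N (If (pos (rd vh)) (Seq (Assign vb [] (Minus (rd vh) (Const 1))) sweep) Skip) M2
      (\<lambda>M'. \<exists>D'. prune_inv D0 out D' M' \<and> M' aSP [] + 2 * card D' < M aSP [] + 2 * card D)"
    if M2: "scanned D s l N (M2 vh [])" "\<And>a. a \<notin> {vk, vh} \<Longrightarrow> M2 a = M1 a" for M2
  proof (rule silent_If)
    have st2: "stack M2 = stack M1" by (rule stack_cong) (use M2(2) in auto)
    have rep2: "repG M2 D" "repX M2 out" "repP M2" 
      using rep1 M2(2) rep_cong(1)[of M2 M1 D] rep_cong(2)[of M2 M1 out] rep_cong(3)[of M2 M1] by simp_all
    {
      assume "\<not> bval M2 (pos (rd vh))"
      then have "vtx s l b \<notin> D" for b using scanned_N(1)[OF M2(1) DV s] by simp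
      then have "line_of s x \<noteq> l" if "x \<in> D" for x using vtx_cases[OF s, of x] that by metis
      then have "clean D out s l" by (auto simp: clean_def heads_def)
      then have "prune_inv D0 out D M2"
        using inv other st2 stack rep2 by (auto simp: prune_inv_def)
      moreover have "M2 aSP [] < M aSP []" using M2(2) sp by (simp add: M1_def)
      ultimately show "silent N Skip M2 (\<lambda>M'. \<exists>D'. prune_inv D0 out D' M' \<and>
          M' aSP [] + 2 * card D' < M aSP [] + 2 * card D)"
        by (intro silent_Skip exI[of _ D]) simp
    }
    assume "bval M2 (pos (rd vh))"
    then have h: "M2 vh [] > 0" by simp
    define b where "b = M2 vh [] - 1"
    define x where "x = vtx s l b"
    have b: "b < N" and x: "x \<in> heads (arc s) D"
      using scanned_N(2)[OF M2(1) DV s h] by (auto simp: b_def x_def)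
    define K where "K = killed D out s x"
    define M3 where "M3 = store M2 vb [] b"
    have "silent N sweep M3 (\<lambda>M'. repG M' (D - K) \<and> M' aSP [] = M3 aSP [] + 2 * card K \<and>
        stack M' = stack M3 \<union> \<Union>(lines ` K) \<and> (\<forall>a. a \<notin> {vk, aG, aSS, aSL, aSP} \<longrightarrow> M' a = M3 a))"
      unfolding K_def x_def using rep2 M2(2) s l b DV by (intro sweep) (auto simp: M3_def M1_def)
    then have "silent N sweep M3 (\<lambda>M'. \<exists>D'. prune_inv D0 out D' M' \<and>
        M' aSP [] + 2 * card D' < M aSP [] + 2 * card D)"
    proof (rule silent_mono, intro exI[of _ "D - K"])
      fix M'
      assume M': "repG M' (D - K) \<and> M' aSP [] = M3 aSP [] + 2 * card K \<and>
        stack M' = stack M3 \<union> \<Union>(lines ` K) \<and> (\<forall>a. a \<notin> {vk, aG, aSS, aSL, aSP} \<longrightarrow> M' a = M3 a)"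
      have KD: "K \<subseteq> D" by (auto simp: K_def killed_def)
      have fin: "finite D" "finite K" using finite_digraph[OF DV] KD finite_subset by auto
      have st: "stack M' = stack M1 \<union> \<Union>(lines ` K)" using M' st2 by (simp add: M3_def)
      have "M3 aSP [] < M aSP []" using M2(2) sp by (simp add: M3_def M1_def)
      moreover have "card (D - K) + card K = card D"
        using KD fin by (metis card_Diff_subset card_mono le_add_diff_inverse2)
      ultimately have less: "M' aSP [] + 2 * card (D - K) < M aSP [] + 2 * card D" using M' by linarith
      have red: "reduced D0 out (D - K)"
        using reduced_killed[OF _ D0 s x] inv by (simp add: K_def prune_inv_def)
      \<comment> \<open>With \<open>out\<close> empty, all of \<open>K\<close> is dominated by the
        head just found, and dominance survives the deletion of dominated vertices.\<close>
      have dom: "dominated W F (D - K) y" if "out = {}" "y \<in> D0 - (D - K)" for y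
      proof -
        have Kdom: "dominated W F D z" if "z \<in> K" for z
          using that x \<open>out = {}\<close> s by (auto simp: K_def killed_def dominated_def arc_def less_2)
        have "dominated W F D y" using that inv Kdom[of y] unfolding prune_inv_def by blast
        then show ?thesis using Kdom by (intro dominated_delete[of D y "D - K"]) auto
      qed
      have KN: "lines z \<subseteq> {..<2} \<times> {..<N}" if "z \<in> K" for z
        using that KD DV vertices_N by (cases z) (auto simp: lines_def)
      have valid: "stack M' \<subseteq> {..<2} \<times> {..<N}"
      proof -
        have "stack M \<subseteq> {..<2} \<times> {..<N}" using inv by (simp add: prune_inv_def)
        then have "stack M1 \<subseteq> {..<2} \<times> {..<N}" using stack by (metis insert_subset)
        moreover have "\<Union>(lines ` K) \<subseteq> {..<2} \<times> {..<N}" by (rule UN_least) (rule KN)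
        ultimately show ?thesis unfolding st by (rule Un_least)
      qed
      have line: "(s', line_of s' z) \<in> stack M'" if "z \<in> K" "s' < 2" for z s'
        using that st by (auto simp: lines_def line_of_def less_2)
      have clean: "(s', a) \<in> stack M' \<or> clean (D - K) out s' a" if s'a: "s' < 2" "a < N" for s' a
      proof (cases "(s', a) \<in> stack M'")
        case False
        then have K_a: "line_of s' z \<noteq> a" if "z \<in> K" for z
          using line[OF that s'a(1)] by blast
        have "clean (D - K) out s' a"
        proof (cases "(s', a) = (s, l)")
          case False
          then have "clean D out s' a"
            using other[OF s'a] \<open>(s', a) \<notin> stack M'\<close> unfolding st by blast
          then show ?thesis by (rule clean_delete) (use s'a K_a DV in auto)
        next
          case True
          \<comment> \<open>Had the head of the processed line been deleted itself, that line would
            be back on the stack.\<close>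
          then have xK: "x \<notin> K" using K_a[of x] by (auto simp: x_def)
          have xD: "x \<in> D" using x heads_subset by (rule subsetD[rotated])
          then have x': "x \<in> heads (arc s) (D - K)" using heads_mono[OF x, of "D - K"] xK by simp
          have "killed (D - K) out s x = {}" by (auto simp: K_def killed_def)
          moreover have "y = x" if "y \<in> heads (arc s) (D - K)" "line_of s y = l" for y
            using head_unique[OF s _ that(1) x'] that(2) DV by (auto simp: x_def)
          ultimately show ?thesis using True by (auto simp: clean_def)
        qed
        then show ?thesis ..
      qed blast
      have "repX M' out" "repP M'" 
        using rep2 M' rep_cong(2)[of M' M2 out] rep_cong(3)[of M' M2] by (simp_all add: M3_def store_def)
      then show "prune_inv D0 out (D - K) M' \<and> M' aSP [] + 2 * card (D - K) < M aSP [] + 2 * card D"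
        unfolding prune_inv_def using less red dom valid clean M' by simp
    qed
    then show "silent N (Seq (Assign vb [] (Minus (rd vh) (Const 1))) sweep) M2 (\<lambda>M'. \<exists>D'. prune_inv D0 out D' M' \<and>
        M' aSP [] + 2 * card D' < M aSP [] + 2 * card D)"
      by (intro silent_Seq silent_Assign) (simp add: M3_def b_def)
  qed
  show ?thesis
    unfolding process_line_def
    apply (intro silent_Seq silent_Assign)
    using scan1 rest by (auto simp: M1_def s_def l_def intro: silent_mono)
qed

lemma push_all:
  assumes "M aN [] = N"
  shows "silent N push_all M (\<lambda>M'. M' aSP [] = 2 * N \<and> stack M' = {..<2} \<times> {..<N} \<and>
    (\<forall>a. a \<notin> {vi, aSS, aSL, aSP} \<longrightarrow> M' a = M a))"
  unfolding push_all_def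
proof (rule silent_Seq, rule silent_Assign,
    rule silent_For[where n = N and I = "\<lambda>k M'. M' aSP [] = 2 * k \<and> stack M' = {..<2} \<times> {..<k}"], goal_cases)
  case (7 k M')
  have "{..<2::nat} \<times> {..<Suc k} = insert (1, k) (insert (0, k) ({..<2} \<times> {..<k}))"
    by (auto simp: less_2 less_Suc_eq)
  note set_eq = this
  have "silent N (push (Const 1) (rd vi)) (pushed M' 0 k)
    (\<lambda>M''. store M'' vi [] (Suc k) aSP [] = 2 * Suc k \<and> stack (store M'' vi [] (Suc k)) = {..<2} \<times> {..<Suc k})"
    by (rule silent_push[where v = 1 and w = k]) (use 7 set_eq in auto)
  note pushed1 = this
  show ?case
    by (rule silent_Seq[OF silent_push[where v = 0 and w = k]]) (use 7 pushed1 in auto)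
next
  case (8 M')
  then show ?case by (auto simp: push_def store_def)
qed (use assms in \<open>auto simp: push_def stack_def\<close>)

text \<open>With the stack empty every line is clean, which yields \<open>final\<close>. The initial
  height is \<open>2 * N\<close>; the constant 10 generously covers the guard, whose test costs
  4.\<close>

lemma prune_com:
  assumes "repG (mem c) D0" "repX (mem c) out" "repP (mem c)" "D0 \<subseteq> V"
  shows "\<exists>c' D. exec prune_com c c' \<and> choices c' = choices c \<and> tape c' = tape c \<and>
    repG (mem c') D \<and> final D0 out D \<and> (out = {} \<longrightarrow> (\<forall>y\<in>D0 - D. dominated W F D y)) \<and>
    clock c' \<le> clock c + loop_cost N push_all + 10 + (10 + loop_cost N process_line) * (2 * N + 2 * (card D0 - card D))"
proof -
  have "silent N push_all (mem c) (\<lambda>M'. M' aSP [] = 2 * N \<and> stack M' = {..<2} \<times> {..<N} \<and>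
      (\<forall>a. a \<notin> {vi, aSS, aSL, aSP} \<longrightarrow> M' a = mem c a))"
    using assms(3) by (intro push_all) (simp add: repP_def)
  then obtain c1 where c1: "exec push_all c c1" "clock c1 \<le> clock c + loop_cost N push_all"
    "choices c1 = choices c" "tape c1 = tape c" "mem c1 aSP [] = 2 * N" "stack (mem c1) = {..<2} \<times> {..<N}"
    "\<And>a. a \<notin> {vi, aSS, aSL, aSP} \<Longrightarrow> mem c1 a = mem c a"
    by (rule silentE) blast
  have "repG (mem c1) D0" "repX (mem c1) out" "repP (mem c1)"
    using assms c1(7) rep_cong(1)[of "mem c1" "mem c" D0] rep_cong(2)[of "mem c1" "mem c" out]
      rep_cong(3)[of "mem c1" "mem c"] by simp_all
  then have inv: "prune_inv D0 out D0 (mem c1)"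
    using c1(6) reduced_refl by (simp add: prune_inv_def)
  let ?b = "pos (rd aSP)" and ?f = "\<lambda>D M. M aSP [] + 2 * card D"
  have "silent N process_line M (\<lambda>M'. \<exists>D'. prune_inv D0 out D' M' \<and> ?f D' M' < ?f D M)"
    if "prune_inv D0 out D M" "bval M ?b" for D M
    using process_line[OF that(1) assms(4)] that(2) by simp
  from While_potential[where J = "prune_inv D0 out" and f = ?f, OF this inv]
  obtain c2 D where c2: "exec (While ?b process_line) c1 c2" "choices c2 = choices c1" "tape c2 = tape c1"
    "prune_inv D0 out D (mem c2)" "\<not> bval (mem c2) ?b"
    "clock c2 \<le> clock c1 + (1 + bcost ?b + loop_cost N process_line) * (?f D0 (mem c1) - ?f D (mem c2)) + (1 + bcost ?b)"
    by blast
  have sp: "mem c2 aSP [] = 0" using c2(5) by simp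
  then have st: "stack (mem c2) = {}" by (simp add: stack_def)
  have DV: "D \<subseteq> V" and red: "reduced D0 out D" using c2(4) assms(4) by (auto simp: prune_inv_def reduced_def)
  have no_kill: "killed D out s x = {}" if "s < 2" "x \<in> heads (arc s) D" for s x
  proof -
    have "x \<in> V" using that(2) DV heads_subset by fast
    then have "line_of s x < N" using vtx_N vtx_cases[OF that(1)] by metis
    then have "clean D out s (line_of s x)" using c2(4) st that(1) by (auto simp: prune_inv_def)
    then show ?thesis using that(2) by (auto simp: clean_def)
  qed
  have "final D0 out D"
  proof -
    have W: "x \<in> tails F D \<and> x \<notin> out" if "x \<in> heads W D" for x
      using that no_kill[of 0 x] by (auto simp: killed_def arc_def heads_def tails_def)
    have F: "x \<in> tails W D \<and> x \<notin> out" if "x \<in> heads F D" for x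
      using that no_kill[of 1 x] by (auto simp: killed_def arc_def heads_def tails_def)
    show ?thesis using W F red unfolding final_def normal_def by blast
  qed
  moreover have "exec prune_com c c2" unfolding prune_com_def by (rule exec.Seq[OF c1(1) c2(1)])
  moreover have "?f D0 (mem c1) - ?f D (mem c2) = 2 * N + 2 * (card D0 - card D)"
  proof -
    have "card D \<le> card D0" using red finite_digraph[OF assms(4)] by (auto simp: reduced_def intro: card_mono)
    then show ?thesis using c1(5) sp by simp
  qed
  then have "clock c2 \<le> clock c + loop_cost N push_all + 10 +
      (10 + loop_cost N process_line) * (2 * N + 2 * (card D0 - card D))"
  proof -
    have "(1 + bcost ?b + loop_cost N process_line) * (2 * N + 2 * (card D0 - card D)) \<le>
        (10 + loop_cost N process_line) * (2 * N + 2 * (card D0 - card D))"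
      by (rule mult_right_mono) auto
    then show ?thesis using c2(6) c1(2) \<open>?f D0 (mem c1) - _ = _\<close> by simp
  qed
  moreover have "out = {} \<longrightarrow> (\<forall>y\<in>D0 - D. dominated W F D y)" "repG (mem c2) D"
    using c2(4) by (auto simp: prune_inv_def)
  ultimately show ?thesis using c1(3,4) c2(2,3) by (intro exI[of _ c2] exI[of _ D] conjI) auto
qed

end

section \<open>Recursive calls on the machine\<close>

abbreviation (input) "cur a \<equiv> Read a [rd aDepth, rd vi, rd vj]"
abbreviation (input) "next_ij \<equiv> [Plus (rd aDepth) (Const 1), rd vi, rd vj]"

definition log_call :: com where
  "log_call = Seq (Emit (Const 0)) (For vi 0 (For vj 1
     (Seq (Emit (cur aFD)) (Seq (Emit (cur aFI)) (Emit (cur aFO))))))"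

text \<open>Records which lines contain a vertex of \<open>inn\<close>, so that membership in
  \<open>same_lines\<close> becomes a test of constant cost and \<open>load\<close> stays
  quadratic.\<close>

definition marks :: com where
  "marks = For vi aN
     (Seq (Assign aMark [Const 0, rd vi] (Const 0))
     (Seq (Assign aMark [Const 1, rd vi] (Const 0))
     (For vj aN
       (Seq (If (pos (cur aFI)) (Assign aMark [Const 0, rd vi] (Const 1)) Skip)
            (If (pos (Read aFI [rd aDepth, rd vj, rd vi])) (Assign aMark [Const 1, rd vi] (Const 1)) Skip)))))"

definition load :: com where
  "load = For vi aN (For vj aN
     (Seq (Assign aG [Const 0, rd vi, rd vj] (cur aFD))
     (Seq (Assign aG [Const 1, rd vj, rd vi] (cur aFD))
     (If (Or (pos (cur aFO)) (And (And (pos (cur aFD)) (Not (pos (cur aFI))))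
                                   (Or (pos (Read aMark [Const 0, rd vi])) (pos (Read aMark [Const 1, rd vj])))))
       (Seq (Assign aX [Const 0, rd vi, rd vj] (Const 1)) (Assign aX [Const 1, rd vj, rd vi] (Const 1)))
       (Seq (Assign aX [Const 0, rd vi, rd vj] (Const 0)) (Assign aX [Const 1, rd vj, rd vi] (Const 0)))))))"

text \<open>The flag \<open>vb\<close> reports a vertex other than the head, \<open>vx\<close> a
  vertex of \<open>inn\<close> that has been deleted. By \<open>cands_iff\<close> the first means
  that the head lies in the difference of the two sets of heads, so column heads need not be
  computed. Inequality is spelled out by two comparisons.\<close>

definition inspect_row :: com where
  "inspect_row = For vj aN
     (If (pos (Read aG [Const 0, rd vi, rd vj]))
       (If (Or (Less (Plus (rd vj) (Const 1)) (rd vh)) (Less (rd vh) (Plus (rd vj) (Const 1))))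
         (Assign vb [] (Const 1)) Skip)
       (If (pos (cur aFI)) (Assign vx [] (Const 1)) Skip))"

definition record_row :: com where
  "record_row =
     Seq (If (pos (rd vh)) (Assign vrows [] (Plus (rd vrows) (Const 1))) Skip)
     (Seq (If (pos (rd vb)) (Seq (Assign aCand [rd vcnt] (rd vi)) (Assign vcnt [] (Plus (rd vcnt) (Const 1)))) Skip)
     (If (pos (rd vx)) (Assign vbad [] (Const 1)) Skip))"

definition examine_row :: com where
  "examine_row = Seq (Assign aH [rd vi] (rd vh)) (Seq (Assign vb [] (Const 0)) (Seq (Assign vx [] (Const 0))
     (Seq inspect_row record_row)))"

definition inspect :: com where
  "inspect =
     Seq (Assign vcnt [] (Const 0)) (Seq (Assign vrows [] (Const 0)) (Seq (Assign vbad [] (Const 0))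
     (For vi aN
       (Seq (Assign vs [] (Const 0)) (Seq (Assign vl [] (rd vi)) (Seq scan examine_row))))))"

definition prelude :: com where
  "prelude = Seq log_call (Seq marks (Seq load (Seq prune_com inspect)))"

definition emit_matching :: com where
  "emit_matching = Seq (Emit (Const 1)) (For vi 0 (Emit (Read aH [rd vi])))"

definition pop :: com where
  "pop = Assign aDepth [] (Minus (rd aDepth) (Const 1))"

definition copy :: com where
  "copy = For vi aN (For vj aN
     (Seq (Assign aFD [rd aDepth, rd vi, rd vj] (Read aG [Const 0, rd vi, rd vj]))
     (Seq (Assign aFD next_ij (Read aG [Const 0, rd vi, rd vj]))
     (Seq (Assign aFI next_ij (cur aFI))
     (Seq (Assign aFO [rd aDepth, rd vi, rd vj] (Read aX [Const 0, rd vi, rd vj]))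
     (Assign aFO next_ij (Read aX [Const 0, rd vi, rd vj])))))))"

text \<open>The new frame holds the first subcall. The old one receives \<open>x\<close> in
  \<open>aFO\<close>, so that popping the new frame leaves the arguments of the second subcall in
  place.\<close>

definition add_choice :: com where
  "add_choice =
     Seq (Assign aFI [Plus (rd aDepth) (Const 1), rd vx, rd vy] (Const 1))
     (Seq (Assign aFO [rd aDepth, rd vx, rd vy] (Const 1))
     (Assign aDepth [] (Plus (rd aDepth) (Const 1))))"

definition branch :: com where
  "branch =
     Seq (Assign vx [] (Read aCand [rd vt]))
     (Seq (Assign vy [] (Minus (Read aH [rd vx]) (Const 1)))
     (Seq copy add_choice))"

definition decide :: com where
  "decide = If (Or (Less (rd vrows) (rd aRows)) (pos (rd vbad))) pop
     (If (Not (pos (rd vcnt))) (Seq emit_matching pop) (Seq (Choose vt [] (rd vcnt)) branch))"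

definition load_graph :: com where
  "load_graph = For vi aN (For vj aN
     (Seq (Assign aG [Const 0, rd vi, rd vj] (Read 2 [rd vi, rd vj]))
          (Assign aG [Const 1, rd vj, rd vi] (Read 2 [rd vi, rd vj]))))"

definition load_arcs :: com where
  "load_arcs = For vi aN (For vj aN (For vk aN
     (Seq (Assign aP [Const 0, rd vi, rd vj, rd vk] (Read 5 [rd vi, rd vj, rd vk]))
          (Assign aP [Const 1, rd vi, rd vj, rd vk] (Read 6 [rd vj, rd vi, rd vk])))))"

definition load_input :: com where
  "load_input = Seq (If (Less (rd 0) (rd 1)) (Assign aN [] (rd 1)) (Assign aN [] (rd 0)))
     (Seq load_graph load_arcs)"

definition first_call :: com where
  "first_call =
     Seq (Assign aRows [] (rd vrows))
     (Seq (For vi aN (For vj aN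
       (Seq (Assign aFD [Const 1, rd vi, rd vj] (Read aG [Const 0, rd vi, rd vj]))
       (Seq (Assign aFI [Const 1, rd vi, rd vj] (Read 3 [rd vi, rd vj]))
            (Assign aFO [Const 1, rd vi, rd vj] (Read 4 [rd vi, rd vj]))))))
     (Assign aDepth [] (Const 1)))"

definition init :: com where
  "init = Seq load_input (Seq prune_com (Seq inspect first_call))"

definition main_prog :: com where
  "main_prog = Seq init (While (pos (rd aDepth)) (Seq prelude decide))"

lemma product_append: "List.product (xs @ ys) zs = List.product xs zs @ List.product ys zs"
  by (induction xs) auto

context numbered
begin

definition repF :: "memory \<Rightarrow> nat \<Rightarrow> (nat \<times> nat) set \<Rightarrow> (nat \<times> nat) set \<Rightarrow> (nat \<times> nat) set \<Rightarrow> bool" where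
  "repF M d D inn out \<longleftrightarrow> (\<forall>a<N. \<forall>b<N. M aFD [d, a, b] = of_bool ((a, b) \<in> D) \<and>
     M aFI [d, a, b] = of_bool ((a, b) \<in> inn) \<and> M aFO [d, a, b] = of_bool ((a, b) \<in> out))"

lemma mn_N: "m \<le> N" "n \<le> N"
  by (auto simp: N_def)

lemma log_call:
  assumes "repF M d D inn out" "M aDepth [] = d" "M 0 [] = m" "M 1 [] = n"
  shows "emits N log_call M tp (\<lambda>M' tp'. tp' = tp @ encode_event m n (Call D inn out))"
proof -
  let ?g = "\<lambda>(w, f). [of_bool ((w, f) \<in> D), of_bool ((w, f) \<in> inn), of_bool ((w, f) \<in> out)] :: nat list"
  show ?thesis unfolding log_call_def
  proof (rule emits_Seq, rule emits_Emit, rule emits_For[where n = m and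
      I = "\<lambda>k M' tp'. tp' = tp @ 0 # concat (map ?g (List.product [0..<k] [0..<n]))"], goal_cases)
    case (7 k M1 tp1)
    from 7(3) have fr: "M1 a = M a" if "a \<notin> {vi, vj}" for a using that by simp
    show ?case
    proof (rule emits_For[where n = n and
      I = "\<lambda>l M' tp'. tp' = tp1 @ concat (map ?g (map (Pair k) [0..<l]))"], goal_cases)
      case (7 l M2 tp2)
      from 7(3) have fr2: "M2 a = M a" if "a \<notin> {vi, vj}" for a using that fr by simp
      have "M2 vi [] = k" using 7(3)[of vi] \<open>M1 vi [] = k\<close> by simp
      moreover have "k < N" "l < N" using \<open>k < m\<close> \<open>l < n\<close> mn_N by auto
      ultimately show ?case
        using assms fr2 7(2,4) by (intro emits_Seq emits_Emit) (simp add: repF_def)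
    next
      case (8 M2 tp2)
      then show ?case using 7(4) by (simp add: product_append)
    qed (use assms fr mn_N in auto)
  qed (use assms mn_N in auto)
qed

lemma marks:
  assumes "repF M d D inn out" "M aDepth [] = d" "M aN [] = N"
  shows "silent N marks M (\<lambda>M'. \<forall>a<N. M' aMark [0, a] = of_bool (\<exists>b<N. (a, b) \<in> inn) \<and>
    M' aMark [1, a] = of_bool (\<exists>b<N. (b, a) \<in> inn))"
  unfolding marks_def
proof (rule silent_For[where n = N and
      I = "\<lambda>k M'. \<forall>a<k. M' aMark [0, a] = of_bool (\<exists>b<N. (a, b) \<in> inn) \<and>
        M' aMark [1, a] = of_bool (\<exists>b<N. (b, a) \<in> inn)"], goal_cases)
  case (7 k M1)
  from 7(3) have fr: "M1 a = M a" if "a \<notin> {vi, vj, aMark}" for a using that by simp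
  show ?case
  proof (rule silent_Seq, rule silent_Assign, rule silent_Seq, rule silent_Assign,
      rule silent_For[where n = N and I = "\<lambda>l M'. (\<forall>a<k. M' aMark [0, a] = M1 aMark [0, a] \<and>
        M' aMark [1, a] = M1 aMark [1, a]) \<and> M' aMark [0, k] = of_bool (\<exists>b<l. (k, b) \<in> inn) \<and>
        M' aMark [1, k] = of_bool (\<exists>b<l. (b, k) \<in> inn)"], goal_cases)
    case (7 l M2)
    from 7(3) have fr2: "M2 a = M a" if "a \<notin> {vi, vj, aMark}" for a
      using that fr by (simp add: store_def)
    have "M2 vi [] = k" using 7(3)[of vi] \<open>M1 vi [] = k\<close> by simp
    moreover have "M2 aFI [d, k, l] = of_bool ((k, l) \<in> inn)" "M2 aFI [d, l, k] = of_bool ((l, k) \<in> inn)"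
      using assms(1) fr2[of aFI] 7(1) \<open>k < N\<close> by (simp_all add: repF_def)
    moreover have "M2 aDepth [] = d" using fr2[of aDepth] assms(2) by simp
    moreover have "(\<exists>b<Suc l. (k, b) \<in> inn) \<longleftrightarrow> (\<exists>b<l. (k, b) \<in> inn) \<or> (k, l) \<in> inn"
      "(\<exists>b<Suc l. (b, k) \<in> inn) \<longleftrightarrow> (\<exists>b<l. (b, k) \<in> inn) \<or> (l, k) \<in> inn" by (auto simp: less_Suc_eq)
    ultimately show ?case
      using 7(2,4) by (intro silent_Seq silent_If silent_Assign silent_Skip) simp_all
  next
    case (8 M2)
    then show ?case using 7(4) by (simp add: less_Suc_eq)
  qed (use assms fr 7(2) in auto)
qed (use assms in auto)

text \<open>As \<open>inn\<close> has at most one vertex in each line, a vertex of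
  \<open>inn\<close> has no competitor in \<open>inn\<close>. Hence a vertex of \<open>D\<close>
  belongs to \<open>same_lines\<close> iff it is outside \<open>inn\<close> and one of its lines is
  marked.\<close>

lemma load:
  assumes "repF M d D inn out" "M aDepth [] = d" "M aN [] = N"
    and marks: "\<forall>a<N. M aMark [0, a] = of_bool (\<exists>b<N. (a, b) \<in> inn) \<and>
      M aMark [1, a] = of_bool (\<exists>b<N. (b, a) \<in> inn)"
    and inn: "inn \<subseteq> V" "inj_on fst inn" "inj_on snd inn"
  shows "silent N load M (\<lambda>M'. repG M' D \<and> repX M' (out \<union> same_lines D inn))"
proof -
  let ?out = "out \<union> same_lines D inn"
  have same: "(x, y) \<in> ?out \<longleftrightarrow>
      (x, y) \<in> out \<or> (x, y) \<in> D \<and> (x, y) \<notin> inn \<and> ((\<exists>b<N. (x, b) \<in> inn) \<or> (\<exists>a<N. (a, y) \<in> inn))" for x y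
  proof -
    have 1: "y' = y" if "(x, y) \<in> inn" "(x, y') \<in> inn" for y'
      using inj_onD[OF inn(2), of "(x, y)" "(x, y')"] that by simp
    have 2: "x' = x" if "(x, y) \<in> inn" "(x', y) \<in> inn" for x'
      using inj_onD[OF inn(3), of "(x, y)" "(x', y)"] that by simp
    have 3: "a < N \<and> b < N" if "(a, b) \<in> inn" for a b using that inn(1) vertices_N by blast
    have "(x, y) \<in> same_lines D inn \<longleftrightarrow>
        (x, y) \<in> D \<and> ((\<exists>b. b \<noteq> y \<and> (x, b) \<in> inn) \<or> (\<exists>a. a \<noteq> x \<and> (a, y) \<in> inn))"
      by (simp add: same_lines_def Bex_def split_paired_Ex) metis
    moreover have "(\<exists>b. b \<noteq> y \<and> (x, b) \<in> inn) \<or> (\<exists>a. a \<noteq> x \<and> (a, y) \<in> inn) \<longleftrightarrow>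
        (x, y) \<notin> inn \<and> ((\<exists>b<N. (x, b) \<in> inn) \<or> (\<exists>a<N. (a, y) \<in> inn))"
    proof (cases "(x, y) \<in> inn")
      case True
      have "\<not> (\<exists>b. b \<noteq> y \<and> (x, b) \<in> inn)" using 1[OF True] by blast
      moreover have "\<not> (\<exists>a. a \<noteq> x \<and> (a, y) \<in> inn)" using 2[OF True] by blast
      ultimately show ?thesis using True by simp
    next
      case False
      have "(\<exists>b. b \<noteq> y \<and> (x, b) \<in> inn) \<longleftrightarrow> (\<exists>b<N. (x, b) \<in> inn)"
        "(\<exists>a. a \<noteq> x \<and> (a, y) \<in> inn) \<longleftrightarrow> (\<exists>a<N. (a, y) \<in> inn)"
        using False 3 by metis+
      then show ?thesis using False by simp
    qed
    ultimately show ?thesis by simp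
  qed
  show ?thesis unfolding load_def
  proof (rule silent_For2[where n = N and J = "\<lambda>_. True" and
      R = "\<lambda>x y M'. M' aG [0, x, y] = of_bool ((x, y) \<in> D) \<and> M' aG [1, y, x] = of_bool ((x, y) \<in> D) \<and>
         M' aX [0, x, y] = of_bool ((x, y) \<in> ?out) \<and> M' aX [1, y, x] = of_bool ((x, y) \<in> ?out)"], goal_cases)
    case (14 x y M1)
    from 14(5) have fr: "M1 a = M a" if "a \<notin> {vi, vj, aG, aX}" for a using that by simp
    have "bval M1 (Or (pos (cur aFO)) (And (And (pos (cur aFD)) (Not (pos (cur aFI))))
        (Or (pos (Read aMark [Const 0, rd vi])) (pos (Read aMark [Const 1, rd vj]))))) \<longleftrightarrow> (x, y) \<in> ?out"
      unfolding same using fr assms 14(1-4) marks by (simp add: repF_def)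
    moreover have "M1 aFD [d, x, y] = of_bool ((x, y) \<in> D)"
      using fr assms 14(1-2) by (simp add: repF_def)
    ultimately show ?case
      using fr assms(2) 14(3,4)
      by (intro silent_Seq silent_Assign silent_If) (auto simp del: Un_iff)
  next
    case (15 M')
    then show ?case by (auto simp: repG_def repX_def vtx_def less_2)
  qed (use assms in auto)
qed

definition cands :: "(nat \<times> nat) set \<Rightarrow> nat list" where
  "cands D = filter (\<lambda>a. \<exists>b<N. (a, b) \<in> D \<and> (a, b) \<notin> heads W D) [0..<N]"

definition inspected :: "memory \<Rightarrow> (nat \<times> nat) set \<Rightarrow> (nat \<times> nat) set \<Rightarrow> bool" where
  "inspected M D inn \<longleftrightarrow> (\<forall>a<N. scanned D 0 a N (M aH [a])) \<and> M vrows [] = card (fst ` D) \<and>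
     M vbad [] = of_bool (\<not> inn \<subseteq> D) \<and>
     M vcnt [] = length (cands D) \<and> (\<forall>v<length (cands D). M aCand [v] = cands D ! v)"

lemma inspect_row:
  assumes "repG M D" "M aN [] = N" "M vi [] = i" "i < N" "M vh [] = h" "M vb [] = 0" "M vx [] = 0"
    and "\<forall>b<N. M aFI [M aDepth [], i, b] = of_bool ((i, b) \<in> inn)"
  shows "silent N inspect_row M (\<lambda>M'. M' vb [] = of_bool (\<exists>b<N. (i, b) \<in> D \<and> Suc b \<noteq> h) \<and>
    M' vx [] = of_bool (\<exists>b<N. (i, b) \<in> inn \<and> (i, b) \<notin> D) \<and> (\<forall>a. a \<notin> {vj, vb, vx} \<longrightarrow> M' a = M a))"
  unfolding inspect_row_def
proof (rule silent_For[where n = N and I = "\<lambda>k M'. M' vb [] = of_bool (\<exists>b<k. (i, b) \<in> D \<and> Suc b \<noteq> h) \<and>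
    M' vx [] = of_bool (\<exists>b<k. (i, b) \<in> inn \<and> (i, b) \<notin> D)"], goal_cases)
  case (7 k M1)
  from 7(3) have fr: "M1 a = M a" if "a \<notin> {vj, vb, vx}" for a using that by simp
  have "M1 aG [0, i, k] = of_bool ((i, k) \<in> D)"
    using fr assms(1,4) 7(1) by (simp add: repG_def vtx_def)
  moreover have "M1 aFI [M1 aDepth [], i, k] = of_bool ((i, k) \<in> inn)"
    using fr[of aFI] fr[of aDepth] assms(8) 7(1) by simp
  moreover have "M1 vi [] = i" "M1 vh [] = h" using fr[of vi] fr[of vh] assms(3,5) by simp_all
  moreover have "(\<exists>b<Suc k. (i, b) \<in> D \<and> Suc b \<noteq> h) \<longleftrightarrow>
      (\<exists>b<k. (i, b) \<in> D \<and> Suc b \<noteq> h) \<or> (i, k) \<in> D \<and> Suc k \<noteq> h"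
    "(\<exists>b<Suc k. (i, b) \<in> inn \<and> (i, b) \<notin> D) \<longleftrightarrow>
      (\<exists>b<k. (i, b) \<in> inn \<and> (i, b) \<notin> D) \<or> (i, k) \<in> inn \<and> (i, k) \<notin> D"
    by (auto simp: less_Suc_eq)
  ultimately show ?case
    using 7(2,4) by (intro silent_If silent_Assign silent_Skip) (simp_all, linarith?)
qed (use assms in auto)

lemma inspect:
  assumes "repG M D" "repP M" "D \<subseteq> V" "inn \<subseteq> V"
    and inn: "\<forall>a<N. \<forall>b<N. M aFI [M aDepth [], a, b] = of_bool ((a, b) \<in> inn)"
  shows "silent N inspect M (\<lambda>M'. inspected M' D inn)"
proof -
  let ?row = "\<lambda>a. \<exists>b<N. (a, b) \<in> D"
  let ?bad = "\<lambda>a. \<exists>b<N. (a, b) \<in> inn \<and> (a, b) \<notin> D"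
  let ?cand = "\<lambda>a. \<exists>b<N. (a, b) \<in> D \<and> (a, b) \<notin> heads W D"
  let ?I = "\<lambda>k M'. (\<forall>a<k. scanned D 0 a N (M' aH [a])) \<and> M' vrows [] = length (filter ?row [0..<k]) \<and>
    M' vbad [] = of_bool (\<exists>a<k. ?bad a) \<and> M' vcnt [] = length (filter ?cand [0..<k]) \<and>
    (\<forall>v<length (filter ?cand [0..<k]). M' aCand [v] = filter ?cand [0..<k] ! v)"
  have arc0: "arc 0 = W" by (simp add: arc_def)
  show ?thesis unfolding inspect_def
  proof (rule silent_Seq, rule silent_Assign, rule silent_Seq, rule silent_Assign, rule silent_Seq, rule silent_Assign,
      rule silent_For[where n = N and I = ?I], goal_cases)
    case (7 k M1)
    let ?A = "{vi, vj, vk, vcnt, vrows, vbad, vs, vl, vh, vb, vx, aH, aCand}"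
    from 7(3) have fr: "M1 a = M a" if "a \<notin> ?A" for a
      using that by (simp add: scan_def examine_row_def inspect_row_def record_row_def store_def)
    define M2 where "M2 = store (store M1 vs [] 0) vl [] k"
    define Q where "Q M'' \<longleftrightarrow> ?I (Suc k) (store M'' vi [] (Suc k))" for M''
    have scan2: "silent N scan M2 (\<lambda>M'. scanned D 0 k N (M' vh []) \<and> (\<forall>a. a \<notin> {vk, vh} \<longrightarrow> M' a = M2 a))"
    proof (rule scan)
      have "repG M1 D" "repP M1"
        using assms(1,2) fr[of aG] fr[of aN] fr[of aP] rep_cong(1)[of M1 M D] rep_cong(3)[of M1 M] by simp_all
      then show "repG M2 D" "repP M2" by (simp_all add: M2_def)
    qed (use assms(3) 7(1) in \<open>auto simp: M2_def\<close>)
    have rest: "silent N examine_row M3 Q"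
      if M3: "scanned D 0 k N (M3 vh [])" "\<And>a. a \<notin> {vk, vh} \<Longrightarrow> M3 a = M2 a" for M3
    proof -
      let ?h = "M3 vh []"
      define M4 where "M4 = store (store (store M3 aH [k] ?h) vb [] 0) vx [] 0"
      have fr4: "M4 a = M a" if "a \<notin> ?A" for a using that M3(2) fr by (simp add: M4_def M2_def store_def)
      have hd: "(\<exists>b<N. (k, b) \<in> D \<and> Suc b \<noteq> ?h) \<longleftrightarrow> ?cand k" "?h > 0 \<longleftrightarrow> ?row k"
      proof -
        note sc = scanned_N[OF M3(1) assms(3)]
        have "(k, b) \<in> heads W D \<longleftrightarrow> Suc b = ?h" if b: "(k, b) \<in> D" for b
        proof -
          have h: "?h > 0" using sc(1)[of b] b by (auto simp: vtx_def)
          then have hh: "(k, ?h - 1) \<in> heads W D" using sc(2) by (simp add: vtx_def arc0)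
          then have "(k, b) \<in> heads W D \<longleftrightarrow> b = ?h - 1"
            using head_unique[of 0 D "(k, b)" "(k, ?h - 1)"] assms(3) by (auto simp: arc0 line_of_def)
          then show ?thesis using h by auto
        qed
        then show "(\<exists>b<N. (k, b) \<in> D \<and> Suc b \<noteq> ?h) \<longleftrightarrow> ?cand k" by blast
        show "?h > 0 \<longleftrightarrow> ?row k"
          using sc heads_subset[of W D] by (auto simp: vtx_def arc0 dest: subsetD)
      qed
      have row: "silent N inspect_row M4 (\<lambda>M'. M' vb [] = of_bool (\<exists>b<N. (k, b) \<in> D \<and> Suc b \<noteq> ?h) \<and>
          M' vx [] = of_bool (?bad k) \<and> (\<forall>a. a \<notin> {vj, vb, vx} \<longrightarrow> M' a = M4 a))"
      proof (rule inspect_row)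
        show "repG M4 D" using assms(1) rep_cong(1)[of M4 M D] fr4[of aG] by simp
        show "M4 aN [] = N" using fr4[of aN] assms(2) by (simp add: repP_def)
        show "M4 vi [] = k" using M3(2) 7(2) by (simp add: M4_def M2_def)
        show "\<forall>b<N. M4 aFI [M4 aDepth [], k, b] = of_bool ((k, b) \<in> inn)"
          using inn 7(1) fr4[of aFI] fr4[of aDepth] by simp
      qed (use 7(1) in \<open>auto simp: M4_def\<close>)
      have recorded: "silent N record_row M5 Q"
        if M5: "M5 vb [] = of_bool (?cand k)" "M5 vx [] = of_bool (?bad k)"
          "\<And>a. a \<notin> {vj, vb, vx} \<Longrightarrow> M5 a = M4 a" for M5
      proof -
        have "M5 vi [] = k" using M5(3) M3(2) 7(2) by (simp add: M4_def M2_def)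
        moreover have "M5 vh [] = ?h" "M5 aH [k] = ?h" using M5(3) by (simp_all add: M4_def)
        moreover have "M5 aH [a] = M1 aH [a]" if "a < k" for a using that M5(3) M3(2) by (simp add: M4_def M2_def)
        moreover have "M5 vrows [] = M1 vrows []" "M5 vcnt [] = M1 vcnt []" "M5 vbad [] = M1 vbad []" "M5 aCand = M1 aCand"
          using M5(3) M3(2) by (simp_all add: M4_def M2_def store_def)
        moreover have "(\<exists>a<Suc k. ?bad a) \<longleftrightarrow> (\<exists>a<k. ?bad a) \<or> ?bad k" by (auto simp: less_Suc_eq)
        ultimately show ?thesis
          unfolding record_row_def Q_def using M5(1,2) 7(4) M3(1) hd(2)
          by (intro silent_Seq silent_If silent_Assign silent_Skip)
            (auto simp: less_Suc_eq nth_append simp del: length_filter_conv_card)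
      qed
      have "silent N (Seq inspect_row record_row) M4 Q"
        by (rule silent_Seq, rule silent_mono[OF row]) (use recorded hd(1) in simp)
      moreover have "M3 vi [] = k" using M3(2) 7(2) by (simp add: M2_def)
      ultimately show ?thesis
        unfolding examine_row_def by (intro silent_Seq[OF silent_Assign]) (simp add: M4_def)
    qed
    have "silent N (Seq scan examine_row) M2 Q"
      by (rule silent_Seq, rule silent_mono[OF scan2]) (use rest in blast)
    then show ?case
      unfolding Q_def[symmetric] using 7(2)
      by (intro silent_Seq[OF silent_Assign]) (simp add: M2_def)
  next
    case (8 M')
    have D: "a < N \<and> b < N" if "(a, b) \<in> D" for a b using that assms(3) vertices_N by blast
    have inn: "a < N \<and> b < N" if "(a, b) \<in> inn" for a b using that assms(4) vertices_N by blast
    have "length (filter ?row [0..<N]) = card (set (filter ?row [0..<N]))"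
      by (rule distinct_card[symmetric]) simp
    also have "set (filter ?row [0..<N]) = fst ` D" using D by force
    finally have "length (filter ?row [0..<N]) = card (fst ` D)" .
    moreover have "(\<exists>a<N. ?bad a) \<longleftrightarrow> \<not> inn \<subseteq> D" by (metis inn subrelI subsetD)
    ultimately show ?case using 8(1) by (simp add: inspected_def cands_def)
  qed (use assms(2) in \<open>auto simp: scan_def examine_row_def inspect_row_def record_row_def repP_def\<close>)
qed

end

section \<open>Writing a matching, branching, and the arguments of calls\<close>

context numbered
begin

lemma head_value:
  assumes "scanned D 0 a N h" "D \<subseteq> V"
  shows "h = (if \<exists>f. (a, f) \<in> heads W D then Suc (THE f. (a, f) \<in> heads W D) else 0)"
proof (cases "h = 0")
  case True
  then show ?thesis using scanned_N(1)[OF assms] heads_subset[of W D] by (auto simp: vtx_def)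
next
  case False
  then have h: "(a, h - 1) \<in> heads W D" using scanned_N(2)[OF assms] by (simp add: vtx_def arc_def)
  moreover have "f = h - 1" if "(a, f) \<in> heads W D" for f
    using head_unique[of 0 D "(a, f)" "(a, h - 1)"] that h assms(2) by (simp add: arc_def line_of_def)
  ultimately have "(THE f. (a, f) \<in> heads W D) = h - 1" by (rule the_equality)
  then show ?thesis using False h by auto
qed

lemma emit_matching:
  assumes "inspected M D inn" "D \<subseteq> V" "M 0 [] = m"
  shows "emits N emit_matching M tp (\<lambda>M' tp'. tp' = tp @ encode_event m n (Output (heads W D)))"
  unfolding emit_matching_def
proof (rule emits_Seq, rule emits_Emit, rule emits_For[where n = m and
    I = "\<lambda>k M' tp'. tp' = tp @ 1 # map (\<lambda>w. if \<exists>f. (w, f) \<in> heads W D then Suc (THE f. (w, f) \<in> heads W D) else 0) [0..<k]"],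
    goal_cases)
  case (7 k M1 tp1)
  have "k < N" using 7(1) mn_N by simp
  then have "scanned D 0 k N (M aH [k])" using assms(1) by (simp add: inspected_def)
  note head_value[OF this assms(2)]
  moreover have "M1 aH [k] = M aH [k]" using 7(3)[of aH] by simp
  ultimately show ?case using 7(2,4) by (intro emits_Emit) simp
qed (use assms mn_N in auto)

text \<open>Frames below the current depth hold the pending second subcalls, so a call has to leave
  them intact.\<close>

definition lower :: "nat \<Rightarrow> memory \<Rightarrow> memory \<Rightarrow> bool" where
  "lower d M M' \<longleftrightarrow> (\<forall>a\<in>{aFD, aFI, aFO}. \<forall>d'<d. \<forall>x y. M' a [d', x, y] = M a [d', x, y])"

lemma lower_trans: "lower d M M' \<Longrightarrow> lower d M' M'' \<Longrightarrow> lower d M M''"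
  by (simp add: lower_def)

lemma lower_mono: "lower d M M' \<Longrightarrow> d' \<le> d \<Longrightarrow> lower d' M M'"
  by (simp add: lower_def)

lemma lower_refl: "(\<And>a. a \<in> {aFD, aFI, aFO} \<Longrightarrow> M' a = M a) \<Longrightarrow> lower d M M'"
  by (simp add: lower_def)

lemma repF_lower: "repF M d D inn out \<Longrightarrow> lower d' M M' \<Longrightarrow> d < d' \<Longrightarrow> repF M' d D inn out"
  by (simp add: lower_def repF_def)

lemma copy:
  assumes "repG M D'" "repX M out'" "repF M d D inn out" "M aDepth [] = d" "M aN [] = N"
  shows "silent N copy M (\<lambda>M'. repF M' d D' inn out' \<and> repF M' (Suc d) D' inn out' \<and> lower d M M')"
  unfolding copy_def
\<comment> \<open>The conjunct on \<open>aFI\<close> is needed because the loop reads frame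
  \<open>d\<close> of the array while writing its frame \<open>Suc d\<close>.\<close>
proof (rule silent_For2[where n = N and J = "\<lambda>M'. lower d M M' \<and> (\<forall>x y. M' aFI [d, x, y] = M aFI [d, x, y])" and
    R = "\<lambda>x y M'. M' aFD [d, x, y] = of_bool ((x, y) \<in> D') \<and> M' aFD [Suc d, x, y] = of_bool ((x, y) \<in> D') \<and>
      M' aFI [Suc d, x, y] = of_bool ((x, y) \<in> inn) \<and>
      M' aFO [d, x, y] = of_bool ((x, y) \<in> out') \<and> M' aFO [Suc d, x, y] = of_bool ((x, y) \<in> out')"], goal_cases)
  case (14 x y M1)
  from 14(5) have fr: "M1 a = M a" if "a \<notin> {vi, vj, aFD, aFI, aFO}" for a using that by simp
  have "M1 aG [0, x, y] = of_bool ((x, y) \<in> D')" "M1 aX [0, x, y] = of_bool ((x, y) \<in> out')"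
    using fr[of aG] fr[of aX] assms(1,2) 14(1,2) by (simp_all add: repG_def repX_def vtx_def)
  moreover have "M1 aFI [d, x, y] = of_bool ((x, y) \<in> inn)"
    using 14 assms(3) by (simp add: repF_def)
  moreover have "M1 aDepth [] = d" using fr[of aDepth] assms(4) by simp
  ultimately show ?case
    using 14(3,4,6) by (intro silent_Seq silent_Assign) (auto simp: lower_def)
next
  case (15 M')
  then show ?case using assms(3) by (auto simp: repF_def)
qed (use assms in \<open>auto simp: lower_def\<close>)

lemma branch:
  assumes "repG M D'" "repX M out'" "repF M d D inn out" "M aDepth [] = d" "M aN [] = N" "inspected M D' inn'"
    and "D' \<subseteq> V" "M vt [] < length (cands D')" "x \<in> heads W D'" "fst x = cands D' ! (M vt [])"
  shows "silent N branch M (\<lambda>M'. M' aDepth [] = Suc d \<and> repF M' d D' inn (insert x out') \<and>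
    repF M' (Suc d) D' (insert x inn) out' \<and> lower d M M')"
proof -
  obtain a b where x: "x = (a, b)" by fastforce
  have "(a, b) \<in> V" using assms(7,9) heads_subset[of W D'] x by auto
  then have ab: "a < N" "b < N" using vertices_N by auto
  have a: "M aCand [M vt []] = a" using assms(6,8,10) x by (simp add: inspected_def)
  have "scanned D' 0 a N (M aH [a])" using assms(6) ab by (simp add: inspected_def)
  note hv = head_value[OF this assms(7)]
  have "\<exists>f. (a, f) \<in> heads W D'" using assms(9) x by blast
  then have "M aH [a] = Suc (THE f. (a, f) \<in> heads W D')" using hv by (simp only: if_True)
  moreover have "(THE f. (a, f) \<in> heads W D') = b"
  proof (rule the_equality)
    show "(a, b) \<in> heads W D'" using assms(9) x by simp
    show "f = b" if "(a, f) \<in> heads W D'" for f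
      using head_unique[of 0 D' "(a, f)" "(a, b)"] that assms(7,9) x by (simp add: arc_def line_of_def)
  qed
  ultimately have b: "M aH [a] - 1 = b" by simp
  define M1 where "M1 = store (store M vx [] a) vy [] b"
  have "silent N copy M1 (\<lambda>M'. repF M' d D' inn out' \<and> repF M' (Suc d) D' inn out' \<and> lower d M1 M')"
    using assms(1-5) by (intro copy[where D = D and out = out]) (auto simp: M1_def repF_def)
  then have copied: "silent N copy M1 (\<lambda>M'. (repF M' d D' inn out' \<and> repF M' (Suc d) D' inn out' \<and> lower d M1 M') \<and>
      (\<forall>a. a \<notin> assigned copy \<longrightarrow> M' a = M1 a))"
    by (rule silent_frame)
  have rest: "silent N add_choice M2
     (\<lambda>M'. M' aDepth [] = Suc d \<and> repF M' d D' inn (insert x out') \<and>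
       repF M' (Suc d) D' (insert x inn) out' \<and> lower d M M')"
    if M2: "repF M2 d D' inn out'" "repF M2 (Suc d) D' inn out'" "lower d M1 M2" "\<And>a. a \<notin> assigned copy \<Longrightarrow> M2 a = M1 a" for M2
  proof -
    have "M2 vx [] = a" "M2 vy [] = b" "M2 aDepth [] = d"
      using M2(4)[of vx] M2(4)[of vy] M2(4)[of aDepth] assms(4) by (auto simp: M1_def copy_def)
    then show ?thesis using M2(1-3) x
      unfolding add_choice_def
      by (intro silent_Seq silent_Assign) (auto simp: repF_def lower_def M1_def)
  qed
  have "silent N (Seq copy add_choice) M1
     (\<lambda>M'. M' aDepth [] = Suc d \<and> repF M' d D' inn (insert x out') \<and>
       repF M' (Suc d) D' (insert x inn) out' \<and> lower d M M')"
    by (rule silent_Seq, rule silent_mono[OF copied]) (use rest in simp)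
  then show ?thesis unfolding branch_def
    using a b by (intro silent_Seq[OF silent_Assign]) (simp add: M1_def)
qed

definition static :: "memory \<Rightarrow> bool" where
  "static M \<longleftrightarrow> repP M \<and> M 0 [] = m \<and> M 1 [] = n \<and> M aRows [] = card (fst ` nf)"

definition call_state :: "memory \<Rightarrow> nat \<Rightarrow> (nat \<times> nat) set \<Rightarrow> (nat \<times> nat) set \<Rightarrow> (nat \<times> nat) set \<Rightarrow> bool" where
  "call_state M d D inn out \<longleftrightarrow> static M \<and> M aDepth [] = d \<and> repF M d D inn out"

text \<open>With the rows of \<open>nf\<close> preserved, the number \<open>r\<close> computed once
  at the start is the row count of every digraph passed to a call.\<close>

definition call_args :: "(nat \<times> nat) set \<Rightarrow> (nat \<times> nat) set \<Rightarrow> bool" where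
  "call_args D inn \<longleftrightarrow> D \<subseteq> V \<and> normal W F D \<and> fst ` D = fst ` nf \<and>
     inn \<subseteq> V \<and> inj_on fst inn \<and> inj_on snd inn"

text \<open>The share of a call that does not depend on deletions. Of the 20, one 10 is the constant
  of \<open>prune_com\<close>; the other covers the guard of the main loop.\<close>

definition body_cost :: nat where
  "body_cost = loop_cost N log_call + loop_cost N marks + loop_cost N load + loop_cost N push_all +
     loop_cost N inspect + loop_cost N decide + 20 + (10 + loop_cost N process_line) * (2 * N)"

definition delete_cost :: nat where
  "delete_cost = 2 * (10 + loop_cost N process_line)"

lemmas prog_defs = log_call_def marks_def load_def prune_com_def push_all_def push_def process_line_def
  sweep_def scan_def inspect_def examine_row_def inspect_row_def record_row_def

lemma static_cong:
  "(\<And>a. a \<in> {0, 1, aN, aP, aRows} \<Longrightarrow> M' a = M a) \<Longrightarrow> static M' \<longleftrightarrow> static M"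
  by (simp add: static_def repP_def)

lemma prelude:
  assumes "call_state (mem c) d D inn out" "call_args D inn"
  shows "\<exists>c' D'. exec prelude c c' \<and> choices c' = choices c \<and>
    map snd (tape c') = map snd (tape c) @ encode_event m n (Call D inn out) \<and>
    final D (out \<union> same_lines D inn) D' \<and> repG (mem c') D' \<and> repX (mem c') (out \<union> same_lines D inn) \<and>
    inspected (mem c') D' inn \<and> (\<forall>a\<in>{0, 1, aN, aP, aRows, aDepth, aFD, aFI, aFO}. mem c' a = mem c a) \<and>
    clock c' + loop_cost N decide + 10 \<le> clock c + body_cost + delete_cost * (card D - card D')"
proof -
  let ?out = "out \<union> same_lines D inn"
  note st = assms(1)[unfolded call_state_def static_def]
  have D: "D \<subseteq> V" "normal W F D" and inn: "inn \<subseteq> V" "inj_on fst inn" "inj_on snd inn"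
    using assms(2) by (auto simp: call_args_def)
  have N: "mem c aN [] = N" using st by (simp add: repP_def)
  have "emits N log_call (mem c) (map snd (tape c))
      (\<lambda>M' tp'. tp' = map snd (tape c) @ encode_event m n (Call D inn out))"
    using st by (intro log_call) auto
  then obtain c1 where c1: "exec log_call c c1" "clock c1 \<le> clock c + loop_cost N log_call" "choices c1 = choices c"
    "map snd (tape c1) = map snd (tape c) @ encode_event m n (Call D inn out)" by (rule emitsE)
  have fr1: "mem c1 a = mem c a" if "a \<notin> assigned log_call" for a using exec_frame[OF c1(1) that] .
  have fr1': "mem c1 a = mem c a" if "a \<in> {0, 1, aN, aP, aRows, aDepth, aFD, aFI, aFO}" for a
    using fr1[of a] that by (auto simp: log_call_def)
  have "silent N marks (mem c1) (\<lambda>M'. \<forall>a<N. M' aMark [0, a] = of_bool (\<exists>b<N. (a, b) \<in> inn) \<and>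
      M' aMark [1, a] = of_bool (\<exists>b<N. (b, a) \<in> inn))"
    using st N fr1' by (intro marks[where D = D and out = out and d = d]) (simp_all add: repF_def)
  then obtain c2 where c2: "exec marks c1 c2" "clock c2 \<le> clock c1 + loop_cost N marks" "choices c2 = choices c1"
    "tape c2 = tape c1" "\<forall>a<N. mem c2 aMark [0, a] = of_bool (\<exists>b<N. (a, b) \<in> inn) \<and>
      mem c2 aMark [1, a] = of_bool (\<exists>b<N. (b, a) \<in> inn)" by (rule silentE)
  have fr2': "mem c2 a = mem c a" if "a \<in> {0, 1, aN, aP, aRows, aDepth, aFD, aFI, aFO}" for a
    using exec_frame[OF c2(1), of a] fr1'[OF that] that by (auto simp: marks_def)
  have "silent N load (mem c2) (\<lambda>M'. repG M' D \<and> repX M' ?out)"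
    using st N fr2' inn c2(5) by (intro load[where d = d]) (simp_all add: repF_def)
  then obtain c3 where c3: "exec load c2 c3" "clock c3 \<le> clock c2 + loop_cost N load" "choices c3 = choices c2"
    "tape c3 = tape c2" "repG (mem c3) D \<and> repX (mem c3) ?out" by (rule silentE)
  have fr3': "mem c3 a = mem c a" if "a \<in> {0, 1, aN, aP, aRows, aDepth, aFD, aFI, aFO}" for a
    using exec_frame[OF c3(1), of a] fr2'[OF that] that by (auto simp: load_def)
  have "repP (mem c3)" using st fr3' by (simp add: repP_def)
  from prune_com[OF _ _ this D(1)] c3(5)
  obtain c4 D' where c4: "exec prune_com c3 c4" "choices c4 = choices c3" "tape c4 = tape c3"
    "repG (mem c4) D'" "final D ?out D'"
    "clock c4 \<le> clock c3 + loop_cost N push_all + 10 + (10 + loop_cost N process_line) * (2 * N + 2 * (card D - card D'))"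
    by blast
  have fr4': "mem c4 a = mem c a" if "a \<in> {0, 1, aN, aP, aRows, aDepth, aFD, aFI, aFO}" for a
    using exec_frame[OF c4(1), of a] fr3'[OF that] that by (auto simp: prog_defs)
  have X4: "repX (mem c4) ?out"
    using exec_frame[OF c4(1), of aX] c3(5) by (simp add: repX_def prog_defs)
  have D'V: "D' \<subseteq> V" using final_subset[OF c4(5)] D by blast
  have "repP (mem c4)" using st fr4' by (simp add: repP_def)
  moreover have "\<forall>a<N. \<forall>b<N. mem c4 aFI [mem c4 aDepth [], a, b] = of_bool ((a, b) \<in> inn)"
    using st fr4' by (simp add: repF_def)
  ultimately have "silent N inspect (mem c4) (\<lambda>M'. inspected M' D' inn)"
    using c4(4) D'V inn(1) by (intro inspect)
  then obtain c5 where c5: "exec inspect c4 c5" "clock c5 \<le> clock c4 + loop_cost N inspect" "choices c5 = choices c4"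
    "tape c5 = tape c4" "inspected (mem c5) D' inn" by (rule silentE)
  have fr5': "mem c5 a = mem c a" if "a \<in> {0, 1, aN, aP, aRows, aDepth, aFD, aFI, aFO}" for a
    using exec_frame[OF c5(1), of a] fr4'[OF that] that by (auto simp: prog_defs)
  have "repX (mem c5) ?out" "repG (mem c5) D'"
    using exec_frame[OF c5(1), of aX] exec_frame[OF c5(1), of aG] X4 c4(4)
    by (simp_all add: repX_def repG_def prog_defs)
  moreover have "exec prelude c c5"
    unfolding prelude_def
    by (rule exec.Seq[OF c1(1) exec.Seq[OF c2(1) exec.Seq[OF c3(1) exec.Seq[OF c4(1) c5(1)]]]])
  moreover have "clock c5 + loop_cost N decide + 10 \<le> clock c + body_cost + delete_cost * (card D - card D')"
  proof -
    have "(10 + loop_cost N process_line) * (2 * N + 2 * (card D - card D')) =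
        (10 + loop_cost N process_line) * (2 * N) + delete_cost * (card D - card D')"
    proof -
      have "(10 + x) * (2 * N + 2 * k) = (10 + x) * (2 * N) + 2 * (10 + x) * k" for x k :: nat
        by (simp add: algebra_simps)
      then show ?thesis unfolding delete_cost_def .
    qed
    then show ?thesis using c1(2) c2(2) c3(2) c4(6) c5(2) unfolding body_cost_def by linarith
  qed
  ultimately show ?thesis
    using c1(3,4) c2(3,4) c3(3,4) c4(2,3,5) c5(3,4,5) fr5'
    by (intro exI[of _ c5] exI[of _ D'] conjI ballI) simp_all
qed

end

section \<open>The recursion tree\<close>

fun spaced :: "nat \<Rightarrow> nat \<Rightarrow> nat list \<Rightarrow> bool" where
  "spaced K L [] \<longleftrightarrow> True"
| "spaced K L (t # ts) \<longleftrightarrow> t \<le> L + K \<and> spaced K t ts"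

lemma spaced_append: "spaced K L (ts @ us) \<longleftrightarrow> spaced K L ts \<and> spaced K (last (L # ts)) us"
  by (induction K L ts rule: spaced.induct) auto

lemma spaced_last: "spaced K L ts \<Longrightarrow> last (L # ts) \<le> L + length ts * K"
proof (induction K L ts rule: spaced.induct)
  case (2 K L t ts)
  then show ?case by simp
qed simp

lemma spaced_nth: "spaced K L ts \<Longrightarrow> Suc k < length ts \<Longrightarrow> ts ! Suc k \<le> ts ! k + K"
proof (induction K L ts arbitrary: k rule: spaced.induct)
  case (2 K L t ts)
  then show ?case by (cases k; cases ts) auto
qed simp

lemma output_times_append:
  "length tp1 = length (concat (map (encode_event m n) evs1)) \<Longrightarrow>
     output_times m n (evs1 @ evs2) (tp1 @ tp2) = output_times m n evs1 tp1 @ output_times m n evs2 tp2"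
proof (induction m n evs1 tp1 rule: output_times.induct)
  case (3 m n M evs tp)
  have len: "length (encode_event m n (Output M)) \<le> length tp" "0 < length (encode_event m n (Output M))"
    using 3(2) by simp_all
  then have "(tp @ tp2) ! (length (encode_event m n (Output M)) - 1) = tp ! (length (encode_event m n (Output M)) - 1)"
    by (simp add: nth_append)
  moreover have "output_times m n (evs @ evs2) (drop (length (encode_event m n (Output M))) tp @ tp2) =
      output_times m n evs (drop (length (encode_event m n (Output M))) tp) @ output_times m n evs2 tp2"
    using 3 by (intro 3(1)) simp
  ultimately show ?case using len by (simp del: encode_event.simps)
next
  case (2 m n D inn out evs tp)
  have len: "length (encode_event m n (Call D inn out)) \<le> length tp"
    using 2(2) by simp
  have "output_times m n (evs @ evs2) (drop (length (encode_event m n (Call D inn out))) tp @ tp2) =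
      output_times m n evs (drop (length (encode_event m n (Call D inn out))) tp) @ output_times m n evs2 tp2"
    using 2 by (intro 2(1)) simp
  then show ?case using len by (simp del: encode_event.simps)
qed auto

definition step :: "config \<Rightarrow> config \<Rightarrow> bool" where
  "step c c' \<longleftrightarrow> mem c aDepth [] > 0 \<and> exec (Seq prelude decide) (tick (1 + bcost (pos (rd aDepth))) c) c'"

lemma steps_While:
  assumes "step\<^sup>*\<^sup>* c c'" "mem c' aDepth [] = 0"
  shows "exec (While (pos (rd aDepth)) (Seq prelude decide)) c (tick (1 + bcost (pos (rd aDepth))) c')"
  using assms
proof (induction rule: converse_rtranclp_induct)
  case base
  then show ?case by (intro exec.WhileFalse) simp
next
  case (step c1 c2)
  have "bval (mem c1) (pos (rd aDepth))" using step.hyps(1) by (simp add: step_def)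
  moreover have "exec (Seq prelude decide) (tick (1 + bcost (pos (rd aDepth))) c1) c2"
    using step.hyps(1) unfolding step_def by (rule conjunct2)
  ultimately show ?case using step.IH[OF step.prems] by (rule exec.WhileTrue)
qed

section \<open>One iteration of the main loop: failure, output, branching\<close>

context numbered
begin

lemma card_digraph: "D \<subseteq> V \<Longrightarrow> card D \<le> N * N"
proof -
  assume "D \<subseteq> V"
  then have "D \<subseteq> {..<N} \<times> {..<N}" using vertices_N by auto
  then have "card D \<le> card ({..<N} \<times> {..<N})" by (intro card_mono) auto
  then show ?thesis by simp
qed

lemma step_prelude:
  assumes "call_state (mem c) d D inn out" "call_args D inn" "d > 0"
  obtains c1 D' where "exec prelude (tick (1 + bcost (pos (rd aDepth))) c) c1" "choices c1 = choices c"
    "map snd (tape c1) = map snd (tape c) @ encode_event m n (Call D inn out)"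
    "final D (out \<union> same_lines D inn) D'" "repG (mem c1) D'" "repX (mem c1) (out \<union> same_lines D inn)"
    "inspected (mem c1) D' inn" "call_state (mem c1) d D inn out" "lower d (mem c) (mem c1)"
    "clock c1 + loop_cost N decide \<le> clock c + body_cost + delete_cost * (card D - card D')"
proof -
  let ?c = "tick (1 + bcost (pos (rd aDepth))) c"
  have c: "mem ?c = mem c" "choices ?c = choices c" "tape ?c = tape c" "clock ?c = clock c + 4"
    by (auto simp: tick_def)
  have "call_state (mem ?c) d D inn out" using assms(1) c by simp
  from prelude[OF this assms(2)] obtain c1 D' where c1: "exec prelude ?c c1" "choices c1 = choices c"
    "map snd (tape c1) = map snd (tape c) @ encode_event m n (Call D inn out)"
    "final D (out \<union> same_lines D inn) D'" "repG (mem c1) D'" "repX (mem c1) (out \<union> same_lines D inn)"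
    "inspected (mem c1) D' inn" "\<forall>a\<in>{0, 1, aN, aP, aRows, aDepth, aFD, aFI, aFO}. mem c1 a = mem c a"
    "clock c1 + loop_cost N decide + 10 \<le> clock c + 4 + body_cost + delete_cost * (card D - card D')"
    unfolding c by blast
  have "call_state (mem c1) d D inn out"
  proof -
    have "mem c1 a = mem c a" if "a \<in> {0, 1, aN, aP, aRows}" for a using c1(8) that by auto
    then have "static (mem c1)" using assms(1) static_cong[of "mem c1" "mem c"] by (simp add: call_state_def)
    then show ?thesis using assms(1) c1(8) by (simp add: call_state_def repF_def)
  qed
  moreover have "lower d (mem c) (mem c1)" using c1(8) by (intro lower_refl) auto
  ultimately show thesis using c1 by (intro that) auto
qed

lemma step_fail:
  assumes "call_state (mem c) d D inn out" "call_args D inn" "d > 0" "sols D inn out = {}"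
  shows "\<exists>c'. step c c' \<and> map snd (tape c') = map snd (tape c) @ encode_event m n (Call D inn out) \<and>
    mem c' aDepth [] = d - 1 \<and> clock c' \<le> clock c + body_cost + delete_cost * card D"
proof -
  obtain c1 D' where c1: "exec prelude (tick (1 + bcost (pos (rd aDepth))) c) c1"
    "map snd (tape c1) = map snd (tape c) @ encode_event m n (Call D inn out)"
    "final D (out \<union> same_lines D inn) D'"
    "inspected (mem c1) D' inn" "call_state (mem c1) d D inn out"
    "clock c1 + loop_cost N decide \<le> clock c + body_cost + delete_cost * (card D - card D')"
    using step_prelude[OF assms(1-3)] by metis
  note st = c1(5)[unfolded call_state_def static_def]
  have D: "D \<subseteq> V" "normal W F D" "fst ` D = fst ` nf" using assms(2) by (auto simp: call_args_def)
  have "card (fst ` D') \<le> card (fst ` D)"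
    using final_subset[OF c1(3)] finite_digraph[OF D(1)] by (intro card_mono) auto
  then have fail: "card (fst ` D') < card (fst ` nf) \<or> \<not> inn \<subseteq> D'"
    using final_sols(1)[OF D(1,2) c1(3)] assms(4) D(3) by auto
  have "emits N decide (mem c1) (map snd (tape c1)) (\<lambda>M' tp'. M' aDepth [] = d - 1 \<and> tp' = map snd (tape c1))"
    unfolding decide_def pop_def
    by (rule emits_If; (intro emits_Assign)?) (use st fail c1(4) in \<open>auto simp: inspected_def split: if_splits\<close>)
  then obtain c2 where "exec decide c1 c2" "clock c2 \<le> clock c1 + loop_cost N decide"
    "mem c2 aDepth [] = d - 1 \<and> map snd (tape c2) = map snd (tape c1)" by (rule emitsE)
  moreover have "delete_cost * (card D - card D') \<le> delete_cost * card D"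
    by (intro mult_left_mono) auto
  then have "clock c2 \<le> clock c + body_cost + delete_cost * card D"
    using calculation(2) c1(6) by linarith
  moreover have "mem c aDepth [] > 0" using assms(1,3) by (simp add: call_state_def)
  ultimately show ?thesis
    using c1 exec.Seq[OF c1(1)] unfolding step_def by (intro exI[of _ c2]) auto
qed

text \<open>In a normal digraph column heads are row tails, so the head of a row fails to be a
  column head exactly when its row contains a second vertex.\<close>

lemma cands_iff:
  assumes "D \<subseteq> V" "normal W F D"
  shows "x \<in> heads W D \<Longrightarrow> x \<notin> heads F D \<longleftrightarrow> fst x \<in> set (cands D)"
    and "a \<in> set (cands D) \<Longrightarrow> \<exists>x. x \<in> heads W D - heads F D \<and> fst x = a"
proof -
  have tails: "heads F D = tails W D" using normal_heads(2) assms by blast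
  have N: "a < N \<and> b < N" if "(a, b) \<in> D" for a b using that assms(1) vertices_N by blast
  have 1: "x \<notin> heads F D \<longleftrightarrow> fst x \<in> set (cands D)" if x: "x \<in> heads W D" for x
  proof -
    obtain a b where ab: "x = (a, b)" by fastforce
    have xD: "(a, b) \<in> D" using x ab heads_subset[of W D] by blast
    have "x \<notin> tails W D \<longleftrightarrow> (\<exists>y\<in>D. (y, x) \<in> W)" using xD ab by (auto simp: tails_def)
    also have "\<dots> \<longleftrightarrow> (\<exists>b'. (a, b') \<in> D \<and> (a, b') \<notin> heads W D)"
    proof
      assume "\<exists>y\<in>D. (y, x) \<in> W"
      then obtain y where y: "y \<in> D" "(y, x) \<in> W" by blast
      then have "fst y = a" using rows.R_line ab by fastforce
      moreover have "y \<notin> heads W D" using y xD ab by (auto simp: heads_def)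
      ultimately show "\<exists>b'. (a, b') \<in> D \<and> (a, b') \<notin> heads W D" using y(1) by (metis prod.collapse)
    next
      assume "\<exists>b'. (a, b') \<in> D \<and> (a, b') \<notin> heads W D"
      then obtain b' where b': "(a, b') \<in> D" "(a, b') \<notin> heads W D" by blast
      then have "((a, b'), x) \<in> W \<or> (x, (a, b')) \<in> W"
        using rows.R_total[of "(a, b')" x] xD ab assms(1) x by auto
      moreover have "(x, (a, b')) \<notin> W" using x b'(1) by (auto simp: heads_def)
      ultimately show "\<exists>y\<in>D. (y, x) \<in> W" using b'(1) by blast
    qed
    also have "\<dots> \<longleftrightarrow> a \<in> set (cands D)" using N by (auto simp: cands_def)
    finally show ?thesis using tails ab by simp
  qed
  then show "x \<in> heads W D \<Longrightarrow> x \<notin> heads F D \<longleftrightarrow> fst x \<in> set (cands D)" .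
  assume a: "a \<in> set (cands D)"
  then obtain b where "(a, b) \<in> D" by (auto simp: cands_def)
  then obtain h where "h \<in> heads W D" "fst h = a" using rows.head_ex by (metis fst_conv)
  then show "\<exists>x. x \<in> heads W D - heads F D \<and> fst x = a" using 1 a by blast
qed

lemma cands_Nil_iff:
  assumes "D \<subseteq> V" "normal W F D"
  shows "cands D = [] \<longleftrightarrow> heads W D = heads F D"
proof
  assume "heads W D = heads F D"
  then show "cands D = []" using cands_iff(2)[OF assms] by (metis Diff_cancel emptyE list.set_sel(1))
next
  assume "cands D = []"
  then have "heads W D - heads F D = {}" using cands_iff(1)[OF assms] by auto
  then show "heads W D = heads F D" using heads_W_diff_nonempty[OF assms] by blast
qed

lemma pruned_rows:
  assumes "call_args D inn" "sols D inn out \<noteq> {}" "final D (out \<union> same_lines D inn) D'"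
  shows "D' = pruned D inn out" "D' \<subseteq> D" "D' \<subseteq> V" "normal W F D'" "fst ` D' = fst ` nf" "inn \<subseteq> D'"
    and "inn \<subseteq> heads W D'" "card inn \<le> N"
proof -
  have D: "D \<subseteq> V" "normal W F D" "fst ` D = fst ` nf" using assms(1) by (auto simp: call_args_def)
  note fs = final_sols[OF D(1,2) assms(3)]
  show 1: "D' = pruned D inn out" using fs(2) assms(2) .
  note p = pruned[OF D(1,2) assms(2), folded 1]
  show D': "D' \<subseteq> D" "D' \<subseteq> V" "normal W F D'" "fst ` D' = fst ` nf" using p D by auto
  show "inn \<subseteq> D'" using fs(1) assms(2) by blast
  show "inn \<subseteq> heads W D'" using p(4) by (simp add: sols_def)
  have "inj_on fst inn" "inn \<subseteq> V" using assms(1) by (auto simp: call_args_def)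
  then have "card inn = card (fst ` inn)" by (simp add: card_image)
  also have "fst ` inn \<subseteq> {..<N}" using \<open>inn \<subseteq> V\<close> vertices_N by auto
  then have "card (fst ` inn) \<le> N" by (metis card_lessThan card_mono finite_lessThan)
  finally show "card inn \<le> N" .
qed

lemma step_leaf:
  assumes "call_state (mem c) d D inn out" "call_args D inn" "d > 0" "sols D inn out \<noteq> {}"
    and "heads W (pruned D inn out) = heads F (pruned D inn out)"
  shows "\<exists>c'. step c c' \<and> map snd (tape c') = map snd (tape c) @ encode_event m n (Call D inn out) @
      encode_event m n (Output (heads W (pruned D inn out))) \<and> choices c' = choices c \<and>
    static (mem c') \<and> mem c' aDepth [] = d - 1 \<and> lower d (mem c) (mem c') \<and>
    clock c' \<le> clock c + body_cost + delete_cost * (card D - card (pruned D inn out))"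
proof -
  obtain c1 D' where c1: "exec prelude (tick (1 + bcost (pos (rd aDepth))) c) c1" "choices c1 = choices c"
    "map snd (tape c1) = map snd (tape c) @ encode_event m n (Call D inn out)"
    "final D (out \<union> same_lines D inn) D'"
    "inspected (mem c1) D' inn" "call_state (mem c1) d D inn out" "lower d (mem c) (mem c1)"
    "clock c1 + loop_cost N decide \<le> clock c + body_cost + delete_cost * (card D - card D')"
    using step_prelude[OF assms(1-3)] by metis
  note st = c1(6)[unfolded call_state_def static_def]
  note p = pruned_rows[OF assms(2,4) c1(4)]
  have nil: "cands D' = []" using cands_Nil_iff[OF p(3,4)] assms(5) p(1) by simp
  have em: "emits N emit_matching (mem c1) (map snd (tape c1))
      (\<lambda>M' tp'. tp' = map snd (tape c1) @ encode_event m n (Output (heads W D')) \<and>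
        (\<forall>a. a \<notin> assigned emit_matching \<longrightarrow> M' a = mem c1 a))"
    using st by (intro emits_frame emit_matching[OF c1(5) p(3)]) auto
  have "emits N decide (mem c1) (map snd (tape c1)) (\<lambda>M' tp'. M' aDepth [] = d - 1 \<and>
      tp' = map snd (tape c1) @ encode_event m n (Output (heads W D')) \<and>
      (\<forall>a. a \<notin> {vi, aDepth} \<longrightarrow> M' a = mem c1 a))"
    unfolding decide_def
  proof (rule emits_If, goal_cases)
    case 1
    then show ?case using st p(5,6) c1(5) by (auto simp: inspected_def)
  next
    case 2
    show ?case
    proof (rule emits_If, goal_cases)
      case 1
      show ?case unfolding pop_def
        by (rule emits_Seq, rule emits_mono[OF em], rule emits_Assign)
          (use st in \<open>auto simp: emit_matching_def store_def\<close>)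
    next
      case 2
      then show ?case using c1(5) nil by (simp add: inspected_def)
    qed
  qed
  then obtain c2 where c2: "exec decide c1 c2" "clock c2 \<le> clock c1 + loop_cost N decide" "choices c2 = choices c1"
    "mem c2 aDepth [] = d - 1 \<and> map snd (tape c2) = map snd (tape c1) @ encode_event m n (Output (heads W D')) \<and>
      (\<forall>a. a \<notin> {vi, aDepth} \<longrightarrow> mem c2 a = mem c1 a)"
    by (rule emitsE)
  have "static (mem c2)"
  proof -
    have "mem c2 a = mem c1 a" if "a \<in> {0, 1, aN, aP, aRows}" for a using c2(4) that by auto
    then show ?thesis using c1(6) static_cong[of "mem c2" "mem c1"] by (simp add: call_state_def)
  qed
  moreover have "lower d (mem c) (mem c2)"
  proof -
    have "lower d (mem c1) (mem c2)" using c2(4) by (intro lower_refl) auto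
    then show ?thesis using c1(7) lower_trans by blast
  qed
  moreover have "step c c2"
    using exec.Seq[OF c1(1) c2(1)] assms(1,3) by (simp add: step_def call_state_def)
  ultimately show ?thesis
    using c1 c2 p(1) by (intro exI[of _ c2]) auto
qed

lemma step_node:
  assumes "call_state (mem c) d D inn out" "call_args D inn" "d > 0" "sols D inn out \<noteq> {}"
  defines "D' \<equiv> pruned D inn out" and "out' \<equiv> out \<union> same_lines D inn"
  assumes x: "x \<in> heads W D' - heads F D'" "fst x = cands D' ! (choices c 0 mod length (cands D'))"
  shows "\<exists>c'. step c c' \<and> map snd (tape c') = map snd (tape c) @ encode_event m n (Call D inn out) \<and>
    choices c' = (\<lambda>i. choices c (Suc i)) \<and> call_state (mem c') (Suc d) D' (insert x inn) out' \<and>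
    repF (mem c') d D' inn (insert x out') \<and> lower d (mem c) (mem c') \<and>
    clock c' \<le> clock c + body_cost + delete_cost * (card D - card D')"
proof -
  obtain c1 E where c1: "exec prelude (tick (1 + bcost (pos (rd aDepth))) c) c1" "choices c1 = choices c"
    "map snd (tape c1) = map snd (tape c) @ encode_event m n (Call D inn out)"
    "final D out' E" "repG (mem c1) E" "repX (mem c1) out'"
    "inspected (mem c1) E inn" "call_state (mem c1) d D inn out" "lower d (mem c) (mem c1)"
    "clock c1 + loop_cost N decide \<le> clock c + body_cost + delete_cost * (card D - card E)"
    unfolding out'_def using step_prelude[OF assms(1-3)] by metis
  note st = c1(8)[unfolded call_state_def static_def]
  note p = pruned_rows[OF assms(2,4) c1(4)[unfolded out'_def]]
  have E: "E = D'" using p(1) by (simp add: D'_def)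
  let ?k = "length (cands D')"
  have "fst x \<in> set (cands D')" using cands_iff(1)[OF p(3,4), of x] x(1) unfolding E by blast
  then have k: "0 < ?k" by (cases "cands D'") auto
  let ?v = "choices c 0 mod ?k"
  define b1 where "b1 = Or (Less (rd vrows) (rd aRows)) (pos (rd vbad))"
  define b2 where "b2 = Not (pos (rd vcnt))"
  have b: "\<not> bval (mem c1) b1" "\<not> bval (mem c1) b2"
    using st p(5,6) c1(7) k E by (auto simp: inspected_def b1_def b2_def)
  \<comment> \<open>The judgements \<open>emits\<close> and \<open>silent\<close> do not allow
    choices to be consumed, so \<open>decide\<close> is executed explicitly up to and including
    \<open>Choose\<close>.\<close>
  define c2 where "c2 = tick (1 + bcost b2) (tick (1 + bcost b1) c1)"
  have c2: "mem c2 = mem c1" "choices c2 = choices c1" "tape c2 = tape c1"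
    "clock c2 = clock c1 + (1 + bcost b1) + (1 + bcost b2)"
    by (simp_all add: c2_def tick_def)
  define c3 where "c3 = tick (2 + acost (rd vcnt))
    (c2\<lparr>mem := store (mem c2) vt [] ?v, choices := (\<lambda>i. choices c2 (Suc i))\<rparr>)"
  have "exec (Choose vt [] (rd vcnt)) c2 c3"
    using exec.Choose[of ?k c2 "rd vcnt" ?v vt "[]"] c1(2,7) c2 k E by (simp add: c3_def inspected_def)
  have c3: "mem c3 = store (mem c1) vt [] ?v" "choices c3 = (\<lambda>i. choices c (Suc i))" "tape c3 = tape c1"
    "clock c3 = clock c2 + (2 + acost (rd vcnt))"
    using c2 c1(2) by (simp_all add: c3_def tick_def)
  have "silent N branch (mem c3) (\<lambda>M'. M' aDepth [] = Suc d \<and> repF M' d D' inn (insert x out') \<and>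
      repF M' (Suc d) D' (insert x inn) out' \<and> lower d (mem c3) M')"
  proof (rule branch)
    show "repG (mem c3) D'" "repX (mem c3) out'" using c1(5,6) E c3 by simp_all
    show "repF (mem c3) d D inn out" "mem c3 aDepth [] = d" "mem c3 aN [] = N" "inspected (mem c3) D' inn"
      using st c3 c1(7) E by (simp_all add: repF_def repP_def inspected_def)
  qed (use p(3) E x k c3 in auto)
  then obtain c4 where c4: "exec branch c3 c4" "clock c4 \<le> clock c3 + loop_cost N branch" "choices c4 = choices c3"
    "tape c4 = tape c3" "mem c4 aDepth [] = Suc d \<and> repF (mem c4) d D' inn (insert x out') \<and>
      repF (mem c4) (Suc d) D' (insert x inn) out' \<and> lower d (mem c3) (mem c4)" by (rule silentE)
  have "exec (Seq (Choose vt [] (rd vcnt)) branch) c2 c4"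
    by (rule exec.Seq) fact+
  then have "exec decide c1 c4"
    unfolding decide_def b1_def[symmetric] b2_def[symmetric]
    using b by (auto intro!: exec.IfFalse simp: c2_def tick_def)
  then have "step c c4"
    using exec.Seq[OF c1(1)] assms(1,3) by (simp add: step_def call_state_def)
  moreover have "clock c4 \<le> clock c + body_cost + delete_cost * (card D - card D')"
  proof -
    have "clock c4 \<le> clock c1 + loop_cost N decide"
      using c4(2) c3(4) c2(4) unfolding decide_def b1_def b2_def by simp
    then show ?thesis using c1(10) E by simp
  qed
  moreover have "static (mem c4)"
  proof -
    have "mem c4 a = mem c1 a" if "a \<in> {0, 1, aN, aP, aRows}" for a
      using exec_frame[OF c4(1), of a] that c3(1)
      by (auto simp: branch_def copy_def add_choice_def store_def)
    then show ?thesis using c1(8) static_cong[of "mem c4" "mem c1"] by (simp add: call_state_def)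
  qed
  moreover have "lower d (mem c) (mem c4)"
  proof -
    have "lower d (mem c1) (mem c3)" using c3(1) by (intro lower_refl) (auto simp: store_def)
    then show ?thesis using c1(9) c4(5) lower_trans by blast
  qed
  ultimately show ?thesis
    using c1(3) c3 c4 by (intro exI[of _ c4]) (simp add: call_state_def)
qed

text \<open>The tree is traversed in preorder, and \<open>ch'\<close> is what remains of the
  sequence: the first subtree hands its remainder to the second. The reduction modulo the number of
  candidates is that of \<open>Choose\<close>.\<close>

primrec chooses ::
  "(nat \<times> nat) tree \<Rightarrow> (nat \<times> nat) set \<Rightarrow> (nat \<times> nat) set \<Rightarrow> (nat \<times> nat) set
     \<Rightarrow> (nat \<Rightarrow> nat) \<Rightarrow> (nat \<Rightarrow> nat) \<Rightarrow> bool" where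
  "chooses Leaf D inn out ch ch' \<longleftrightarrow> ch' = ch"
| "chooses (Node x t1 t2) D inn out ch ch' \<longleftrightarrow>
     fst x = cands (pruned D inn out) ! (ch 0 mod length (cands (pruned D inn out))) \<and>
     (\<exists>ch1. chooses t1 (pruned D inn out) (insert x inn) (out \<union> same_lines D inn) (\<lambda>i. ch (Suc i)) ch1 \<and>
            chooses t2 (pruned D inn out) inn (insert x (out \<union> same_lines D inn)) ch1 ch')"

text \<open>The sequence is built backwards from an arbitrary remainder \<open>ch'\<close>; at a
  node, \<open>case_nat v ch2\<close> puts the index of the chosen candidate in front, unaffected by
  the reduction as it is in range.\<close>

lemma chooses_of_tree:
  assumes "rec_tree t D inn out" "D \<subseteq> V" "normal W F D"
  shows "\<exists>ch. chooses t D inn out ch ch'"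
  using assms
proof (induction t arbitrary: D inn out ch')
  case (Node x t1 t2)
  let ?D = "pruned D inn out" and ?out = "out \<union> same_lines D inn"
  from Node.prems have ne: "sols D inn out \<noteq> {}" and x: "x \<in> heads W ?D - heads F ?D" by auto
  note p = pruned[OF Node.prems(2,3) ne]
  have DV: "?D \<subseteq> V" using p(1) Node.prems(2) by blast
  have t: "rec_tree t1 ?D (insert x inn) ?out" "rec_tree t2 ?D inn (insert x ?out)" using Node.prems by auto
  obtain ch1 where ch1: "chooses t2 ?D inn (insert x ?out) ch1 ch'"
    using Node.IH(2)[OF t(2) DV p(2)] by blast
  obtain ch2 where ch2: "chooses t1 ?D (insert x inn) ?out ch2 ch1"
    using Node.IH(1)[OF t(1) DV p(2)] by blast
  have "fst x \<in> set (cands ?D)" using cands_iff(1)[OF DV p(2)] x by blast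
  then obtain v where "v < length (cands ?D)" "cands ?D ! v = fst x" by (auto simp: in_set_conv_nth)
  then show ?case using ch1 ch2 by (intro exI[of _ "case_nat v ch2"]) auto
qed auto

lemma tree_of_choices:
  assumes "D \<subseteq> V" "normal W F D" "sols D inn out \<noteq> {}"
  shows "\<exists>t ch'. rec_tree t D inn out \<and> chooses t D inn out ch ch'"
  using assms
proof (induction "card (sols D inn out)" arbitrary: D inn out ch rule: less_induct)
  case less
  let ?D = "pruned D inn out" and ?out = "out \<union> same_lines D inn"
  note p = pruned[OF less.prems]
  have DV: "?D \<subseteq> V" using p(1) less.prems(1) by blast
  show ?case
  proof (cases "heads W ?D = heads F ?D")
    case True
    then show ?thesis using less.prems by (intro exI[of _ Leaf] exI[of _ ch]) simp
  next
    case False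
    then have "cands ?D \<noteq> []" using cands_Nil_iff[OF DV p(2)] by simp
    then have "cands ?D ! (ch 0 mod length (cands ?D)) \<in> set (cands ?D)" by simp
    then obtain x where x: "x \<in> heads W ?D - heads F ?D" "fst x = cands ?D ! (ch 0 mod length (cands ?D))"
      using cands_iff(2)[OF DV p(2)] by metis
    note c = card_sols_split[OF less.prems x(1)] and s = sols_split[OF less.prems x(1)]
    obtain t1 ch1 where t1: "rec_tree t1 ?D (insert x inn) ?out"
      "chooses t1 ?D (insert x inn) ?out (\<lambda>i. ch (Suc i)) ch1"
      using less.hyps[OF c(1) DV p(2) s(3)] by blast
    obtain t2 ch2 where t2: "rec_tree t2 ?D inn (insert x ?out)" "chooses t2 ?D inn (insert x ?out) ch1 ch2"
      using less.hyps[OF c(2) DV p(2) s(4)] by blast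
    show ?thesis using less.prems x t1 t2 by (intro exI[of _ "Node x t1 t2"] exI[of _ ch2]) auto
  qed
qed

text \<open>
  An upper bound for the time until the next output: every call on the way to it adds a vertex to
  \<open>inn\<close>, and pays for its deletions by the decrease of \<open>D\<close>.
\<close>

definition potential :: "(nat \<times> nat) set \<Rightarrow> (nat \<times> nat) set \<Rightarrow> nat" where
  "potential D inn = body_cost * (N + 1 - card inn) + delete_cost * card D"

definition max_potential :: nat where
  "max_potential = body_cost * (N + 1) + delete_cost * (N * N)"

lemma potential_le: "D \<subseteq> V \<Longrightarrow> potential D inn \<le> max_potential"
  unfolding potential_def max_potential_def by (intro add_mono mult_left_mono card_digraph) auto

text \<open>Growing \<open>inn\<close> by one vertex releases one \<open>body_cost\<close>, and the
  decrease of \<open>D\<close> releases the cost of the deletions, which together pay for the call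
  up to its first subcall.\<close>

lemma call_args_children:
  assumes "call_args D inn" "sols D inn out \<noteq> {}"
  defines "D' \<equiv> pruned D inn out"
  assumes x: "x \<in> heads W D' - heads F D'"
  shows "call_args D' (insert x inn)" "call_args D' inn"
    and "body_cost + delete_cost * (card D - card D') + potential D' (insert x inn) \<le> potential D inn"
proof -
  have D: "D \<subseteq> V" "normal W F D" "fst ` D = fst ` nf" and inn: "inn \<subseteq> V" "inj_on fst inn" "inj_on snd inn"
    using assms(1) by (auto simp: call_args_def)
  obtain E where E: "final D (out \<union> same_lines D inn) E" using final_ex[OF D(1,2)] .
  note p = pruned_rows[OF assms(1,2) E, folded D'_def] 
  have ED: "E = D'" using p(1) .
  note p = p[unfolded ED]
  \<comment> \<open>The enlarged \<open>inn\<close> lies inside the matching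
    \<open>heads W D'\<close>, so it still meets each line at most once.\<close>
  have ins: "insert x inn \<subseteq> heads W D'" using p(7) x by blast
  note inj = stable_inj[OF stable_heads(1)[OF p(4,3)] p(3)]
  have "insert x inn \<subseteq> V" using ins heads_subset[of W D'] p(3) by blast
  then show args: "call_args D' (insert x inn)" "call_args D' inn"
    using p inn inj_on_subset[OF inj(1) ins] inj_on_subset[OF inj(2) ins] by (simp_all add: call_args_def)
  have "x \<notin> inn" using sols_split(5)[OF D(1,2) assms(2)] x by (simp add: D'_def)
  moreover have fin: "finite inn" using inn(1) finite_digraph by blast
  ultimately have card: "card (insert x inn) = Suc (card inn)" by simp
  have "card (insert x inn) = card (fst ` insert x inn)"
    using args(1) unfolding call_args_def by (metis card_image)
  also have "fst y < N" if "y \<in> insert x inn" for y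
    using that \<open>insert x inn \<subseteq> V\<close> vertices_N[of "fst y" "snd y"] by auto
  then have "fst ` insert x inn \<subseteq> {..<N}" by auto
  then have "card (fst ` insert x inn) \<le> N" by (metis card_lessThan card_mono finite_lessThan)
  finally have le: "Suc (card inn) \<le> N" using card by simp
  have "card D' \<le> card D" using p(2) finite_digraph[OF D(1)] by (intro card_mono)
  then have "delete_cost * (card D - card D') + delete_cost * card D' = delete_cost * card D"
    by (metis distrib_left le_add_diff_inverse2)
  \<comment> \<open>Since \<open>inn\<close> with \<open>x\<close> has at most \<open>N\<close>
    elements, the truncated subtraction is exact here.\<close>
  moreover have "body_cost + body_cost * (N + 1 - Suc (card inn)) = body_cost * (N + 1 - card inn)"
  proof -
    have "N + 1 - card inn = Suc (N + 1 - Suc (card inn))" using le by simp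
    then show ?thesis by simp
  qed
  ultimately show "body_cost + delete_cost * (card D - card D') + potential D' (insert x inn) \<le> potential D inn"
    unfolding potential_def card by linarith
qed

lemma step_tape:
  assumes "step c c'"
  obtains tp where "tape c' = tape c @ tp" "\<And>e. e \<in> set tp \<Longrightarrow> clock c \<le> fst e \<and> fst e \<le> clock c'"
proof -
  have "exec (Seq prelude decide) (tick (1 + bcost (pos (rd aDepth))) c) c'" using assms by (simp add: step_def)
  from exec_tape[OF this] obtain tp where
    "tape c' = tape c @ tp" "\<forall>e\<in>set tp. clock (tick (1 + bcost (pos (rd aDepth))) c) \<le> fst e \<and> fst e \<le> clock c'"
    by (auto simp: tick_def)
  then show thesis by (intro that[of tp]) (auto simp: tick_def dest!: bspec)
qed

text \<open>\<open>L\<close> stands for the time of the latest output, or at first for the bound on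
  initialization. The iteration of a leaf ends at most \<open>max_potential\<close> after its
  output, and a pending second subcall again has potential at most \<open>max_potential\<close>;
  hence the allowance of two. Descending into a first subcall preserves the hypothesis on the
  clock.\<close>

lemma run_tree:
  assumes "rec_tree t D inn out" "call_args D inn" "call_state (mem c) d D inn out" "d > 0"
    and "chooses t D inn out (choices c) ch'" "clock c + potential D inn \<le> L + 2 * max_potential"
  shows "\<exists>c' tp. step\<^sup>*\<^sup>* c c' \<and> tape c' = tape c @ tp \<and>
    map snd tp = concat (map (encode_event m n) (log_tree t D inn out)) \<and> choices c' = ch' \<and>
    static (mem c') \<and> mem c' aDepth [] = d - 1 \<and> lower d (mem c) (mem c') \<and>
    (let ts = output_times m n (log_tree t D inn out) tp in
     length ts = outputs (log_tree t D inn out) \<and> spaced (2 * max_potential) L ts \<and>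
     ts \<noteq> [] \<and> clock c' \<le> last ts + max_potential)"
  using assms
proof (induction t arbitrary: D inn out c d L ch')
  case Leaf
  let ?D = "pruned D inn out" and ?out = "out \<union> same_lines D inn"
  from Leaf.prems have ne: "sols D inn out \<noteq> {}" and hd: "heads W ?D = heads F ?D" by auto
  have D: "D \<subseteq> V" "normal W F D" using Leaf.prems(2) by (auto simp: call_args_def)
  obtain c' where c': "step c c'" "map snd (tape c') = map snd (tape c) @ encode_event m n (Call D inn out) @
      encode_event m n (Output (heads W ?D))" "choices c' = choices c"
    "static (mem c')" "mem c' aDepth [] = d - 1" "lower d (mem c) (mem c')"
    "clock c' \<le> clock c + body_cost + delete_cost * (card D - card ?D)"
    using step_leaf[OF Leaf.prems(3,2,4) ne hd] by blast
  obtain tp where tp: "tape c' = tape c @ tp" "\<And>e. e \<in> set tp \<Longrightarrow> clock c \<le> fst e \<and> fst e \<le> clock c'"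
    using step_tape[OF c'(1)] by blast
  have enc: "map snd tp = encode_event m n (Call D inn out) @ encode_event m n (Output (heads W ?D))"
    using c'(2) tp(1) by simp
  define i where "i = length (encode_event m n (Call D inn out)) + (length (encode_event m n (Output (heads W ?D))) - 1)"
  have "length tp = length (encode_event m n (Call D inn out)) + length (encode_event m n (Output (heads W ?D)))"
    using enc by (metis length_append length_map)
  moreover have "0 < length (encode_event m n (Output (heads W ?D)))" by simp
  ultimately have i: "i < length tp" unfolding i_def by linarith
  have ts: "output_times m n (log_tree Leaf D inn out) tp = [fst (tp ! i)]"
    using i unfolding i_def by (simp del: encode_event.simps)
  have stamp: "clock c \<le> fst (tp ! i)" "fst (tp ! i) \<le> clock c'" using tp(2)[OF nth_mem[OF i]] by auto
  obtain E where E: "final D ?out E" using final_ex[OF D] .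
  note p = pruned_rows[OF Leaf.prems(2) ne E]
  \<comment> \<open>As \<open>inn\<close> has at most \<open>N\<close> elements, the potential still
    contains one full \<open>body_cost\<close> for the leaf.\<close>
  have cost: "body_cost + delete_cost * (card D - card ?D) \<le> potential D inn"
  proof -
    have "body_cost * 1 \<le> body_cost * (N + 1 - card inn)" using p(8) by (intro mult_left_mono) auto
    moreover have "delete_cost * (card D - card ?D) \<le> delete_cost * card D" by simp
    ultimately show ?thesis unfolding potential_def by linarith
  qed
  have "fst (tp ! i) \<le> L + 2 * max_potential" using stamp cost c'(7) Leaf.prems(6) by linarith
  moreover have "clock c' \<le> fst (tp ! i) + max_potential"
    using stamp cost c'(7) potential_le[OF D(1), of inn] by linarith
  ultimately have "let ts = output_times m n (log_tree Leaf D inn out) tp in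
     length ts = outputs (log_tree Leaf D inn out) \<and> spaced (2 * max_potential) L ts \<and>
     ts \<noteq> [] \<and> clock c' \<le> last ts + max_potential" unfolding ts by simp
  moreover have "map snd tp = concat (map (encode_event m n) (log_tree Leaf D inn out))"
    using enc by (simp del: encode_event.simps)
  ultimately show ?case
    using c'(1,3-6) tp(1) Leaf.prems(5) by (intro exI[of _ c'] exI[of _ tp] conjI r_into_rtranclp) simp_all
next
  case (Node x t1 t2)
  let ?D = "pruned D inn out" and ?out = "out \<union> same_lines D inn"
  let ?l1 = "log_tree t1 ?D (insert x inn) ?out" and ?l2 = "log_tree t2 ?D inn (insert x ?out)"
  from Node.prems have ne: "sols D inn out \<noteq> {}" and x: "x \<in> heads W ?D - heads F ?D"
    and trees: "rec_tree t1 ?D (insert x inn) ?out" "rec_tree t2 ?D inn (insert x ?out)" by auto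
  have D: "D \<subseteq> V" "normal W F D" using Node.prems(2) by (auto simp: call_args_def)
  note args = call_args_children[OF Node.prems(2) ne x]
  have DV: "?D \<subseteq> V" using args(2) by (simp add: call_args_def)
  from Node.prems(5) obtain ch1 where
    x_choice: "fst x = cands ?D ! (choices c 0 mod length (cands ?D))" and
    ch1: "chooses t1 ?D (insert x inn) ?out (\<lambda>i. choices c (Suc i)) ch1" "chooses t2 ?D inn (insert x ?out) ch1 ch'"
    by auto
  obtain c1 where c1: "step c c1" "map snd (tape c1) = map snd (tape c) @ encode_event m n (Call D inn out)"
    "choices c1 = (\<lambda>i. choices c (Suc i))" "call_state (mem c1) (Suc d) ?D (insert x inn) ?out"
    "repF (mem c1) d ?D inn (insert x ?out)" "lower d (mem c) (mem c1)"
    "clock c1 \<le> clock c + body_cost + delete_cost * (card D - card ?D)"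
    using step_node[OF Node.prems(3,2,4) ne x x_choice] by blast
  obtain tp0 where tp0: "tape c1 = tape c @ tp0" using step_tape[OF c1(1)] by blast
  have enc0: "map snd tp0 = encode_event m n (Call D inn out)" using c1(2) tp0 by simp
  have "clock c1 + potential ?D (insert x inn) \<le> L + 2 * max_potential"
    using c1(7) args(3) Node.prems(6) by linarith
  from Node.IH(1)[OF trees(1) args(1) c1(4) zero_less_Suc _ this, unfolded c1(3), OF ch1(1)]
  obtain c2 tp1 where c2: "step\<^sup>*\<^sup>* c1 c2" "tape c2 = tape c1 @ tp1"
    "map snd tp1 = concat (map (encode_event m n) ?l1)" "choices c2 = ch1" "static (mem c2)" "mem c2 aDepth [] = d"
    "lower (Suc d) (mem c1) (mem c2)" "length (output_times m n ?l1 tp1) = outputs ?l1"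
    "spaced (2 * max_potential) L (output_times m n ?l1 tp1)"
    "output_times m n ?l1 tp1 \<noteq> []" "clock c2 \<le> last (output_times m n ?l1 tp1) + max_potential"
    unfolding Let_def diff_Suc_1 by blast
  let ?L = "last (output_times m n ?l1 tp1)"
  have "repF (mem c2) d ?D inn (insert x ?out)" using repF_lower[OF c1(5) c2(7)] by simp
  then have state2: "call_state (mem c2) d ?D inn (insert x ?out)" using c2(5,6) by (simp add: call_state_def)
  \<comment> \<open>The last output of the first subtree takes over the role of
    \<open>L\<close>.\<close>
  have "clock c2 + potential ?D inn \<le> ?L + 2 * max_potential"
    using c2(11) potential_le[OF DV, of inn] by linarith
  from Node.IH(2)[OF trees(2) args(2) state2 Node.prems(4) _ this, unfolded c2(4), OF ch1(2)]
  obtain c3 tp2 where c3: "step\<^sup>*\<^sup>* c2 c3" "tape c3 = tape c2 @ tp2"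
    "map snd tp2 = concat (map (encode_event m n) ?l2)" "choices c3 = ch'" "static (mem c3)" "mem c3 aDepth [] = d - 1"
    "lower d (mem c2) (mem c3)" "length (output_times m n ?l2 tp2) = outputs ?l2"
    "spaced (2 * max_potential) ?L (output_times m n ?l2 tp2)"
    "output_times m n ?l2 tp2 \<noteq> []" "clock c3 \<le> last (output_times m n ?l2 tp2) + max_potential"
    unfolding Let_def diff_Suc_1 by blast
  have len1: "length tp1 = length (concat (map (encode_event m n) ?l1))" using c2(3) by (metis length_map)
  have len0: "length (encode_event m n (Call D inn out)) = length tp0" using enc0 by (metis length_map)
  have ts: "output_times m n (log_tree (Node x t1 t2) D inn out) (tp0 @ tp1 @ tp2) =
      output_times m n ?l1 tp1 @ output_times m n ?l2 tp2"
    using output_times_append[OF len1, of ?l2 tp2] by (simp add: len0 del: encode_event.simps)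
  have "step\<^sup>*\<^sup>* c c3" using c1(1) c2(1) c3(1) by (meson converse_rtranclp_into_rtranclp rtranclp_trans)
  moreover have "lower d (mem c) (mem c3)"
    using c1(6) lower_mono[OF c2(7), of d] c3(7) lower_trans by (metis le_add2 plus_1_eq_Suc)
  moreover have "tape c3 = tape c @ tp0 @ tp1 @ tp2" using tp0 c2(2) c3(2) by simp
  moreover have "map snd (tp0 @ tp1 @ tp2) = concat (map (encode_event m n) (log_tree (Node x t1 t2) D inn out))"
    using enc0 c2(3) c3(3) by (simp del: encode_event.simps)
  moreover have "spaced (2 * max_potential) L (output_times m n ?l1 tp1 @ output_times m n ?l2 tp2)"
    using c2(9,10) c3(9) by (simp add: spaced_append)
  moreover from this have "let ts = output_times m n (log_tree (Node x t1 t2) D inn out) (tp0 @ tp1 @ tp2) in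
     length ts = outputs (log_tree (Node x t1 t2) D inn out) \<and> spaced (2 * max_potential) L ts \<and>
     ts \<noteq> [] \<and> clock c3 \<le> last ts + max_potential"
    using c2(8) c3(8,10,11) unfolding ts by (simp add: Let_def)
  ultimately show ?case
    using c3(4-6) by (intro exI[of _ c3] exI[of _ "tp0 @ tp1 @ tp2"] conjI)
qed

end

section \<open>Initialization and total running time\<close>

context numbered
begin

lemma input_apply [simp]:
  "input_memory P inn out a [] = (if a = 0 then m else if a = 1 then n else 0)"
  "input_memory P inn out a [w, f] =
     of_bool (a = 2 \<and> (w, f) \<in> V \<or> a = 3 \<and> (w, f) \<in> inn \<or> a = 4 \<and> (w, f) \<in> out)"
  "input_memory P inn out a [w, f, x] =
     of_bool (a = 5 \<and> ((w, f), (w, x)) \<in> W \<or> a = 6 \<and> ((w, f), (x, f)) \<in> F)"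
  by (simp_all add: input_memory_def m_def n_def)

lemma load_input:
  "silent N load_input (input_memory P inn out) (\<lambda>M'. repG M' V \<and> repP M')"
proof -
  let ?M = "input_memory P inn out"
  have arcs: "silent N load_arcs M (\<lambda>M'. repG M' V \<and> repP M')"
    if M: "repG M V" "M aN [] = N" "M 5 = ?M 5" "M 6 = ?M 6" for M
    unfolding load_arcs_def
  proof (rule silent_For2[where n = N and J = "\<lambda>_. True" and
      R = "\<lambda>x y M'. \<forall>z<N. M' aP [0, x, y, z] = of_bool (((x, y), (x, z)) \<in> W) \<and>
        M' aP [1, x, y, z] = of_bool (((y, x), (z, x)) \<in> F)"], goal_cases)
    case (14 x y M1)
    from 14(5) have fr: "M1 a = M a" if "a \<notin> {vi, vj, vk, aP}" for a using that by simp
    show ?case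
    proof (rule silent_For[where n = N and
        I = "\<lambda>k M'. (\<forall>z<k. M' aP [0, x, y, z] = of_bool (((x, y), (x, z)) \<in> W) \<and>
            M' aP [1, x, y, z] = of_bool (((y, x), (z, x)) \<in> F)) \<and>
          (\<forall>x' y' z s. (x', y') \<noteq> (x, y) \<longrightarrow> M' aP [s, x', y', z] = M1 aP [s, x', y', z])"], goal_cases)
      case (7 k M2)
      from 7(3) have "M2 5 = ?M 5" "M2 6 = ?M 6" "M2 vi [] = x" "M2 vj [] = y"
        using fr[of 5] fr[of 6] M 14(3,4) by simp_all
      then show ?case
        using 7(2,4) by (intro silent_Seq silent_Assign) (auto simp: less_Suc_eq)
    next
      case (8 M2)
      then show ?case by simp
    qed (use fr M in auto)
  next
    case (15 M')
    then have "repP M'" using M(2) by (simp add: repP_def arc_def vtx_def less_2)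
    moreover have "repG M' V" using 15(3)[of aG] M(1) rep_cong(1)[of M' M V] by simp
    ultimately show ?case by blast
  qed (use M in auto)
  have loops: "silent N (Seq load_graph load_arcs) (store ?M aN [] N) (\<lambda>M'. repG M' V \<and> repP M')"
    unfolding load_graph_def
  proof (rule silent_Seq, rule silent_For2[where n = N and J = "\<lambda>_. True" and
      R = "\<lambda>x y M'. M' aG [0, x, y] = of_bool ((x, y) \<in> V) \<and> M' aG [1, y, x] = of_bool ((x, y) \<in> V)"], goal_cases)
    case (14 x y M1)
    from 14(5)[of 2] have "M1 2 [x, y] = of_bool ((x, y) \<in> V)" by simp
    then show ?case
      using 14(3,4) by (intro silent_Seq silent_Assign) auto
  next
    case (15 M')
    show ?case
    proof (rule arcs)
      show "repG M' V" using 15(2) by (auto simp: repG_def vtx_def less_2)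
      show "M' aN [] = N" "M' 5 = ?M 5" "M' 6 = ?M 6"
        using 15(3)[of aN] 15(3)[of 5] 15(3)[of 6] by (simp_all add: store_def)
    qed
  qed auto
  show ?thesis unfolding load_input_def
  proof (rule silent_Seq, rule silent_If)
    show "silent N (Assign aN [] (rd 1)) ?M (\<lambda>M'. silent N (Seq load_graph load_arcs) M' (\<lambda>M'. repG M' V \<and> repP M'))"
      if "bval ?M (Less (rd 0) (rd 1))"
      using that loops by (intro silent_Assign) (simp add: N_def max_def)
    show "silent N (Assign aN [] (rd 0)) ?M (\<lambda>M'. silent N (Seq load_graph load_arcs) M' (\<lambda>M'. repG M' V \<and> repP M'))"
      if "\<not> bval ?M (Less (rd 0) (rd 1))"
      using that loops by (intro silent_Assign) (cases "m = n"; simp add: N_def max_def)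
  qed
qed

lemma first_call:
  assumes "repG M nf" "repP M" "M 0 [] = m" "M 1 [] = n" "M vrows [] = card (fst ` nf)"
    and "\<And>a b. M 3 [a, b] = of_bool ((a, b) \<in> inn)" "\<And>a b. M 4 [a, b] = of_bool ((a, b) \<in> out)"
  shows "silent N first_call M (\<lambda>M'. call_state M' 1 nf inn out)"
  unfolding first_call_def
proof (rule silent_Seq, rule silent_Assign, rule silent_Seq, rule silent_For2[where n = N and J = "\<lambda>_. True" and
      R = "\<lambda>x y M'. M' aFD [1, x, y] = of_bool ((x, y) \<in> nf) \<and> M' aFI [1, x, y] = of_bool ((x, y) \<in> inn) \<and>
        M' aFO [1, x, y] = of_bool ((x, y) \<in> out)"], goal_cases)
  case (14 x y M1)
  from 14(5)[of aG] have "M1 aG [0, x, y] = of_bool ((x, y) \<in> nf)"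
    using 14(1,2) assms(1) by (simp add: repG_def vtx_def)
  moreover have "M1 3 [x, y] = of_bool ((x, y) \<in> inn)" "M1 4 [x, y] = of_bool ((x, y) \<in> out)"
    using 14(5)[of 3] 14(5)[of 4] assms(6,7) by simp_all
  ultimately show ?case
    using 14(3,4) by (intro silent_Seq silent_Assign) auto
next
  case (15 M')
  have fr: "M' a [] = store M aRows [] (M vrows []) a []" if "a \<notin> {vi, vj, aFD, aFI, aFO}" for a
    using 15(3)[of a] that by simp
  have "repP M'" using assms(2) 15(3)[of aP] 15(3)[of aN] by (simp add: repP_def)
  then show ?case
    using 15(2) fr[of 0] fr[of 1] fr[of aRows] assms(3-5)
    by (intro silent_Assign) (simp add: call_state_def static_def repF_def)
qed (use assms(2) in \<open>auto simp: repP_def\<close>)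

definition init_cost :: nat where
  "init_cost = loop_cost N load_input + loop_cost N push_all + 10 +
     (10 + loop_cost N process_line) * (2 * N + 2 * (N * N)) + loop_cost N inspect + loop_cost N first_call"

lemma init:
  assumes "mem c = input_memory P inn out"
  shows "\<exists>c'. exec init c c' \<and> call_state (mem c') 1 nf inn out \<and> choices c' = choices c \<and>
    tape c' = tape c \<and> clock c' \<le> clock c + init_cost"
proof -
  let ?M = "input_memory P inn out"
  have "silent N load_input (mem c) (\<lambda>M'. repG M' V \<and> repP M')"
    unfolding assms by (rule load_input)
  then obtain c1 where c1: "exec load_input c c1" "clock c1 \<le> clock c + loop_cost N load_input"
    "choices c1 = choices c" "tape c1 = tape c" "repG (mem c1) V \<and> repP (mem c1)" by (rule silentE)
  have fr1: "mem c1 a = ?M a" if "a \<notin> {aN, aG, aP, vi, vj, vk}" for a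
    using exec_frame[OF c1(1), of a] that assms by (simp add: load_input_def load_graph_def load_arcs_def)
  have "repX (mem c1) {}" using fr1[of aX] by (simp add: repX_def)
  from prune_com[OF _ this _ subset_refl] c1(5)
  obtain c2 D where c2: "exec prune_com c1 c2" "choices c2 = choices c1" "tape c2 = tape c1"
    "repG (mem c2) D" "final V {} D" "\<forall>y\<in>V - D. dominated W F D y"
    "clock c2 \<le> clock c1 + loop_cost N push_all + 10 + (10 + loop_cost N process_line) * (2 * N + 2 * (card V - card D))"
    by blast
  have fr2: "mem c2 a = mem c1 a" if "a \<notin> {aG, aSS, aSL, aSP, vi, vk, vs, vl, vt, vb, vh}" for a
    using exec_frame[OF c2(1), of a] that by (auto simp: prog_defs)
  have D: "D = nf" using final_V[of D] c2(5,6) by (auto simp: final_def)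
  have P2: "repP (mem c2)" using c1(5) rep_cong(3)[of "mem c2" "mem c1"] fr2[of aN] fr2[of aP] by simp
  \<comment> \<open>Before the first call \<open>inspect\<close> serves to count the rows of
    \<open>nf\<close>. The frames are still zero, so it finds an empty \<open>inn\<close>.\<close>
  have "\<forall>a<N. \<forall>b<N. mem c2 aFI [mem c2 aDepth [], a, b] = of_bool ((a, b) \<in> {})"
    using fr2[of aFI] fr1[of aFI] fr2[of aDepth] fr1[of aDepth] by simp
  then have "silent N inspect (mem c2) (\<lambda>M'. inspected M' nf {})"
    using c2(4) D P2 nf(1) by (intro inspect) auto
  then obtain c3 where c3: "exec inspect c2 c3" "clock c3 \<le> clock c2 + loop_cost N inspect" "choices c3 = choices c2"
    "tape c3 = tape c2" "inspected (mem c3) nf {}" by (rule silentE)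
  have fr3: "mem c3 a = mem c2 a" if "a \<notin> {vi, vj, vk, vcnt, vrows, vbad, vs, vl, vh, vb, vx, aH, aCand}" for a
    using exec_frame[OF c3(1), of a] that by (auto simp: prog_defs)
  have "silent N first_call (mem c3) (\<lambda>M'. call_state M' 1 nf inn out)"
  proof (rule first_call)
    show "repG (mem c3) nf" using c2(4) D fr3[of aG] rep_cong(1)[of "mem c3" "mem c2"] by simp
    show "repP (mem c3)" using P2 rep_cong(3)[of "mem c3" "mem c2"] fr3[of aN] fr3[of aP] by simp
    show "mem c3 0 [] = m" "mem c3 1 [] = n"
      using fr1[of 0] fr2[of 0] fr3[of 0] fr1[of 1] fr2[of 1] fr3[of 1] by simp_all
    show "mem c3 vrows [] = card (fst ` nf)" using c3(5) by (simp add: inspected_def)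
    show "mem c3 3 [a, b] = of_bool ((a, b) \<in> inn)" "mem c3 4 [a, b] = of_bool ((a, b) \<in> out)" for a b
      using fr1[of 3] fr2[of 3] fr3[of 3] fr1[of 4] fr2[of 4] fr3[of 4] by simp_all
  qed
  then obtain c4 where c4: "exec first_call c3 c4" "clock c4 \<le> clock c3 + loop_cost N first_call" "choices c4 = choices c3"
    "tape c4 = tape c3" "call_state (mem c4) 1 nf inn out" by (rule silentE)
  have "exec init c c4" unfolding init_def
    by (rule exec.Seq[OF c1(1) exec.Seq[OF c2(1) exec.Seq[OF c3(1) c4(1)]]])
  moreover have "(10 + loop_cost N process_line) * (2 * N + 2 * (card V - card D)) \<le>
      (10 + loop_cost N process_line) * (2 * N + 2 * (N * N))"
    using card_digraph[OF subset_refl] by (intro mult_left_mono add_mono) auto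
  then have "clock c4 \<le> clock c + init_cost"
    using c1(2) c2(7) c3(2) c4(2) unfolding init_cost_def by linarith
  ultimately show ?thesis using c1 c2 c3 c4 by (intro exI[of _ c4]) simp
qed

end

text \<open>Independent of the market, as one constant must serve all of them. \<open>b\<close>
  bounds \<open>body_cost\<close> in units of \<open>N ^ 2\<close> and \<open>d\<close> bounds
  \<open>delete_cost\<close> in units of \<open>N\<close>; with \<open>N + 1 \<le> 2 * N\<close>
  this gives \<open>2 * b + d\<close> for \<open>max_potential\<close>, counted twice for the gap
  between outputs. The other terms pay for the initialization, with \<open>2 * d\<close> for its
  pruning, and for the last guard.\<close>

definition cost_bound :: nat where
  "cost_bound = (let b = loop_cost 1 log_call + loop_cost 1 marks + loop_cost 1 load + loop_cost 1 push_all +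
       loop_cost 1 inspect + loop_cost 1 decide + 20 + (10 + loop_cost 1 process_line) * 2;
     d = 2 * (10 + loop_cost 1 process_line)
   in loop_cost 1 load_input + loop_cost 1 push_all + 10 + 2 * d + loop_cost 1 inspect +
     loop_cost 1 first_call + 10 + 2 * (2 * b + d))"

context numbered
begin

lemmas com_defs = prog_defs decide_def emit_matching_def pop_def branch_def copy_def add_choice_def
  load_input_def load_graph_def load_arcs_def first_call_def

lemma costs:
  assumes "N \<ge> 1"
  shows "init_cost + max_potential + 10 \<le> cost_bound * N ^ 3" "2 * max_potential \<le> cost_bound * N ^ 3"
proof -
  have p: "N ^ 2 \<le> N ^ 3" "1 \<le> N ^ 2" "N \<le> N ^ 2" "1 \<le> N ^ 3"
    using assms power_increasing[of 2 3 N] power_increasing[of 1 2 N] by simp_all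
  define pl where "pl = loop_cost 1 process_line"
  define d where "d = 2 * (10 + pl)"
  define b where "b = loop_cost 1 log_call + loop_cost 1 marks + loop_cost 1 load + loop_cost 1 push_all +
       loop_cost 1 inspect + loop_cost 1 decide + 20 + (10 + pl) * 2"
  have line: "10 + loop_cost N process_line \<le> (10 + pl) * N"
  proof -
    have "loop_cost N process_line \<le> pl * N ^ 1"
      unfolding pl_def by (rule loop_cost_le[OF assms]) (simp add: com_defs)
    moreover have "10 \<le> 10 * N" using assms by simp
    ultimately show ?thesis by (simp add: algebra_simps)
  qed
  have two: "loop_cost N log_call \<le> loop_cost 1 log_call * N ^ 2" "loop_cost N marks \<le> loop_cost 1 marks * N ^ 2"
    "loop_cost N load \<le> loop_cost 1 load * N ^ 2" "loop_cost N push_all \<le> loop_cost 1 push_all * N ^ 2"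
    "loop_cost N inspect \<le> loop_cost 1 inspect * N ^ 2" "loop_cost N decide \<le> loop_cost 1 decide * N ^ 2"
    "loop_cost N first_call \<le> loop_cost 1 first_call * N ^ 2"
    by (rule loop_cost_le[OF assms], simp add: com_defs)+
  have three: "loop_cost N load_input \<le> loop_cost 1 load_input * N ^ 3"
    by (rule loop_cost_le[OF assms]) (simp add: com_defs)
  have body: "body_cost \<le> b * N ^ 2"
  proof -
    have "(10 + loop_cost N process_line) * (2 * N) \<le> (10 + pl) * N * (2 * N)"
      using line by (rule mult_right_mono) simp
    also have "\<dots> = (10 + pl) * 2 * N ^ 2" by (simp add: power2_eq_square)
    finally have "(10 + loop_cost N process_line) * (2 * N) \<le> (10 + pl) * 2 * N ^ 2" .
    moreover have "20 \<le> 20 * N ^ 2" using p(2) by simp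
    ultimately show ?thesis unfolding body_cost_def b_def add_mult_distrib using two by linarith
  qed
  have del: "delete_cost \<le> d * N" 
    unfolding delete_cost_def d_def mult.assoc by (rule mult_left_mono[OF line]) simp
  have max: "max_potential \<le> (2 * b + d) * N ^ 3"
  proof -
    have "body_cost * (N + 1) \<le> b * N ^ 2 * (2 * N)" using body assms by (intro mult_mono) auto
    moreover have "delete_cost * (N * N) \<le> d * N * (N * N)" using del by (rule mult_right_mono) simp
    ultimately have "max_potential \<le> b * N ^ 2 * (2 * N) + d * N * (N * N)"
      unfolding max_potential_def by (rule add_mono)
    also have "\<dots> = (2 * b + d) * N ^ 3" by (simp add: power2_eq_square power3_eq_cube algebra_simps)
    finally show ?thesis .
  qed
  have cb: "cost_bound = loop_cost 1 load_input + loop_cost 1 push_all + 10 + 2 * d + loop_cost 1 inspect +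
      loop_cost 1 first_call + 10 + 2 * (2 * b + d)"
    unfolding cost_bound_def Let_def b_def d_def pl_def ..
  have up: "x * N ^ 2 \<le> x * N ^ 3" for x using p(1) by (rule mult_left_mono) simp
  have "init_cost \<le> (loop_cost 1 load_input + loop_cost 1 push_all + 10 + 2 * d + loop_cost 1 inspect +
      loop_cost 1 first_call) * N ^ 3"
  proof -
    have "2 * N + 2 * (N * N) \<le> 4 * (N * N)" using p(3) by (simp add: power2_eq_square)
    then have "(10 + loop_cost N process_line) * (2 * N + 2 * (N * N)) \<le> (10 + pl) * N * (4 * (N * N))"
      using line by (intro mult_mono) auto
    also have "\<dots> = 2 * d * N ^ 3" by (simp add: d_def power3_eq_cube)
    finally have "(10 + loop_cost N process_line) * (2 * N + 2 * (N * N)) \<le> 2 * d * N ^ 3" .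
    moreover have "10 \<le> 10 * N ^ 3" using p(4) by simp
    ultimately show ?thesis
      unfolding init_cost_def add_mult_distrib
      using three two(4,5,7) up[of "loop_cost 1 push_all"] up[of "loop_cost 1 inspect"] up[of "loop_cost 1 first_call"]
      by linarith
  qed
  moreover have "10 \<le> 10 * N ^ 3" using p(4) by simp
  moreover have "2 * (2 * b + d) * N ^ 3 = (2 * b + d) * N ^ 3 + (2 * b + d) * N ^ 3"
    by (simp add: algebra_simps)
  ultimately show "init_cost + max_potential + 10 \<le> cost_bound * N ^ 3" "2 * max_potential \<le> cost_bound * N ^ 3"
    unfolding cb add_mult_distrib using max by (linarith, linarith)
qed

lemma initial_args:
  assumes "valid_constraints P inn out"
  shows "call_args nf inn"
  using assms nf(1,2) by (simp add: call_args_def valid_constraints_def)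

lemma start_simps: "mem (start P inn out ch) = input_memory P inn out" "clock (start P inn out ch) = 0"
  "choices (start P inn out ch) = ch" "tape (start P inn out ch) = []"
  by (simp_all add: start_def)

lemma timely_tree:
  assumes "valid_constraints P inn out" "rec_tree t nf inn out" "chooses t nf inn out ch ch'"
    and "enumerate_stable P pick inn out = Some (log_tree t nf inn out)"
  shows "timely_run main_prog cost_bound P inn out ch pick"
proof -
  let ?evs = "log_tree t nf inn out" and ?K = "2 * max_potential"
  note args = initial_args[OF assms(1)]
  obtain c where c: "exec init (start P inn out ch) c" "call_state (mem c) 1 nf inn out" "choices c = ch"
    "tape c = []" "clock c \<le> init_cost"
    using init[of "start P inn out ch" inn out] by (auto simp: start_simps)
  have "clock c + potential nf inn \<le> init_cost + ?K"
    using c(5) potential_le[OF nf(1), of inn] by linarith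
  from run_tree[OF assms(2) args c(2) zero_less_one _ this, of ch'] assms(3) c(3)
  obtain c' tp where c': "step\<^sup>*\<^sup>* c c'" "tape c' = tp" "map snd tp = concat (map (encode_event m n) ?evs)"
    "mem c' aDepth [] = 0" "length (output_times m n ?evs tp) = outputs ?evs"
    "spaced ?K init_cost (output_times m n ?evs tp)" "output_times m n ?evs tp \<noteq> []"
    "clock c' \<le> last (output_times m n ?evs tp) + max_potential"
    unfolding Let_def c(4) by (auto simp: Let_def)
  define e where "e = tick (1 + bcost (pos (rd aDepth))) c'"
  have e: "exec main_prog (start P inn out ch) e"
    unfolding main_prog_def e_def by (rule exec.Seq[OF c(1) steps_While[OF c'(1,4)]])
  have etp: "tape e = tp" and ecl: "clock e = clock c' + 4" using c'(2) by (simp_all add: e_def tick_def)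
  have s: "outputs ?evs = card (solutions ?evs)" using outputs_log_tree[OF assms(2) nf(1,2)] .
  \<comment> \<open>The times are spaced by at most \<open>?K\<close> from \<open>init_cost\<close>
    on, one for each solution. What follows the last output is at most \<open>max_potential\<close>
    and a final guard.\<close>
  have "last (output_times m n ?evs tp) \<le> init_cost + card (solutions ?evs) * ?K"
    using spaced_last[OF c'(6)] c'(5,7) s by simp
  then have total: "clock e \<le> init_cost + max_potential + 10 + card (solutions ?evs) * ?K"
    using c'(8) ecl by linarith
  show ?thesis
    unfolding timely_run_def Let_def m_def[symmetric] n_def[symmetric] N_def[symmetric]
  proof (intro exI[of _ e] exI[of _ ?evs] conjI impI allI)
    show "exec main_prog (start P inn out ch) e" by (fact e)
    show "enumerate_stable P pick inn out = Some ?evs" by (fact assms(4))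
    show "map snd (tape e) = concat (map (encode_event m n) ?evs)" using c'(3) etp by simp
    assume N: "N > 0"
    then have bounds: "init_cost + max_potential + 10 \<le> cost_bound * N ^ 3" "?K \<le> cost_bound * N ^ 3"
      using costs by simp_all
    have "card (solutions ?evs) * ?K \<le> card (solutions ?evs) * (cost_bound * N ^ 3)"
      using bounds(2) by (rule mult_left_mono) simp
    moreover have "cost_bound * (N ^ 3 + N ^ 3 * card (solutions ?evs)) =
        cost_bound * N ^ 3 + card (solutions ?evs) * (cost_bound * N ^ 3)"
      by (simp add: algebra_simps)
    ultimately show "clock e \<le> cost_bound * (N ^ 3 + N ^ 3 * card (solutions ?evs))"
      using total bounds(1) by linarith
    fix k assume "Suc k < length (output_times m n ?evs (tape e))"
    then have "output_times m n ?evs tp ! Suc k \<le> output_times m n ?evs tp ! k + ?K"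
      using spaced_nth[OF c'(6)] etp by simp
    then show "output_times m n ?evs (tape e) ! Suc k \<le> output_times m n ?evs (tape e) ! k + cost_bound * N ^ 3"
      using bounds(2) etp by simp
  qed
qed

text \<open>Rule and program may prune to different digraphs here, but both fail and log only the
  arguments of the single call. Hence any choices go with any rule.\<close>

lemma timely_fail:
  assumes "valid_constraints P inn out" "sols nf inn out = {}" "choice_rule pick"
  shows "timely_run main_prog cost_bound P inn out ch pick"
proof -
  let ?evs = "[Call nf inn out]"
  note args = initial_args[OF assms(1)]
  obtain c where c: "exec init (start P inn out ch) c" "call_state (mem c) 1 nf inn out" "tape c = []" "clock c \<le> init_cost"
    using init[of "start P inn out ch" inn out] by (auto simp: start_simps)
  obtain c' where c': "step c c'" "map snd (tape c') = encode_event m n (Call nf inn out)" "mem c' aDepth [] = 0"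
    "clock c' \<le> clock c + body_cost + delete_cost * card nf"
    using step_fail[OF c(2) args zero_less_one assms(2)] c(3) by auto
  define e where "e = tick (1 + bcost (pos (rd aDepth))) c'"
  have e: "exec main_prog (start P inn out ch) e"
    unfolding main_prog_def e_def by (rule exec.Seq[OF c(1) steps_While[OF r_into_rtranclp[of step, OF c'(1)] c'(3)]])
  have etp: "tape e = tape c'" and ecl: "clock e = clock c' + 4" by (simp_all add: e_def tick_def)
  have "body_cost * 1 \<le> body_cost * (N + 1)" by (intro mult_left_mono) auto
  moreover have "delete_cost * card nf \<le> delete_cost * (N * N)" using card_digraph[OF nf(1)] by (rule mult_left_mono) simp
  ultimately have total: "clock e \<le> init_cost + max_potential + 10"
    unfolding max_potential_def using c(4) c'(4) ecl by linarith
  have evs: "enumerate_stable P pick inn out = Some ?evs"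
    using enumerate_rec_unfold(1)[OF nf(1,2) assms(3,2)] by (simp add: enumerate_stable_eq)
  show ?thesis
    unfolding timely_run_def Let_def m_def[symmetric] n_def[symmetric] N_def[symmetric]
  proof (intro exI[of _ e] exI[of _ ?evs] conjI impI allI)
    show "exec main_prog (start P inn out ch) e" by (fact e)
    show "enumerate_stable P pick inn out = Some ?evs" by (fact evs)
    show "map snd (tape e) = concat (map (encode_event m n) ?evs)" using c'(2) etp by simp
    assume "N > 0"
    then have "clock e \<le> cost_bound * N ^ 3" using costs(1) total by simp
    then show "clock e \<le> cost_bound * (N ^ 3 + N ^ 3 * card (solutions ?evs))"
      by (simp add: add_mult_distrib2)
  qed simp
qed

lemma timely_for_choices:
  assumes "valid_constraints P inn out"
  shows "\<exists>pick. choice_rule pick \<and> timely_run main_prog cost_bound P inn out ch pick"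
proof (cases "sols nf inn out = {}")
  case True
  have "choice_rule (\<lambda>(p :: bool list) X. SOME x :: nat \<times> nat. x \<in> X)"
    by (simp add: choice_rule_def some_in_eq)
  then show ?thesis using timely_fail[OF assms True] by blast
next
  case False
  obtain t ch' where t: "rec_tree t nf inn out" "chooses t nf inn out ch ch'"
    using tree_of_choices[OF nf(1,2) False] by blast
  \<comment> \<open>The rule follows the labels of the tree; elsewhere an arbitrary element keeps it
    a choice rule.\<close>
  define pick where "pick p X = (case label t p of Some x \<Rightarrow> if x \<in> X then x else SOME x. x \<in> X
    | None \<Rightarrow> SOME x. x \<in> X)" for p X
  have pick: "choice_rule pick"
    by (auto simp: choice_rule_def pick_def some_in_eq split: option.splits)
  have "enumerate_stable P pick inn out = Some (log_tree t nf inn out)"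
    unfolding enumerate_stable_eq
    by (rule enumerate_rec_log_tree[OF t(1) nf(1,2) pick]) (simp add: pick_def)
  then show ?thesis using timely_tree[OF assms t] pick by blast
qed

lemma timely_for_pick:
  assumes "valid_constraints P inn out" "choice_rule pick"
  shows "\<exists>ch. timely_run main_prog cost_bound P inn out ch pick"
proof (cases "sols nf inn out = {}")
  case True
  then show ?thesis using timely_fail assms by blast
next
  case False
  obtain t where t: "rec_tree t nf inn out" "enumerate_stable P pick inn out = Some (log_tree t nf inn out)"
    using rec_tree_of_pick[OF nf(1,2) False assms(2)] by (auto simp: enumerate_stable_eq)
  \<comment> \<open>The choices left over after the run are immaterial; they are set to 0.\<close>
  obtain ch where "chooses t nf inn out ch (\<lambda>_. 0)" using chooses_of_tree[OF t(1) nf(1,2)] by blast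
  then show ?thesis using timely_tree[OF assms(1) t(1) _ t(2)] by blast
qed

end

theorem theorem1:
  shows "(\<forall>(P :: ('w, 'f) market) Vin Vout pick.
            valid_market P \<and> valid_constraints P Vin Vout \<and> choice_rule pick \<longrightarrow>
            (\<exists>evs. enumerate_stable P pick Vin Vout = Some evs \<and>
               solutions evs =
                 {M. stable_matching P (vertices P) M \<and> Vin \<subseteq> M \<and> M \<inter> Vout = {}}))
       \<and> (\<exists>prog C. \<forall>P Vin Vout.
            valid_market P \<and> numbered_market P \<and> valid_constraints P Vin Vout \<longrightarrow>
            (\<forall>ch. \<exists>pick. choice_rule pick \<and> timely_run prog C P Vin Vout ch pick) \<and>
            (\<forall>pick. choice_rule pick \<longrightarrow> (\<exists>ch. timely_run prog C P Vin Vout ch pick)))"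
proof (rule conjI)
  have "\<exists>evs. enumerate_stable P pick Vin Vout = Some evs \<and>
      solutions evs = {M. stable_matching P (vertices P) M \<and> Vin \<subseteq> M \<and> M \<inter> Vout = {}}"
    if "valid_market P" "choice_rule pick"
    for P :: "('w, 'f) market" and Vin Vout pick
  proof -
    interpret market P by unfold_locales (fact that(1))
    show ?thesis using enumerate_stable_correct[OF that(2)] .
  qed
  then show "\<forall>(P :: ('w, 'f) market) Vin Vout pick.
      valid_market P \<and> valid_constraints P Vin Vout \<and> choice_rule pick \<longrightarrow>
      (\<exists>evs. enumerate_stable P pick Vin Vout = Some evs \<and>
         solutions evs = {M. stable_matching P (vertices P) M \<and> Vin \<subseteq> M \<and> M \<inter> Vout = {}})"
    by blast
next
  have "(\<forall>ch. \<exists>pick. choice_rule pick \<and> timely_run main_prog cost_bound P Vin Vout ch pick) \<and>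
      (\<forall>pick. choice_rule pick \<longrightarrow> (\<exists>ch. timely_run main_prog cost_bound P Vin Vout ch pick))"
    if "valid_market P" "numbered_market P" "valid_constraints P Vin Vout" for P Vin Vout
  proof -
    interpret numbered P by unfold_locales (fact that)+
    show ?thesis using timely_for_choices[OF that(3)] timely_for_pick[OF that(3)] by blast
  qed
  then show "\<exists>prog C. \<forall>P Vin Vout.
      valid_market P \<and> numbered_market P \<and> valid_constraints P Vin Vout \<longrightarrow>
      (\<forall>ch. \<exists>pick. choice_rule pick \<and> timely_run prog C P Vin Vout ch pick) \<and>
      (\<forall>pick. choice_rule pick \<longrightarrow> (\<exists>ch. timely_run prog C P Vin Vout ch pick))"
    by blast
qed

end
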